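(* Let $R$ be a field and suppose $(X,Y)$ is a relative pair of precubical sets. Then there is a long exact sequence of $R[X]$-bimodules (the relative homology sequence) $$\cdots\to HM_{i+1}[X]\to HM_{i+1}[X,Y]\xrightarrow{\partial_*}{}^X HM_i[Y]\to HM_i[X]\to HM_i[X,Y]\xrightarrow{\partial_*}\cdots\to HM_1[X]\to HM_1[X,Y]\to 0 .$$
   Context: $R$ is a field. A precubical set $X$ is a graded set $(X_n)_{n\in\mathbb N}$ with maps $d^0_i,d^1_i:X_n\to X_{n-1}$ ($0\le i\le n-1$) such that $d^k_i d^l_j=d^l_{j-1}d^k_i$ for $i<j$, $k,l\in\{0,1\}$. For $I=\{i_1<\dots<i_k\}$ put $d^\epsilon_I=d^\epsilon_{i_1}\circ\dots\circ d^\epsilon_{i_k}$; for an $n$-cube $c$ put $d^\epsilon(c)=d^\epsilon_{\{0,\dots,n-1\}}(c)\in X_0$. A finite precubical set $X$ is in $Cub$ if its non-looping length covering $\tilde X$ ($\tilde X_n=X_n\times\mathbb Z$, $d^\epsilon_i(c,k)=(d^\epsilon_i(c),k+\epsilon)$) is proper, i.e. the map $c\mapsto\{d^0(c),d^1(c)\}$ on its cubes is injective. A cube chain from $v$ to $w$ is a sequence $c=(c_1,\dots,c_l)$, $l\ge0$, $c_k\in X_{n_k}$, $n_k>0$, with either $l=0$ and $v=w$, or $d^0(c_1)=v$, $d^1(c_l)=w$ and $d^1(c_k)=d^0(c_{k+1})$. Its dimension is $n_1+\dots+n_l-l$; $Ch^{=m}(X)$ is the set of cube chains of dimension $m$. The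 path algebra $R[X]$ has as $R$-basis $Ch^{=0}(X)$ (directed paths, including constant paths $e_v$), with product the concatenation if defined and $0$ otherwise. For $i\ge1$, $R_i[X]$ is the $R$-vector space with basis $Ch^{=i-1}(X)$, an $R[X]$-bimodule via concatenation: $p\bullet r\bullet q$ is the concatenation if endpoints match, $0$ otherwise. The boundary $\partial:R_{i+1}[X]\to R_i[X]$ ($i\ge1$) is $$\partial c=\sum_{k=1}^l\sum_{r=1}^{n_k-1}\sum_{I\subseteq\{0,\dots,n_k-1\},|I|=r}(-1)^{n_1+\dots+n_{k-1}+k+r+1}\mathrm{sgn}(I)\,d_{k,I}(c),$$ with $d_{k,I}(c)=(c_1,\dots,c_{k-1},d^0_{\overline I}(c_k),d^1_I(c_k),c_{k+1},\dots,c_l)$, $\overline I=\{0,\dots,n_k-1\}\setminus I$, and $\mathrm{sgn}(I)=1$ if $\sum_{j\in I}(j+1)\equiv\sum_{j=1}^r j \bmod 2$, $-1$ otherwise; $\partial=0$ on $R_1[X]$. For $i\ge1$, $HM_i[X]=\mathrm{Ker}\,\partial_{|R_i[X]}/\mathrm{Im}\,\partial_{|R_{i+1}[X]}$, an $R[X]$-bimodule. Relative pair: for $X\in Cub$ and $Y$ a sub-precubical set of $X$, $(X,Y)$ is a relative pair if for all $c=(c_1,\dots,c_m)\in Ch^{=0}(X)$: if $d^0(c_1)\in Y_0$, there exists $k\in\{1,\dots,m\}$ such that $c_l\notin Y$ for all $l>k$ and $c_l\in Y$ for all $l<k$; and if $d^1(c_m)\in Y_0$, there exists $k\in\{1,\dots,m\}$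 such that $c_l\in Y$ for all $l>k$ and $c_l\notin Y$ for all $l<k$. Extension of scalars: for $Y\subseteq X$ and an $R[Y]$-bimodule $M$, ${}^XM=R[X]\otimes_{R[Y]}M\otimes_{R[Y]}R[X]$, with $R[X]$ an $R[Y]$-bimodule through the inclusion $R[Y]\to R[X]$, and with the evident $R[X]$-bimodule structure. Relative homology: ${}^XR_i[Y]$ is regarded as the sub-$R[X]$-bimodule of $R_i[X]$ via $p\otimes c\otimes q\mapsto p\bullet c\bullet q$, and $HM_i[X,Y]$ ($i\ge1$) is the $i$th homology of the chain complex of $R[X]$-bimodules $R_*[X]/{}^XR_*[Y]$ with boundary $\partial[x]=[\partial x]$.
   Formalization: It is additionally assumed that the maps p⊗c⊗q ↦ p•c•q from ^XR_i[Y] to R_i[X] are injective for all i ≥ 1; relative pairs need not satisfy this (one edge with Y its two endpoints), and the sequence then fails to be exact. *)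

theory Defs
  imports "HOL-Algebra.Free_Abelian_Groups" "HOL-Algebra.Generated_Groups" "HOL-Algebra.AbelCoset"
    "HOL-Algebra.Module"
begin

section \<open>Precubical sets\<close>

text \<open>The face map d^e_i : X_n -> X_(n-1) is \<open>face X e n i\<close>, where \<open>False\<close> stands for the exponent 0
  and \<open>True\<close> for 1. The sets X_n need not be disjoint, so a cube is a pair (n, x) with x in X_n.\<close>

record 'a precubical =
  cells :: "nat \<Rightarrow> 'a set"
  face :: "bool \<Rightarrow> nat \<Rightarrow> nat \<Rightarrow> 'a \<Rightarrow> 'a"

definition precubical_set :: "'a precubical \<Rightarrow> bool" where
  "precubical_set X \<longleftrightarrow>
     (\<forall>e n i. \<forall>x\<in>cells X n. i < n \<longrightarrow> face X e n i x \<in> cells X (n - 1)) \<and>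
     (\<forall>k l n i j. \<forall>x\<in>cells X n. i < j \<and> j < n \<longrightarrow>
        face X k (n - 1) i (face X l n j x) = face X l (n - 1) (j - 1) (face X k n i x))"

definition cubes :: "'a precubical \<Rightarrow> (nat \<times> 'a) set" where
  "cubes X = (SIGMA n:UNIV. cells X n)"

primrec face_seq :: "'a precubical \<Rightarrow> bool \<Rightarrow> nat \<Rightarrow> nat list \<Rightarrow> 'a \<Rightarrow> 'a" where
  "face_seq X e n [] x = x"
| "face_seq X e n (i # is) x = face_seq X e (n - 1) is (face X e n i x)"

text \<open>In the composite d_(i_1) o ... o d_(i_k) with i_1 < ... < i_k the largest index acts first.\<close>

definition multi_face :: "'a precubical \<Rightarrow> bool \<Rightarrow> nat \<Rightarrow> nat set \<Rightarrow> 'a \<Rightarrow> 'a" where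
  "multi_face X e n I x = face_seq X e n (rev (sorted_list_of_set I)) x"

definition vertex :: "'a precubical \<Rightarrow> bool \<Rightarrow> nat \<times> 'a \<Rightarrow> 'a" where
  "vertex X e c = multi_face X e (fst c) {..<fst c} (snd c)"

definition proper :: "'a precubical \<Rightarrow> bool" where
  "proper X \<longleftrightarrow> inj_on (\<lambda>c. {vertex X False c, vertex X True c}) (cubes X)"

definition length_covering :: "'a precubical \<Rightarrow> ('a \<times> int) precubical" where
  "length_covering X = \<lparr>cells = (\<lambda>n. cells X n \<times> UNIV),
     face = (\<lambda>e n i (c, k). (face X e n i c, k + of_bool e))\<rparr>"

definition Cub :: "'a precubical set" where
  "Cub = {X. precubical_set X \<and> finite (cubes X) \<and> proper (length_covering X)}"

definition sub_precubical :: "'a precubical \<Rightarrow> 'a precubical \<Rightarrow> bool" where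
  "sub_precubical Y X \<longleftrightarrow> precubical_set Y \<and> (\<forall>n. cells Y n \<subseteq> cells X n) \<and>
     (\<forall>e n i. \<forall>x\<in>cells Y n. i < n \<longrightarrow> face Y e n i x = face X e n i x)"


section \<open>Cube chains\<close>

text \<open>A cube chain is stored as (v, cs, w) with its end points, which is what distinguishes the
  constant paths e_v = (v, [], v).\<close>

type_synonym 'a cchain = "'a \<times> (nat \<times> 'a) list \<times> 'a"

definition cube_chain :: "'a precubical \<Rightarrow> 'a cchain \<Rightarrow> bool" where
  "cube_chain X = (\<lambda>(v, cs, w).
     v \<in> cells X 0 \<and> w \<in> cells X 0 \<and> set cs \<subseteq> cubes X \<and> (\<forall>c\<in>set cs. fst c > 0) \<and>
     (if cs = [] then v = w
      else vertex X False (hd cs) = v \<and> vertex X True (last cs) = w \<and>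
           (\<forall>k. Suc k < length cs \<longrightarrow> vertex X True (cs ! k) = vertex X False (cs ! Suc k))))"

definition cdim :: "'a cchain \<Rightarrow> nat" where
  "cdim = (\<lambda>(v, cs, w). sum_list (map fst cs) - length cs)"

definition Ch :: "'a precubical \<Rightarrow> nat \<Rightarrow> 'a cchain set" where
  "Ch X m = {c. cube_chain X c \<and> cdim c = m}"

definition relative_pair :: "'a precubical \<Rightarrow> 'a precubical \<Rightarrow> bool" where
  "relative_pair X Y \<longleftrightarrow> X \<in> Cub \<and> sub_precubical Y X \<and>
     (\<forall>v cs w. (v, cs, w) \<in> Ch X 0 \<and> cs \<noteq> [] \<longrightarrow>
        (vertex X False (hd cs) \<in> cells Y 0 \<longrightarrow>
           (\<exists>k<length cs. (\<forall>l<length cs. (l > k \<longrightarrow> cs ! l \<notin> cubes Y) \<and> (l < k \<longrightarrow> cs ! l \<in> cubes Y)))) \<and>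
        (vertex X True (last cs) \<in> cells Y 0 \<longrightarrow>
           (\<exists>k<length cs. (\<forall>l<length cs. (l > k \<longrightarrow> cs ! l \<in> cubes Y) \<and> (l < k \<longrightarrow> cs ! l \<notin> cubes Y)))))"


section \<open>Bimodules\<close>

text \<open>As in the library record of modules, the ring multiplication and unit of the underlying
  record are unused. The field \<open>smult\<close> is the left action.\<close>

record ('l, 'm, 'r) bimodule = "('l, 'm) module" +
  rsmult :: "'m \<Rightarrow> 'r \<Rightarrow> 'm"

locale bimodule = A?: ring A + B?: ring B + M?: abelian_group M
  for A :: "('l, 'x) ring_scheme" and B :: "('r, 'y) ring_scheme"
    and M :: "('l, 'm, 'r, 'z) bimodule_scheme" +
  assumes lact_closed: "\<lbrakk>a \<in> carrier A; x \<in> carrier M\<rbrakk> \<Longrightarrow> smult M a x \<in> carrier M"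
    and ract_closed: "\<lbrakk>x \<in> carrier M; b \<in> carrier B\<rbrakk> \<Longrightarrow> rsmult M x b \<in> carrier M"
    and lact_add: "\<lbrakk>a \<in> carrier A; x \<in> carrier M; y \<in> carrier M\<rbrakk> \<Longrightarrow>
      smult M a (x \<oplus>\<^bsub>M\<^esub> y) = smult M a x \<oplus>\<^bsub>M\<^esub> smult M a y"
    and ract_add: "\<lbrakk>x \<in> carrier M; y \<in> carrier M; b \<in> carrier B\<rbrakk> \<Longrightarrow>
      rsmult M (x \<oplus>\<^bsub>M\<^esub> y) b = rsmult M x b \<oplus>\<^bsub>M\<^esub> rsmult M y b"
    and add_lact: "\<lbrakk>a \<in> carrier A; a' \<in> carrier A; x \<in> carrier M\<rbrakk> \<Longrightarrow>
      smult M (a \<oplus>\<^bsub>A\<^esub> a') x = smult M a x \<oplus>\<^bsub>M\<^esub> smult M a' x"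
    and add_ract: "\<lbrakk>x \<in> carrier M; b \<in> carrier B; b' \<in> carrier B\<rbrakk> \<Longrightarrow>
      rsmult M x (b \<oplus>\<^bsub>B\<^esub> b') = rsmult M x b \<oplus>\<^bsub>M\<^esub> rsmult M x b'"
    and lact_assoc: "\<lbrakk>a \<in> carrier A; a' \<in> carrier A; x \<in> carrier M\<rbrakk> \<Longrightarrow>
      smult M (a \<otimes>\<^bsub>A\<^esub> a') x = smult M a (smult M a' x)"
    and ract_assoc: "\<lbrakk>x \<in> carrier M; b \<in> carrier B; b' \<in> carrier B\<rbrakk> \<Longrightarrow>
      rsmult M x (b \<otimes>\<^bsub>B\<^esub> b') = rsmult M (rsmult M x b) b'"
    and lact_ract: "\<lbrakk>a \<in> carrier A; x \<in> carrier M; b \<in> carrier B\<rbrakk> \<Longrightarrow>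
      rsmult M (smult M a x) b = smult M a (rsmult M x b)"
    and one_lact: "x \<in> carrier M \<Longrightarrow> smult M \<one>\<^bsub>A\<^esub> x = x"
    and ract_one: "x \<in> carrier M \<Longrightarrow> rsmult M x \<one>\<^bsub>B\<^esub> = x"

definition bimodule_hom :: "('l, 'x) ring_scheme \<Rightarrow> ('r, 'y) ring_scheme \<Rightarrow>
    ('l, 'm, 'r) bimodule \<Rightarrow> ('l, 'n, 'r) bimodule \<Rightarrow> ('m \<Rightarrow> 'n) set" where
  "bimodule_hom A B M N = {h \<in> hom (add_monoid M) (add_monoid N).
     (\<forall>a\<in>carrier A. \<forall>x\<in>carrier M. h (smult M a x) = smult N a (h x)) \<and>
     (\<forall>x\<in>carrier M. \<forall>b\<in>carrier B. h (rsmult M x b) = rsmult N (h x) b)}"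

text \<open>\<open>quot_map P N f\<close> is the map [x] |-> f(x) + N induced on cosets; it is meaningful when f sends
  the subgroup whose cosets form the source into N.\<close>

definition quot_map :: "('p, 'z) ring_scheme \<Rightarrow> 'p set \<Rightarrow> ('m \<Rightarrow> 'p) \<Rightarrow> 'm set \<Rightarrow> 'p set" where
  "quot_map P N f C = (\<Union>x\<in>C. N +>\<^bsub>P\<^esub> f x)"

definition quot_bimodule :: "('l, 'm, 'r) bimodule \<Rightarrow> 'm set \<Rightarrow> ('l, 'm set, 'r) bimodule" where
  "quot_bimodule M N =
     \<lparr>carrier = a_rcosets\<^bsub>M\<^esub> N, mult = undefined, one = undefined, zero = N, add = set_add M,
      smult = (\<lambda>a. quot_map M N (\<lambda>x. smult M a x)),
      rsmult = (\<lambda>C b. quot_map M N (\<lambda>x. rsmult M x b) C)\<rparr>"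

text \<open>Homology at M of L --f--> M --g--> N.\<close>

definition homology :: "('l, 'k, 'r) bimodule \<Rightarrow> ('l, 'm, 'r) bimodule \<Rightarrow> ('l, 'n, 'r) bimodule \<Rightarrow>
    ('k \<Rightarrow> 'm) \<Rightarrow> ('m \<Rightarrow> 'n) \<Rightarrow> ('l, 'm set, 'r) bimodule" where
  "homology L M N f g = quot_bimodule (M\<lparr>carrier := a_kernel M N g\<rparr>) (f ` carrier L)"

definition exact_at :: "('l, 'k, 'r) bimodule \<Rightarrow> ('l, 'm, 'r) bimodule \<Rightarrow> ('l, 'n, 'r) bimodule \<Rightarrow>
    ('k \<Rightarrow> 'm) \<Rightarrow> ('m \<Rightarrow> 'n) \<Rightarrow> bool" where
  "exact_at L M N f g \<longleftrightarrow> f ` carrier L = a_kernel M N g"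

subsection \<open>Tensor products\<close>

text \<open>The tensor product over A is the free abelian group on carrier M x carrier N modulo the
  subgroup generated by the biadditivity and A-balancedness relations. The ring A need not act
  unitally on the factors.\<close>

definition free_pairs :: "('l, 'm, 's) bimodule \<Rightarrow> ('s, 'n, 'r) bimodule \<Rightarrow>
    ('l, ('m \<times> 'n) \<Rightarrow>\<^sub>0 int, 'r) bimodule" where
  "free_pairs M N =
     \<lparr>carrier = carrier (free_Abelian_group (carrier M \<times> carrier N)),
      mult = undefined, one = undefined, zero = 0, add = (+),
      smult = (\<lambda>a. frag_extend (\<lambda>(m, n). frag_of (smult M a m, n))),
      rsmult = (\<lambda>f b. frag_extend (\<lambda>(m, n). frag_of (m, rsmult N n b)) f)\<rparr>"

definition tensor_rels :: "('s, 'x) ring_scheme \<Rightarrow> ('l, 'm, 's) bimodule \<Rightarrow> ('s, 'n, 'r) bimodule \<Rightarrow>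
    (('m \<times> 'n) \<Rightarrow>\<^sub>0 int) set" where
  "tensor_rels A M N = generate (free_Abelian_group (carrier M \<times> carrier N))
     ({frag_of (m \<oplus>\<^bsub>M\<^esub> m', n) - frag_of (m, n) - frag_of (m', n) | m m' n.
         m \<in> carrier M \<and> m' \<in> carrier M \<and> n \<in> carrier N} \<union>
      {frag_of (m, n \<oplus>\<^bsub>N\<^esub> n') - frag_of (m, n) - frag_of (m, n') | m n n'.
         m \<in> carrier M \<and> n \<in> carrier N \<and> n' \<in> carrier N} \<union>
      {frag_of (rsmult M m a, n) - frag_of (m, smult N a n) | m a n.
         m \<in> carrier M \<and> a \<in> carrier A \<and> n \<in> carrier N})"

definition tensor :: "('s, 'x) ring_scheme \<Rightarrow> ('l, 'm, 's) bimodule \<Rightarrow> ('s, 'n, 'r) bimodule \<Rightarrow>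
    ('l, (('m \<times> 'n) \<Rightarrow>\<^sub>0 int) set, 'r) bimodule" where
  "tensor A M N = quot_bimodule (free_pairs M N) (tensor_rels A M N)"

definition pure_tensor :: "('s, 'x) ring_scheme \<Rightarrow> ('l, 'm, 's) bimodule \<Rightarrow> ('s, 'n, 'r) bimodule \<Rightarrow>
    'm \<Rightarrow> 'n \<Rightarrow> (('m \<times> 'n) \<Rightarrow>\<^sub>0 int) set" where
  "pure_tensor A M N m n = tensor_rels A M N +>\<^bsub>free_pairs M N\<^esub> frag_of (m, n)"

text \<open>The additive map out of a tensor product induced by a biadditive balanced map \<open>\<phi>\<close> into P.\<close>

definition tensor_lift :: "('p, 'z) ring_scheme \<Rightarrow> ('m \<times> 'n \<Rightarrow> 'p) \<Rightarrow>
    (('m \<times> 'n) \<Rightarrow>\<^sub>0 int) set \<Rightarrow> 'p" where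
  "tensor_lift P \<phi> T = the_elem
     ((\<lambda>f. \<Oplus>\<^bsub>P\<^esub>k\<in>Poly_Mapping.keys f. [Poly_Mapping.lookup f k] \<cdot>\<^bsub>P\<^esub> \<phi> k) ` T)"


section \<open>Path algebra, homology modules, extension of scalars\<close>

text \<open>R-linear combinations of cube chains are finitely supported functions on cube chains. The
  argument of type \<open>'r itself\<close> names the coefficient field R.\<close>

type_synonym ('a, 'r) chains = "'a cchain \<Rightarrow>\<^sub>0 'r"

text \<open>Bilinear extension of concatenation: the product of R[X] and both actions on R_i[X]. The
  vector space structure is the action of the scalar multiples of the unit of R[X].\<close>

definition conc :: "('a, 'r::field) chains \<Rightarrow> ('a, 'r) chains \<Rightarrow> ('a, 'r) chains" where
  "conc f g = (\<Sum>(v, cs, w)\<in>Poly_Mapping.keys f. \<Sum>(v', cs', w')\<in>Poly_Mapping.keys g.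
     if w = v' then Poly_Mapping.single (v, cs @ cs', w')
       (Poly_Mapping.lookup f (v, cs, w) * Poly_Mapping.lookup g (v', cs', w')) else 0)"

definition path_algebra :: "'r itself \<Rightarrow> 'a precubical \<Rightarrow> (('a, 'r::field) chains) ring" where
  "path_algebra R X =
     \<lparr>carrier = {f. Poly_Mapping.keys f \<subseteq> Ch X 0}, mult = conc,
      one = (\<Sum>v\<in>cells X 0. Poly_Mapping.single (v, [], v) 1), zero = 0, add = (+)\<rparr>"

text \<open>R_i[X], with basis the chains of dimension i - 1; for i = 0 this is the zero module. The same
  record at i = 1 is R[X] as a bimodule over itself or, by restriction, over R[Y] for Y inside X.\<close>

definition chain_bimodule :: "'r itself \<Rightarrow> 'a precubical \<Rightarrow> nat \<Rightarrow>
    (('a, 'r::field) chains, ('a, 'r) chains, ('a, 'r) chains) bimodule" where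
  "chain_bimodule R X i =
     \<lparr>carrier = {f. \<forall>c\<in>Poly_Mapping.keys f. \<exists>m. m + 1 = i \<and> c \<in> Ch X m},
      mult = undefined, one = undefined, zero = 0, add = (+), smult = conc, rsmult = conc\<rparr>"

text \<open>Lists are indexed from 0, so the index k below is the usual position minus 1.\<close>

definition chain_face :: "'a precubical \<Rightarrow> nat \<Rightarrow> nat set \<Rightarrow> 'a cchain \<Rightarrow> 'a cchain" where
  "chain_face X k I = (\<lambda>(v, cs, w). (let (n, c) = cs ! k in
     (v, take k cs @ [(card I, multi_face X False n ({..<n} - I) c),
                      (n - card I, multi_face X True n I c)] @ drop (Suc k) cs, w)))"

definition sgn_set :: "nat set \<Rightarrow> 'r::field" where
  "sgn_set I = (if (\<Sum>j\<in>I. j + 1) mod 2 = (\<Sum>j=1..card I. j) mod 2 then 1 else - 1)"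

definition boundary :: "'a precubical \<Rightarrow> ('a, 'r::field) chains \<Rightarrow> ('a, 'r) chains" where
  "boundary X f = (\<Sum>(v, cs, w)\<in>Poly_Mapping.keys f.
     \<Sum>k<length cs. \<Sum>r\<in>{1..<fst (cs ! k)}. \<Sum>I\<in>{I. I \<subseteq> {..<fst (cs ! k)} \<and> card I = r}.
       Poly_Mapping.single (chain_face X k I (v, cs, w))
         ((- 1) ^ ((\<Sum>j<k. fst (cs ! j)) + (k + 1) + r + 1) * sgn_set I
           * Poly_Mapping.lookup f (v, cs, w)))"

definition boundaries :: "'r itself \<Rightarrow> 'a precubical \<Rightarrow> nat \<Rightarrow> (('a, 'r::field) chains) set" where
  "boundaries R X i = boundary X ` carrier (chain_bimodule R X (i + 1))"

definition cycles :: "'r itself \<Rightarrow> 'a precubical \<Rightarrow> nat \<Rightarrow> (('a, 'r::field) chains) set" where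
  "cycles R X i = a_kernel (chain_bimodule R X i) (chain_bimodule R X (i - 1)) (boundary X)"

definition HM :: "'r itself \<Rightarrow> 'a precubical \<Rightarrow> nat \<Rightarrow>
    (('a, 'r::field) chains, (('a, 'r) chains) set, ('a, 'r) chains) bimodule" where
  "HM R X i = homology (chain_bimodule R X (i + 1)) (chain_bimodule R X i)
     (chain_bimodule R X (i - 1)) (boundary X) (boundary X)"

type_synonym ('a, 'r, 'm) ext =
  "(((((('a, 'r) chains \<times> 'm) \<Rightarrow>\<^sub>0 int) set) \<times> ('a, 'r) chains) \<Rightarrow>\<^sub>0 int) set"

definition ext_scalars :: "'r itself \<Rightarrow> 'a precubical \<Rightarrow> 'a precubical \<Rightarrow>
    (('a, 'r::field) chains, 'm, ('a, 'r) chains) bimodule \<Rightarrow>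
    (('a, 'r) chains, ('a, 'r, 'm) ext, ('a, 'r) chains) bimodule" where
  "ext_scalars R X Y M =
     tensor (path_algebra R Y) (tensor (path_algebra R Y) (chain_bimodule R X 1) M) (chain_bimodule R X 1)"

definition ext_pure :: "'r itself \<Rightarrow> 'a precubical \<Rightarrow> 'a precubical \<Rightarrow>
    (('a, 'r::field) chains, 'm, ('a, 'r) chains) bimodule \<Rightarrow>
    ('a, 'r) chains \<Rightarrow> 'm \<Rightarrow> ('a, 'r) chains \<Rightarrow> ('a, 'r, 'm) ext" where
  "ext_pure R X Y M p m q =
     pure_tensor (path_algebra R Y) (tensor (path_algebra R Y) (chain_bimodule R X 1) M) (chain_bimodule R X 1)
       (pure_tensor (path_algebra R Y) (chain_bimodule R X 1) M p m) q"

text \<open>For an R[Y]-bimodule map \<open>\<iota>\<close> from M to an R[X]-bimodule P, \<open>ext_hom P \<iota>\<close> is the induced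
  R[X]-bimodule map p (x) m (x) q |-> p \<open>\<iota>\<close>(m) q from the extension of scalars of M to P.\<close>

definition ext_hom :: "(('a, 'r::field) chains, 'p, ('a, 'r) chains) bimodule \<Rightarrow>
    ('m \<Rightarrow> 'p) \<Rightarrow> ('a, 'r, 'm) ext \<Rightarrow> 'p" where
  "ext_hom P \<iota> = tensor_lift P (\<lambda>(t, q).
     rsmult P (tensor_lift P (\<lambda>(p, m). smult P p (\<iota> m)) t) q)"

section \<open>Relative homology\<close>

text \<open>The map p (x) c (x) q |-> p c q from the extension of scalars of R_i[Y] to R_i[X].\<close>

definition ext_incl :: "'r itself \<Rightarrow> 'a precubical \<Rightarrow> nat \<Rightarrow>
    ('a, 'r::field, ('a, 'r) chains) ext \<Rightarrow> ('a, 'r) chains" where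
  "ext_incl R X i = ext_hom (chain_bimodule R X i) (\<lambda>c. c)"

text \<open>Regarding the extension of scalars of R_i[Y] as a sub-bimodule of R_i[X] presupposes that
  \<open>ext_incl\<close> is injective. This does not follow from \<open>relative_pair\<close>: if X is a single edge a from v
  to w and Y = {v, w}, then a (x) e_w (x) e_w and e_v (x) e_v (x) a are distinct but both are sent
  to a (and the relative homology sequence fails to be exact). Hence the following predicate.\<close>

definition ext_embeds :: "'r::field itself \<Rightarrow> 'a precubical \<Rightarrow> 'a precubical \<Rightarrow> bool" where
  "ext_embeds R X Y \<longleftrightarrow>
     (\<forall>i\<ge>1. inj_on (ext_incl R X i) (carrier (ext_scalars R X Y (chain_bimodule R Y i))))"

definition rel_sub :: "'r itself \<Rightarrow> 'a precubical \<Rightarrow> 'a precubical \<Rightarrow> nat \<Rightarrow>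
    (('a, 'r::field) chains) set" where
  "rel_sub R X Y i = ext_incl R X i ` carrier (ext_scalars R X Y (chain_bimodule R Y i))"

definition rel_chain_bimodule :: "'r itself \<Rightarrow> 'a precubical \<Rightarrow> 'a precubical \<Rightarrow> nat \<Rightarrow>
    (('a, 'r::field) chains, (('a, 'r) chains) set, ('a, 'r) chains) bimodule" where
  "rel_chain_bimodule R X Y i = quot_bimodule (chain_bimodule R X i) (rel_sub R X Y i)"

text \<open>The boundary [x] |-> [\<open>\<partial>\<close> x] from degree i + 1 to degree i.\<close>

definition rel_boundary :: "'r itself \<Rightarrow> 'a precubical \<Rightarrow> 'a precubical \<Rightarrow> nat \<Rightarrow>
    (('a, 'r::field) chains) set \<Rightarrow> (('a, 'r) chains) set" where
  "rel_boundary R X Y i = quot_map (chain_bimodule R X i) (rel_sub R X Y i) (boundary X)"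

definition HM_rel :: "'r itself \<Rightarrow> 'a precubical \<Rightarrow> 'a precubical \<Rightarrow> nat \<Rightarrow>
    (('a, 'r::field) chains, (('a, 'r) chains) set set, ('a, 'r) chains) bimodule" where
  "HM_rel R X Y i = homology (rel_chain_bimodule R X Y (i + 1)) (rel_chain_bimodule R X Y i)
     (rel_chain_bimodule R X Y (i - 1)) (rel_boundary R X Y i) (rel_boundary R X Y (i - 1))"

definition rel_boundaries :: "'r itself \<Rightarrow> 'a precubical \<Rightarrow> 'a precubical \<Rightarrow> nat \<Rightarrow>
    (('a, 'r::field) chains) set set" where
  "rel_boundaries R X Y i = rel_boundary R X Y i ` carrier (rel_chain_bimodule R X Y (i + 1))"

definition HM_class :: "'r itself \<Rightarrow> 'a precubical \<Rightarrow> nat \<Rightarrow>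
    ('a, 'r::field) chains \<Rightarrow> (('a, 'r) chains) set" where
  "HM_class R X i z = boundaries R X i +>\<^bsub>chain_bimodule R X i\<^esub> z"

text \<open>The class in HM_i[X,Y] of the coset [x].\<close>

definition HM_rel_class :: "'r itself \<Rightarrow> 'a precubical \<Rightarrow> 'a precubical \<Rightarrow> nat \<Rightarrow>
    ('a, 'r::field) chains \<Rightarrow> (('a, 'r) chains) set set" where
  "HM_rel_class R X Y i x = rel_boundaries R X Y i +>\<^bsub>rel_chain_bimodule R X Y i\<^esub>
     (rel_sub R X Y i +>\<^bsub>chain_bimodule R X i\<^esub> x)"

text \<open>p (x) [z] (x) q |-> [p z q], from the extension of scalars of HM_i[Y] to HM_i[X].\<close>

definition HM_incl :: "'r itself \<Rightarrow> 'a precubical \<Rightarrow> nat \<Rightarrow>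
    ('a, 'r::field, (('a, 'r) chains) set) ext \<Rightarrow> (('a, 'r) chains) set" where
  "HM_incl R X i = ext_hom (HM R X i) (quot_map (chain_bimodule R X i) (boundaries R X i) (\<lambda>z. z))"

text \<open>[z] |-> [[z]], from HM_i[X] to HM_i[X,Y].\<close>

definition HM_proj :: "'r itself \<Rightarrow> 'a precubical \<Rightarrow> 'a precubical \<Rightarrow> nat \<Rightarrow>
    (('a, 'r::field) chains) set \<Rightarrow> (('a, 'r) chains) set set" where
  "HM_proj R X Y i = quot_map (rel_chain_bimodule R X Y i) (rel_boundaries R X Y i)
     (\<lambda>z. rel_sub R X Y i +>\<^bsub>chain_bimodule R X i\<^esub> z)"

text \<open>\<open>\<delta>\<close> is the connecting map from HM_(i+1)[X,Y] to the extension of scalars of HM_i[Y]: if the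
  boundary of x is a sum of p_j z_j q_j with cycles z_j of Y, it sends the class of [x] to the sum of
  p_j (x) [z_j] (x) q_j.\<close>

definition connecting_map :: "'r itself \<Rightarrow> 'a precubical \<Rightarrow> 'a precubical \<Rightarrow> nat \<Rightarrow>
    ((('a, 'r::field) chains) set set \<Rightarrow> ('a, 'r, (('a, 'r) chains) set) ext) \<Rightarrow> bool" where
  "connecting_map R X Y i \<delta> \<longleftrightarrow>
     (\<forall>x n p z q. x \<in> carrier (chain_bimodule R X (i + 1)) \<and>
        (\<forall>j<n. p j \<in> carrier (path_algebra R X) \<and> z j \<in> cycles R Y i \<and> q j \<in> carrier (path_algebra R X)) \<and>
        boundary X x = (\<Sum>j<(n::nat). conc (conc (p j) (z j)) (q j)) \<longrightarrow>
        \<delta> (HM_rel_class R X Y (i + 1) x) =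
          (\<Oplus>\<^bsub>ext_scalars R X Y (HM R Y i)\<^esub>j\<in>{..<n}.
             ext_pure R X Y (HM R Y i) (p j) (HM_class R Y i (z j)) (q j)))"

end

theory Submission imports Defs begin

text \<open>Write \<open>A\<close> for \<open>R[X]\<close> and \<open>S\<close> for \<open>R[Y]\<close>. The extensions of scalars of the chain modules
of \<open>Y\<close> form a subcomplex of the chain modules of \<open>X\<close>, and a subcomplex always has a long exact
homology sequence. What has to be shown is that the homology of this subcomplex is the extension of
scalars of the homology of \<open>Y\<close>, that is, that extension of scalars along the inclusion of \<open>S\<close> into
\<open>A\<close> is exact.

Exactness comes from coordinates. A directed path of \<open>X\<close> that ends in a vertex of \<open>Y\<close> factors
uniquely into a reduced prefix \<open>p\<close>, which is constant or ends with an edge outside \<open>Y\<close>, and a path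
of \<open>Y\<close>: cut in front of the longest final segment inside \<open>Y\<close>. A path that ends outside \<open>Y\<close>
contributes nothing to a tensor product over \<open>S\<close>, because the unit of \<open>S\<close> annihilates it from the
right. On the other side suffixes play the same part. Hence the extension of scalars of an
\<open>S\<close>-bimodule \<open>M\<close> is the direct sum, over reduced prefixes \<open>p\<close> and suffixes \<open>q\<close>, of the groups
\<open>p \<otimes> e M f \<otimes> q\<close> with \<open>e\<close> the constant path at the end of \<open>p\<close> and \<open>f\<close> the one at the start of
\<open>q\<close>. The coordinate \<open>coord p q t\<close> in \<open>M\<close> is found by stripping \<open>p\<close> and \<open>q\<close> off the outer
factors; every \<open>t\<close> is the finite sum of the elements \<open>p \<otimes> coord p q t \<otimes> q\<close> (\<open>coord_expansion\<close>), and
so it vanishes when all its coordinates do (\<open>coord_eq_zero\<close>). Coordinates are natural in \<open>M\<close>: they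
commute with the boundary (\<open>boundary_lift\<close>) and with the passage from cycles to homology classes
(\<open>homology_lift\<close>).

Since the extension of scalars of each \<open>R_i[Y]\<close> embeds into \<open>R_i[X]\<close>, identities in the subcomplex can be
tested on coordinates. A cycle of the subcomplex has cycles of \<open>Y\<close> as coordinates (\<open>coord_cycle\<close>),
and if it bounds in the subcomplex its coordinates bound in \<open>Y\<close> (\<open>comparison_kernel\<close>). Therefore
the map \<open>comparison\<close>, which sends \<open>p \<otimes> [z] \<otimes> q\<close> to the class of \<open>p z q\<close>, identifies the extension
of scalars of \<open>HM_i[Y]\<close> with the homology of the subcomplex. The connecting map sends the class of
a relative cycle \<open>x\<close> to the element that \<open>comparison\<close> maps to the class of the boundary of \<open>x\<close>, and
exactness is the usual diagram chase.

All this presupposes that the boundary squares to zero and is linear over paths. It satisfies a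
Leibniz rule for concatenation (\<open>boundary_conc\<close>), which gives the linearity and reduces the square to
a single cube (\<open>boundary_boundary_single_cube\<close>). Splitting an \<open>n\<close>-cube twice distributes its
directions over three nonempty parts \<open>A\<close>, \<open>B\<close>, \<open>C\<close> in this order. Each such distribution arises
twice, by splitting off \<open>C\<close> first or \<open>A\<close> first, with the same three cubes and opposite signs, since
the sign of a split counts inversions between its parts.\<close>

section \<open>Linear maps on finitely supported functions\<close>

definition scal :: "'r::field \<Rightarrow> ('c \<Rightarrow>\<^sub>0 'r) \<Rightarrow> ('c \<Rightarrow>\<^sub>0 'r)" where
  "scal a f = Poly_Mapping.map ((*) a) f"

lemma lookup_scal [simp]: "Poly_Mapping.lookup (scal a f) c = a * Poly_Mapping.lookup f c"
  by (simp add: scal_def Poly_Mapping.map.rep_eq when_def)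

lemma scal_simps [simp]: "scal a 0 = 0" "scal 0 f = 0" "scal 1 f = f" "scal a (scal b f) = scal (a * b) f"
  "scal a (Poly_Mapping.single c b) = Poly_Mapping.single c (a * b)" "scal (- 1) f = - f"
  by (auto intro!: poly_mapping_eqI simp: lookup_single when_def)

lemma scal_add: "scal a (f + g) = scal a f + scal a g"
  by (rule poly_mapping_eqI) (simp add: lookup_add algebra_simps)

lemma scal_add_left: "scal (a + b) f = scal a f + scal b f"
  by (rule poly_mapping_eqI) (simp add: lookup_add algebra_simps)

lemma scal_sum: "scal a (sum F S) = (\<Sum>i\<in>S. scal a (F i))"
  by (induction S rule: infinite_finite_induct) (auto simp: scal_add)

definition rlinear :: "(('c \<Rightarrow>\<^sub>0 'r::field) \<Rightarrow> ('d \<Rightarrow>\<^sub>0 'r)) \<Rightarrow> bool" where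
  "rlinear F \<longleftrightarrow> (\<forall>f g. F (f + g) = F f + F g) \<and> (\<forall>a f. F (scal a f) = scal a (F f))"

lemma rlinearD:
  assumes "rlinear F"
  shows "F (f + g) = F f + F g" "F (scal a f) = scal a (F f)" "F 0 = 0" "F (- f) = - F f"
    "F (f - g) = F f - F g" "F (sum h S) = (\<Sum>i\<in>S. F (h i))"
proof -
  show add: "F (f + g) = F f + F g" for f g using assms by (simp add: rlinear_def)
  show sc: "F (scal a f) = scal a (F f)" for a f using assms by (simp add: rlinear_def)
  show z: "F 0 = 0" using sc[of 0 0] by simp
  show m: "F (- f) = - F f" for f using sc[of "-1" f] by simp
  show "F (f - g) = F f - F g" using add[of f "- g"] m by simp
  show "F (sum h S) = (\<Sum>i\<in>S. F (h i))"
    by (induction S rule: infinite_finite_induct) (auto simp: add z)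
qed

lemma poly_mapping_sum_single:
  fixes f :: "'c \<Rightarrow>\<^sub>0 'r::comm_monoid_add"
  shows "f = (\<Sum>c\<in>Poly_Mapping.keys f. Poly_Mapping.single c (Poly_Mapping.lookup f c))"
  by (rule poly_mapping_eqI)
    (auto simp: lookup_sum lookup_single when_def sum.delta in_keys_iff)

lemma chains_induct [consumes 1, case_names zero add single]:
  fixes f :: "'c \<Rightarrow>\<^sub>0 'r::comm_monoid_add"
  assumes "Poly_Mapping.keys f \<subseteq> S" and "P 0"
    and "\<And>f g. \<lbrakk>Poly_Mapping.keys f \<subseteq> S; Poly_Mapping.keys g \<subseteq> S; P f; P g\<rbrakk> \<Longrightarrow> P (f + g)"
    and "\<And>c a. c \<in> S \<Longrightarrow> P (Poly_Mapping.single c a)"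
  shows "P f"
proof -
  let ?s = "\<lambda>c. Poly_Mapping.single c (Poly_Mapping.lookup f c)"
  have "Poly_Mapping.keys (sum ?s T) \<subseteq> S \<and> P (sum ?s T)" if "finite T" "T \<subseteq> S" for T
    using that
  proof (induction T)
    case (insert c T)
    then have "Poly_Mapping.keys (?s c) \<subseteq> S" by (auto split: if_splits)
    moreover have "Poly_Mapping.keys (?s c + sum ?s T) \<subseteq> S"
      using insert keys_add[of "?s c" "sum ?s T"] \<open>Poly_Mapping.keys (?s c) \<subseteq> S\<close> by blast
    ultimately show ?case using insert assms(3,4) by simp
  qed (simp add: assms(2))
  then show ?thesis using assms(1) poly_mapping_sum_single[of f] by (metis finite_keys)
qed

text \<open>Most identities between chains are checked on single chains with coefficient 1 by this rule.\<close>

lemma rlinear_eqI: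
  assumes "rlinear F" "rlinear G" "Poly_Mapping.keys f \<subseteq> S"
    and "\<And>c. c \<in> S \<Longrightarrow> F (Poly_Mapping.single c 1) = G (Poly_Mapping.single c 1)"
  shows "F f = G f"
  using assms(3)
proof (induction rule: chains_induct)
  case (single c a)
  then show ?case using rlinearD(2)[OF assms(1), of a "Poly_Mapping.single c 1"]
      rlinearD(2)[OF assms(2), of a "Poly_Mapping.single c 1"] assms(4) by simp
qed (simp_all add: rlinearD[OF assms(1)] rlinearD[OF assms(2)])

definition lin :: "('c \<Rightarrow> ('d \<Rightarrow>\<^sub>0 'r)) \<Rightarrow> ('c \<Rightarrow>\<^sub>0 'r::field) \<Rightarrow> ('d \<Rightarrow>\<^sub>0 'r)" where
  "lin F f = (\<Sum>c\<in>Poly_Mapping.keys f. scal (Poly_Mapping.lookup f c) (F c))"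

lemma lin_superset:
  assumes "finite S" "Poly_Mapping.keys f \<subseteq> S"
  shows "lin F f = (\<Sum>c\<in>S. scal (Poly_Mapping.lookup f c) (F c))"
  unfolding lin_def using assms by (intro sum.mono_neutral_left) (auto simp: in_keys_iff)

lemma rlinear_lin: "rlinear (lin F)"
  unfolding rlinear_def
proof (intro conjI allI)
  fix f g :: "'a \<Rightarrow>\<^sub>0 'b"
  let ?S = "Poly_Mapping.keys f \<union> Poly_Mapping.keys g"
  have "lin F (f + g) = (\<Sum>c\<in>?S. scal (Poly_Mapping.lookup (f + g) c) (F c))"
    using keys_add[of f g] by (intro lin_superset) auto
  also have "\<dots> = (\<Sum>c\<in>?S. scal (Poly_Mapping.lookup f c) (F c)) + (\<Sum>c\<in>?S. scal (Poly_Mapping.lookup g c) (F c))"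
    by (simp add: lookup_add scal_add_left sum.distrib)
  also have "\<dots> = lin F f + lin F g"
    using lin_superset[of ?S f F] lin_superset[of ?S g F] by simp
  finally show "lin F (f + g) = lin F f + lin F g" .
next
  fix a and f :: "'a \<Rightarrow>\<^sub>0 'b"
  have "lin F (scal a f) = (\<Sum>c\<in>Poly_Mapping.keys f. scal (Poly_Mapping.lookup (scal a f) c) (F c))"
    by (rule lin_superset) (auto simp: in_keys_iff)
  then show "lin F (scal a f) = scal a (lin F f)"
    by (simp add: lin_def scal_sum)
qed

lemma lin_single [simp]: "lin F (Poly_Mapping.single c a) = scal a (F c)"
  by (simp add: lin_def)

lemma rlinear_comp: "rlinear F \<Longrightarrow> rlinear G \<Longrightarrow> rlinear (\<lambda>f. F (G f))"
  by (simp add: rlinear_def)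

lemma rlinear_id: "rlinear (\<lambda>f. f)"
  by (simp add: rlinear_def)

lemma rlinear_add: "rlinear F \<Longrightarrow> rlinear G \<Longrightarrow> rlinear (\<lambda>f. F f + G f)"
  by (simp add: rlinear_def scal_add algebra_simps)

lemma rlinear_scal: "rlinear F \<Longrightarrow> rlinear (\<lambda>f. scal a (F f))"
  by (simp add: rlinear_def scal_add mult.commute)

lemma rlinear_zero: "rlinear (\<lambda>f. 0)"
  by (simp add: rlinear_def)

lemma keys_lin: "Poly_Mapping.keys (lin F f) \<subseteq> (\<Union>c\<in>Poly_Mapping.keys f. Poly_Mapping.keys (F c))"
proof -
  have "Poly_Mapping.keys (lin F f) \<subseteq> (\<Union>c\<in>Poly_Mapping.keys f. Poly_Mapping.keys (scal (Poly_Mapping.lookup f c) (F c)))"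
    unfolding lin_def by (rule keys_sum)
  then show ?thesis by (fastforce simp: in_keys_iff)
qed

lemma rlinear_keys:
  assumes "rlinear F" "Poly_Mapping.keys f \<subseteq> S"
    and "\<And>c. c \<in> S \<Longrightarrow> Poly_Mapping.keys (F (Poly_Mapping.single c 1)) \<subseteq> T"
  shows "Poly_Mapping.keys (F f) \<subseteq> T"
proof -
  have "F f = lin (\<lambda>c. F (Poly_Mapping.single c 1)) f"
    by (rule rlinear_eqI[OF assms(1) rlinear_lin subset_UNIV]) simp
  then show ?thesis using keys_lin[of "\<lambda>c. F (Poly_Mapping.single c 1)" f] assms(2,3) by fastforce
qed

section \<open>Concatenation\<close>

text \<open>Bilinearity of \<open>conc\<close> is not visible in a double sum over supports, which change under addition;
written as an iterated \<open>lin\<close> of its values on pairs of chains, it is bilinear by construction.\<close>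

definition cconc :: "'a cchain \<Rightarrow> 'a cchain \<Rightarrow> ('a, 'r::field) chains" where
  "cconc = (\<lambda>(v, cs, w) (v', cs', w'). if w = v' then Poly_Mapping.single (v, cs @ cs', w') 1 else 0)"

lemma conc_eq_lin: "conc f g = lin (\<lambda>c. lin (cconc c) g) f"
  unfolding conc_def lin_def scal_sum
  by (intro sum.cong refl, clarify, intro sum.cong refl) (auto simp: cconc_def)

lemma rlinear_conc_left: "rlinear (\<lambda>f. conc f g)"
  unfolding conc_eq_lin by (rule rlinear_lin)

lemma rlinear_conc_right: "rlinear (\<lambda>g. conc f g)"
proof -
  have "rlinear (\<lambda>g. \<Sum>c\<in>S. scal (a c) (lin (cconc c) g :: ('a, 'b) chains))"
    if "finite S" for S :: "'a cchain set" and a :: "'a cchain \<Rightarrow> 'b"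
    using that
    by (induction S) (simp_all add: rlinear_zero rlinear_add rlinear_scal rlinear_lin)
  from this[of "Poly_Mapping.keys f" "Poly_Mapping.lookup f"] show ?thesis
    unfolding conc_eq_lin lin_def[where f = f] by simp
qed

lemmas conc_left = rlinearD[OF rlinear_conc_left]
lemmas conc_right = rlinearD[OF rlinear_conc_right]

lemma conc_single:
  "conc (Poly_Mapping.single (v, cs, w) a) (Poly_Mapping.single (v', cs', w') b) =
     (if w = v' then Poly_Mapping.single (v, cs @ cs', w') (a * b) else 0)"
  by (simp add: conc_eq_lin cconc_def)

lemma conc_assoc: "conc (conc f g) h = conc f (conc g h)"
proof (rule rlinear_eqI[where S = UNIV and f = f])
  fix c1 :: "'a cchain"
  let ?s = "Poly_Mapping.single c1 1 :: ('a, 'b) chains"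
  show "conc (conc ?s g) h = conc ?s (conc g h)"
  proof (rule rlinear_eqI[where S = UNIV and f = g])
    fix c2 :: "'a cchain"
    let ?t = "Poly_Mapping.single c2 1 :: ('a, 'b) chains"
    show "conc (conc ?s ?t) h = conc ?s (conc ?t h)"
    proof (rule rlinear_eqI[where S = UNIV and f = h])
      fix c3 :: "'a cchain"
      obtain v1 cs1 w1 v2 cs2 w2 v3 cs3 w3
        where "c1 = (v1, cs1, w1)" "c2 = (v2, cs2, w2)" "c3 = (v3, cs3, w3)"
        by (metis prod_cases3)
      then show "conc (conc ?s ?t) (Poly_Mapping.single c3 1) = conc ?s (conc ?t (Poly_Mapping.single c3 1))"
        by (auto simp: conc_single conc_left conc_right)
    qed (auto intro: rlinear_conc_right rlinear_comp rlinear_conc_left)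
  qed (auto intro: rlinear_comp[OF rlinear_conc_left rlinear_conc_right] rlinear_comp[OF rlinear_conc_right rlinear_conc_left])
qed (auto intro: rlinear_comp[OF rlinear_conc_left rlinear_conc_left] rlinear_conc_left)

section \<open>Iterated faces of a cube\<close>

text \<open>In an iterated face the index of a direction drops with every smaller direction that was collapsed
before. To compare such composites, a direction always keeps its index in the original cube: a
marking \<open>g\<close> says of each direction whether it survives (\<open>None\<close>) or is collapsed to its end \<open>e\<close>
(\<open>Some e\<close>). A surviving direction \<open>i\<close> has the index \<open>i - marked_below g i\<close> in the face.\<close>

definition marked_below :: "(nat \<Rightarrow> bool option) \<Rightarrow> nat \<Rightarrow> nat" where
  "marked_below g i = card {j. j < i \<and> g j \<noteq> None}"

lemma marked_below_0 [simp]: "marked_below g 0 = 0"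
  by (simp add: marked_below_def)

lemma marked_below_Suc [simp]:
  "marked_below g (Suc i) = marked_below g i + (if g i = None then 0 else 1)"
proof -
  have "{j. j < Suc i \<and> g j \<noteq> None} = {j. j < i \<and> g j \<noteq> None} \<union> (if g i = None then {} else {i})"
    by (auto simp: less_Suc_eq split: if_splits)
  then show ?thesis by (auto simp: marked_below_def)
qed

lemma marked_below_le: "marked_below g i \<le> i"
  by (induction i) auto

text \<open>The marked directions below \<open>i\<close> are collapsed from the largest to the smallest, so that none of them
has been renumbered when its turn comes. The argument \<open>d\<close> is the dimension of \<open>x\<close>.\<close>

primrec mixed_face :: "'a precubical \<Rightarrow> (nat \<Rightarrow> bool option) \<Rightarrow> nat \<Rightarrow> nat \<Rightarrow> 'a \<Rightarrow> 'a" where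
  "mixed_face X g 0 d x = x"
| "mixed_face X g (Suc i) d x = (case g i of None \<Rightarrow> mixed_face X g i d x
     | Some e \<Rightarrow> mixed_face X g i (d - 1) (face X e d i x))"

lemma mixed_face_cong:
  "(\<And>j. j < i \<Longrightarrow> g j = h j) \<Longrightarrow> mixed_face X g i d x = mixed_face X h i d x"
  by (induction i arbitrary: d x) (auto split: option.splits)

lemma face_in_cells:
  "precubical_set X \<Longrightarrow> x \<in> cells X n \<Longrightarrow> i < n \<Longrightarrow> face X e n i x \<in> cells X (n - 1)"
  by (auto simp: precubical_set_def)

lemma mixed_face_in_cells:
  assumes "precubical_set X"
  shows "x \<in> cells X d \<Longrightarrow> i \<le> d \<Longrightarrow> mixed_face X g i d x \<in> cells X (d - marked_below g i)"
proof (induction i arbitrary: d x)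
  case (Suc i)
  show ?case
  proof (cases "g i")
    case (Some e)
    have "mixed_face X g i (d - 1) (face X e d i x) \<in> cells X (d - 1 - marked_below g i)"
      using Suc face_in_cells[OF assms] by (intro Suc.IH) auto
    then show ?thesis using Some by simp
  qed (use Suc in auto)
qed simp

text \<open>By the precubical identity the face in a large direction can be exchanged with the faces in smaller
ones; its index drops by the number of them that have been collapsed.\<close>

lemma face_mixed_face:
  assumes "precubical_set X"
  shows "\<lbrakk>x \<in> cells X d; N \<le> M; M < d\<rbrakk> \<Longrightarrow>
    face X e (d - marked_below g N) (M - marked_below g N) (mixed_face X g N d x)
      = mixed_face X g N (d - 1) (face X e d M x)"
proof (induction N arbitrary: d M x)
  case (Suc N)
  show ?case
  proof (cases "g N")
    case (Some e')
    have sw: "face X e (d - 1) (M - 1) (face X e' d N x) = face X e' (d - 1) N (face X e d M x)"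
      using assms Suc.prems unfolding precubical_set_def by (metis Suc_le_eq)
    have "face X e (d - 1 - marked_below g N) (M - 1 - marked_below g N)
        (mixed_face X g N (d - 1) (face X e' d N x))
      = mixed_face X g N (d - 1 - 1) (face X e (d - 1) (M - 1) (face X e' d N x))"
      using Suc.prems face_in_cells[OF assms] by (intro Suc.IH) auto
    then show ?thesis using Some sw by simp
  qed (use Suc in auto)
qed simp

text \<open>If the surviving directions of \<open>g\<close> are renumbered consecutively and then marked by \<open>h\<close>, this is the
resulting marking of the original directions.\<close>

definition merge_marks :: "(nat \<Rightarrow> bool option) \<Rightarrow> (nat \<Rightarrow> bool option) \<Rightarrow> nat \<Rightarrow> bool option" where
  "merge_marks g h i = (case g i of Some e \<Rightarrow> Some e | None \<Rightarrow> h (i - marked_below g i))"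

text \<open>The induction treats the largest direction first. If only \<open>h\<close> marks it, its face has to be moved in
front of all faces taken by \<open>g\<close>, which is \<open>face_mixed_face\<close>.\<close>

lemma mixed_face_mixed_face:
  assumes "precubical_set X"
  shows "\<lbrakk>x \<in> cells X d; N \<le> d\<rbrakk> \<Longrightarrow>
    mixed_face X h (N - marked_below g N) (d - marked_below g N) (mixed_face X g N d x)
      = mixed_face X (merge_marks g h) N d x"
proof (induction N arbitrary: d x)
  case (Suc N)
  show ?case
  proof (cases "g N")
    case (Some e)
    have "mixed_face X h (N - marked_below g N) (d - 1 - marked_below g N)
        (mixed_face X g N (d - 1) (face X e d N x))
      = mixed_face X (merge_marks g h) N (d - 1) (face X e d N x)"
      using Suc.prems face_in_cells[OF assms] by (intro Suc.IH) auto
    moreover have "merge_marks g h N = Some e" by (simp add: merge_marks_def Some)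
    ultimately show ?thesis using Some by simp
  next
    case None
    have mm: "merge_marks g h N = h (N - marked_below g N)" by (simp add: merge_marks_def None)
    have eq: "Suc N - marked_below g N = Suc (N - marked_below g N)"
      using marked_below_le[of g N] by simp
    show ?thesis
    proof (cases "h (N - marked_below g N)")
      case N: None
      then show ?thesis using None Suc by (simp add: mm eq)
    next
      case (Some e)
      have "mixed_face X h (N - marked_below g N) (d - 1 - marked_below g N)
          (mixed_face X g N (d - 1) (face X e d N x))
        = mixed_face X (merge_marks g h) N (d - 1) (face X e d N x)"
        using Suc.prems face_in_cells[OF assms] by (intro Suc.IH) auto
      then show ?thesis using None Some Suc.prems face_mixed_face[OF assms, of x d N N e g]
        by (simp add: mm eq)
    qed
  qed
qed simp

definition marks :: "bool \<Rightarrow> nat set \<Rightarrow> nat \<Rightarrow> bool option" where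
  "marks e I j = (if j \<in> I then Some e else None)"

lemma face_seq_eq_mixed_face:
  "face_seq X e d (rev (sorted_list_of_set (I \<inter> {..<i}))) x = mixed_face X (marks e I) i d x"
proof (induction i arbitrary: d x)
  case (Suc i)
  have "sorted_list_of_set (I \<inter> {..<Suc i}) = sorted_list_of_set (I \<inter> {..<i}) @ (if i \<in> I then [i] else [])"
  proof (cases "i \<in> I")
    case True
    have "sorted_list_of_set (set (sorted_list_of_set (I \<inter> {..<i}) @ [i])) = sorted_list_of_set (I \<inter> {..<i}) @ [i]"
      by (intro sorted_list_of_set.idem_if_sorted_distinct) (auto simp: sorted_append less_imp_le)
    moreover have "set (sorted_list_of_set (I \<inter> {..<i}) @ [i]) = I \<inter> {..<Suc i}"
      using True by auto
    ultimately show ?thesis using True by metis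
  next
    case False
    then have "I \<inter> {..<Suc i} = I \<inter> {..<i}" by (auto simp: less_Suc_eq)
    then show ?thesis using False by simp
  qed
  then show ?case using Suc by (auto simp: marks_def)
qed simp

lemma multi_face_eq_mixed_face:
  assumes "I \<subseteq> {..<n}"
  shows "multi_face X e n I x = mixed_face X (marks e I) n n x"
  using face_seq_eq_mixed_face[of X e n I n x] assms by (simp add: multi_face_def Int_absorb2)

lemma marked_below_marks: "I \<subseteq> {..<n} \<Longrightarrow> marked_below (marks e I) n = card I"
  unfolding marked_below_def marks_def by (intro arg_cong[where f = card]) auto

lemma multi_face_in_cells:
  assumes "precubical_set X" "x \<in> cells X n" "I \<subseteq> {..<n}"
  shows "multi_face X e n I x \<in> cells X (n - card I)"
  using mixed_face_in_cells[OF assms(1,2), of n "marks e I"] assms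
  by (simp add: multi_face_eq_mixed_face marked_below_marks)

text \<open>The increasing enumeration of \<open>S\<close>, that is, the index of a direction \<open>i\<close> in the face in which exactly
the directions of \<open>S\<close> survive.\<close>

definition rank :: "nat set \<Rightarrow> nat \<Rightarrow> nat" where
  "rank S i = card {j\<in>S. j < i}"

lemma rank_less:
  assumes "finite S" "i \<in> S" "i < j"
  shows "rank S i < rank S j"
  unfolding rank_def using assms by (intro psubset_card_mono) auto

lemma bij_betw_rank:
  assumes "finite S"
  shows "bij_betw (rank S) S {..<card S}"
proof -
  have inj: "inj_on (rank S) S"
    by (intro linorder_inj_onI') (use rank_less[OF assms] in \<open>metis less_irrefl\<close>)
  have "rank S ` S \<subseteq> {..<card S}"
    unfolding rank_def using assms by (auto intro!: psubset_card_mono)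
  moreover have "card (rank S ` S) = card {..<card S}" using card_image[OF inj] by simp
  ultimately have "rank S ` S = {..<card S}" by (simp add: card_subset_eq)
  then show ?thesis using inj by (simp add: bij_betw_def)
qed

lemma rank_lessThan: "i \<le> n \<Longrightarrow> rank {..<n} i = i"
proof -
  assume "i \<le> n"
  then have "{j\<in>{..<n}. j < i} = {..<i}" by auto
  then show ?thesis by (simp add: rank_def)
qed

lemma rank_complement:
  assumes "i < n" "K \<subseteq> {..<n}"
  shows "rank ({..<n} - K) i = i - marked_below (marks e K) i"
proof -
  let ?M = "{j. j < i \<and> marks e K j \<noteq> None}"
  have eq: "{j\<in>{..<n} - K. j < i} = {..<i} - ?M"
    using assms by (auto simp: marks_def)
  have sub: "?M \<subseteq> {..<i}" by auto
  have "card ({..<i} - ?M) = i - card ?M"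
    unfolding card_Diff_subset[OF finite_subset[OF sub finite_lessThan] sub] by simp
  then show ?thesis unfolding rank_def marked_below_def eq .
qed

definition two_marks :: "bool \<Rightarrow> nat set \<Rightarrow> bool \<Rightarrow> nat set \<Rightarrow> nat \<Rightarrow> bool option" where
  "two_marks e K e' L j = (if j \<in> K then Some e else if j \<in> L then Some e' else None)"

text \<open>Two successive multiple faces become one marking of the original directions. Equality of composites
of faces can then be read off from equality of markings.\<close>

lemma multi_face_multi_face:
  assumes X: "precubical_set X" and x: "x \<in> cells X n"
    and K: "K \<subseteq> {..<n}" and L: "L \<subseteq> {..<n} - K"
    and m: "m = n - card K" and J: "J = rank ({..<n} - K) ` L"
  shows "multi_face X e' m J (multi_face X e n K x) = mixed_face X (two_marks e K e' L) n n x"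
proof -
  let ?r = "rank ({..<n} - K)"
  have card: "card ({..<n} - K) = n - card K"
    using K by (simp add: card_Diff_subset finite_subset[OF K])
  have bij: "bij_betw ?r ({..<n} - K) {..<n - card K}"
    using bij_betw_rank[of "{..<n} - K"] by (simp add: card)
  have sub: "J \<subseteq> {..<n - card K}" unfolding J using bij L by (auto simp: bij_betw_def)
  have "multi_face X e' m J (multi_face X e n K x)
    = mixed_face X (marks e' J) (n - card K) (n - card K) (mixed_face X (marks e K) n n x)"
    using sub K by (simp add: m multi_face_eq_mixed_face)
  also have "\<dots> = mixed_face X (merge_marks (marks e K) (marks e' J)) n n x"
    using mixed_face_mixed_face[OF X x, of n "marks e' J" "marks e K"] K by (simp add: marked_below_marks)
  also have "\<dots> = mixed_face X (two_marks e K e' L) n n x"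
  proof (rule mixed_face_cong)
    fix j assume "j < n"
    show "merge_marks (marks e K) (marks e' J) j = two_marks e K e' L j"
    proof (cases "j \<in> K")
      case False
      have "?r j \<in> J \<longleftrightarrow> j \<in> L"
        unfolding J using bij L False \<open>j < n\<close> unfolding bij_betw_def
        by (intro inj_on_image_mem_iff) auto
      then show ?thesis using False rank_complement[OF \<open>j < n\<close> K, of e]
        by (simp add: merge_marks_def marks_def two_marks_def)
    qed (simp add: merge_marks_def marks_def two_marks_def)
  qed
  finally show ?thesis .
qed

lemma vertex_eq_mixed_face: "vertex X e (n, x) = mixed_face X (\<lambda>_. Some e) n n x"
  unfolding vertex_def
  by (simp add: multi_face_eq_mixed_face, rule mixed_face_cong) (simp add: marks_def)

lemma vertex_in_cells:
  "precubical_set X \<Longrightarrow> c \<in> cubes X \<Longrightarrow> vertex X e c \<in> cells X 0"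
  using multi_face_in_cells[of X "snd c" "fst c" "{..<fst c}" e]
  by (auto simp: vertex_def cubes_def)

lemma vertex_multi_face:
  assumes X: "precubical_set X" and x: "x \<in> cells X n" and K: "K \<subseteq> {..<n}" and m: "m = n - card K"
  shows "vertex X e' (m, multi_face X e n K x) = mixed_face X (two_marks e K e' ({..<n} - K)) n n x"
proof -
  have card: "card ({..<n} - K) = n - card K"
    using K by (simp add: card_Diff_subset finite_subset[OF K])
  have "{..<m} = rank ({..<n} - K) ` ({..<n} - K)"
    using bij_betw_rank[of "{..<n} - K"] by (simp add: card m bij_betw_def)
  then show ?thesis unfolding vertex_def fst_conv snd_conv
    by (intro multi_face_multi_face[OF X x K order_refl m])
qed

section \<open>The boundary\<close>

definition proper_parts :: "'b set \<Rightarrow> 'b set set" where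
  "proper_parts S = {I. I \<subset> S \<and> I \<noteq> {}}"

text \<open>The boundary replaces a cube \<open>c\<close> of a chain by two cubes, split along a set \<open>I\<close> of directions:
the first runs through the directions in \<open>I\<close>, starting at the initial vertex of \<open>c\<close>, and the second
through the remaining ones, ending at the final vertex of \<open>c\<close>.\<close>

definition lower_piece :: "'a precubical \<Rightarrow> nat \<times> 'a \<Rightarrow> nat set \<Rightarrow> nat \<times> 'a" where
  "lower_piece X c I = (card I, multi_face X False (fst c) ({..<fst c} - I) (snd c))"

definition upper_piece :: "'a precubical \<Rightarrow> nat \<times> 'a \<Rightarrow> nat set \<Rightarrow> nat \<times> 'a" where
  "upper_piece X c I = (fst c - card I, multi_face X True (fst c) I (snd c))"

text \<open>The part of the sign of a face that depends on \<open>I\<close>, including \<open>(- 1) ^ r\<close> for \<open>r = card I\<close>; what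
remains of the sign depends on the preceding cubes only (\<open>boundary_single\<close>).\<close>

definition split_sign :: "nat set \<Rightarrow> 'r::field" where
  "split_sign I = (- 1) ^ card I * sgn_set I"

lemma rlinear_boundary: "rlinear (boundary X :: ('a, 'r::field) chains \<Rightarrow> _)"
proof -
  have "boundary X f = lin (\<lambda>c. boundary X (Poly_Mapping.single c 1)) f" for f :: "('a, 'r) chains"
    unfolding lin_def boundary_def[of X f]
    by (intro sum.cong refl) (auto simp: boundary_def scal_sum mult_ac split: prod.splits)
  then have "boundary X = lin (\<lambda>c. boundary X (Poly_Mapping.single c 1) :: ('a, 'r) chains)" by blast
  then show ?thesis by (metis rlinear_lin)
qed

lemmas boundary_rlinear = rlinearD[OF rlinear_boundary]

lemma sum_proper_parts:
  fixes g :: "nat set \<Rightarrow> 'b::comm_monoid_add"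
  shows "(\<Sum>r\<in>{1..<n}. \<Sum>I\<in>{I. I \<subseteq> {..<n} \<and> card I = r}. g I) = (\<Sum>I\<in>proper_parts {..<n}. g I)"
proof -
  have "(\<Sum>r\<in>{1..<n}. \<Sum>I\<in>{I. I \<subseteq> {..<n} \<and> card I = r}. g I)
    = sum g (\<Union>r\<in>{1..<n}. {I. I \<subseteq> {..<n} \<and> card I = r})"
    by (rule sum.UNION_disjoint[symmetric]) auto
  also have "(\<Union>r\<in>{1..<n}. {I. I \<subseteq> {..<n} \<and> card I = r}) = proper_parts {..<n}"
  proof -
    have "I \<in> (\<Union>r\<in>{1..<n}. {I. I \<subseteq> {..<n} \<and> card I = r}) \<longleftrightarrow> I \<in> proper_parts {..<n}" for I
    proof (cases "I \<subseteq> {..<n}")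
      case True
      then have fin: "finite I" by (simp add: finite_subset)
      have "I \<noteq> {..<n} \<longleftrightarrow> card I < n"
        using True psubset_card_mono[of "{..<n}" I] by (auto simp: psubset_eq)
      moreover have "I \<noteq> {} \<longleftrightarrow> 1 \<le> card I"
        using fin by (metis One_nat_def Suc_leI card_gt_0_iff not_one_le_zero card.empty)
      ultimately show ?thesis using True by (simp add: proper_parts_def psubset_eq conj_commute)
    qed (simp add: proper_parts_def psubset_eq)
    then show ?thesis by blast
  qed
  finally show ?thesis .
qed

lemma chain_face_eq:
  "chain_face X k I (v, cs, w) =
     (v, take k cs @ [lower_piece X (cs ! k) I, upper_piece X (cs ! k) I] @ drop (Suc k) cs, w)"
  by (simp add: chain_face_def lower_piece_def upper_piece_def split: prod.splits)

lemma boundary_single: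
  "boundary X (Poly_Mapping.single (v, cs, w) 1 :: ('a, 'r::field) chains) =
     (\<Sum>k<length cs. \<Sum>I\<in>proper_parts {..<fst (cs ! k)}.
        Poly_Mapping.single (v, take k cs @ [lower_piece X (cs ! k) I, upper_piece X (cs ! k) I] @ drop (Suc k) cs, w)
          ((- 1) ^ ((\<Sum>j<k. fst (cs ! j)) + k) * split_sign I))"
proof -
  have *: "(- 1 :: 'r) ^ (a + (k + 1) + r + 1) = (- 1) ^ (a + k) * (- 1) ^ r" for a k r :: nat
    by (simp only: power_add power_one_right mult.assoc mult_minus_left mult_minus_right mult_1_left mult_1_right
      minus_minus)
  have "boundary X (Poly_Mapping.single (v, cs, w) 1 :: ('a, 'r) chains) =
    (\<Sum>k<length cs. \<Sum>r\<in>{1..<fst (cs ! k)}. \<Sum>I\<in>{I. I \<subseteq> {..<fst (cs ! k)} \<and> card I = r}.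
       Poly_Mapping.single (chain_face X k I (v, cs, w))
         ((- 1) ^ ((\<Sum>j<k. fst (cs ! j)) + (k + 1) + r + 1) * sgn_set I))"
    by (simp only: boundary_def keys_single one_neq_zero if_False sum.insert finite.emptyI empty_iff not_False_eq_True
        sum.empty add_0_right prod.case lookup_single_eq mult_1_right)
  also have "\<dots> = (\<Sum>k<length cs. \<Sum>r\<in>{1..<fst (cs ! k)}. \<Sum>I\<in>{I. I \<subseteq> {..<fst (cs ! k)} \<and> card I = r}.
       Poly_Mapping.single (v, take k cs @ [lower_piece X (cs ! k) I, upper_piece X (cs ! k) I] @ drop (Suc k) cs, w)
          ((- 1) ^ ((\<Sum>j<k. fst (cs ! j)) + k) * split_sign I))"
    unfolding chain_face_eq
  proof (intro sum.cong refl arg_cong2[where f = Poly_Mapping.single])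
    fix k r I assume "I \<in> {I. I \<subseteq> {..<fst (cs ! k)} \<and> card I = r}"
    then show "(- 1 :: 'r) ^ ((\<Sum>j<k. fst (cs ! j)) + (k + 1) + r + 1) * sgn_set I =
      (- 1) ^ ((\<Sum>j<k. fst (cs ! j)) + k) * split_sign I"
      unfolding * split_sign_def by simp
  qed
  also have "\<dots> = (\<Sum>k<length cs. \<Sum>I\<in>proper_parts {..<fst (cs ! k)}.
       Poly_Mapping.single (v, take k cs @ [lower_piece X (cs ! k) I, upper_piece X (cs ! k) I] @ drop (Suc k) cs, w)
          ((- 1) ^ ((\<Sum>j<k. fst (cs ! j)) + k) * split_sign I))"
    by (rule sum.cong[OF refl], rule sum_proper_parts)
  finally show ?thesis .
qed

lemma boundary_Nil [simp]: "boundary X (Poly_Mapping.single (v, [], w) 1) = 0"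
  unfolding boundary_single list.size lessThan_0 sum.empty ..

text \<open>The vertex \<open>u\<close> is arbitrary: concatenation compares only the stored end points, and neither side
requires the lists of cubes to be connected.\<close>

lemma boundary_Cons:
  "boundary X (Poly_Mapping.single (v, c # cs, w) 1 :: ('a, 'r::field) chains) =
     (\<Sum>I\<in>proper_parts {..<fst c}.
        Poly_Mapping.single (v, lower_piece X c I # upper_piece X c I # cs, w) (split_sign I)) +
     scal ((- 1) ^ (fst c + 1))
       (conc (Poly_Mapping.single (v, [c], u) 1) (boundary X (Poly_Mapping.single (u, cs, w) 1)))"
proof -
  let ?t = "\<lambda>k I. (v, take k (c # cs) @ [lower_piece X ((c # cs) ! k) I, upper_piece X ((c # cs) ! k) I] @ drop (Suc k) (c # cs), w)"
  let ?u = "\<lambda>k I. (u, take k cs @ [lower_piece X (cs ! k) I, upper_piece X (cs ! k) I] @ drop (Suc k) cs, w)"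
  have *: "(- 1 :: 'r) ^ ((\<Sum>j<Suc k. fst ((c # cs) ! j)) + Suc k) = (- 1) ^ (fst c + 1) * (- 1) ^ ((\<Sum>j<k. fst (cs ! j)) + k)"
    for k
  proof -
    have "(\<Sum>j<Suc k. fst ((c # cs) ! j)) + Suc k = (fst c + 1) + ((\<Sum>j<k. fst (cs ! j)) + k)"
      unfolding sum.lessThan_Suc_shift by simp
    then show ?thesis by (simp only: power_add)
  qed
  have s: "Poly_Mapping.single (?t (Suc k) I) ((- 1) ^ (fst c + 1) * a) =
    scal ((- 1) ^ (fst c + 1)) (conc (Poly_Mapping.single (v, [c], u) 1) (Poly_Mapping.single (?u k I) a))"
    for k I and a :: 'r
    by (simp add: conc_single)
  have "boundary X (Poly_Mapping.single (v, c # cs, w) 1 :: ('a, 'r::field) chains) =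
     (\<Sum>I\<in>proper_parts {..<fst c}. Poly_Mapping.single (?t 0 I) (split_sign I)) +
     (\<Sum>k<length cs. \<Sum>I\<in>proper_parts {..<fst (cs ! k)}. Poly_Mapping.single (?t (Suc k) I)
        ((- 1) ^ ((\<Sum>j<Suc k. fst ((c # cs) ! j)) + Suc k) * split_sign I))"
    unfolding boundary_single length_Cons sum.lessThan_Suc_shift[of _ "length cs"] by simp
  then show ?thesis
    unfolding * mult.assoc s by (simp add: boundary_single conc_right scal_sum)
qed

lemma boundary_single_cube:
  "boundary X (Poly_Mapping.single (v, [c], w) 1 :: ('a, 'r::field) chains) =
     (\<Sum>I\<in>proper_parts {..<fst c}. Poly_Mapping.single (v, [lower_piece X c I, upper_piece X c I], w) (split_sign I))"
  using boundary_Cons[of X v c "[]" w w] by (simp add: conc_right)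

lemma boundary_append:
  assumes "cs = [] \<Longrightarrow> v = u"
  shows "boundary X (Poly_Mapping.single (v, cs @ ds, w) 1 :: ('a, 'r::field) chains) =
     conc (boundary X (Poly_Mapping.single (v, cs, u) 1)) (Poly_Mapping.single (u, ds, w) 1) +
     scal ((- 1) ^ (sum_list (map fst cs) + length cs))
       (conc (Poly_Mapping.single (v, cs, u) 1) (boundary X (Poly_Mapping.single (u, ds, w) 1)))"
  using assms
proof (induction cs arbitrary: v)
  case Nil
  have "conc (Poly_Mapping.single (u, [], u) 1) (boundary X (Poly_Mapping.single (u, ds, w) 1)) =
    (boundary X (Poly_Mapping.single (u, ds, w) 1) :: ('a, 'r) chains)"
    by (simp add: boundary_single conc_right conc_single)
  then show ?case using Nil by (simp add: conc_left)
next
  case (Cons c cs)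
  have IH: "boundary X (Poly_Mapping.single (u, cs @ ds, w) 1 :: ('a, 'r::field) chains) =
     conc (boundary X (Poly_Mapping.single (u, cs, u) 1)) (Poly_Mapping.single (u, ds, w) 1) +
     scal ((- 1) ^ (sum_list (map fst cs) + length cs))
       (conc (Poly_Mapping.single (u, cs, u) 1) (boundary X (Poly_Mapping.single (u, ds, w) 1)))"
    by (rule Cons.IH) simp
  have c: "conc (Poly_Mapping.single (v, [c], u) 1) (conc (Poly_Mapping.single (u, cs, u) 1) g) =
    conc (Poly_Mapping.single (v, c # cs, u) 1) g" for g :: "('a, 'r) chains"
    by (simp add: conc_assoc[symmetric] conc_single)
  have e: "(- 1 :: 'r) ^ (sum_list (map fst (c # cs)) + length (c # cs)) =
    (- 1) ^ (fst c + 1) * (- 1) ^ (sum_list (map fst cs) + length cs)"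
    by (simp add: power_add)
  show ?case
    unfolding append_Cons boundary_Cons[of X v c "cs @ ds" w u] boundary_Cons[of X v c cs u u] IH e
    by (simp add: conc_left conc_right conc_single scal_add c conc_assoc[symmetric] add.assoc del: power_Suc)
qed

text \<open>The dimension of a chain is the sum of the \<open>n_k\<close> minus the length, which has the same parity as the sum
plus the length. A triple with an empty list of cubes has to be a constant path, since otherwise
concatenation with it would change an end point.\<close>

definition koszul_parity :: "'r::field \<Rightarrow> 'a cchain set" where
  "koszul_parity s = {(v, cs, w). (cs = [] \<longrightarrow> v = w) \<and> (- 1) ^ (sum_list (map fst cs) + length cs) = s}"

text \<open>The Leibniz rule: a face of a concatenation is taken in one of the two parts, and moving past \<open>f\<close>
costs one sign for each of its dimensions.\<close>

lemma boundary_conc: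
  fixes f g :: "('a, 'r::field) chains"
  assumes "Poly_Mapping.keys f \<subseteq> koszul_parity s"
  shows "boundary X (conc f g) = conc (boundary X f) g + scal s (conc f (boundary X g))"
proof (rule rlinear_eqI[where f = f, OF _ _ assms])
  fix c1 :: "'a cchain" assume c1: "c1 \<in> koszul_parity s"
  let ?f = "Poly_Mapping.single c1 1 :: ('a, 'r) chains"
  show "boundary X (conc ?f g) = conc (boundary X ?f) g + scal s (conc ?f (boundary X g))"
  proof (rule rlinear_eqI[where f = g, OF _ _ subset_UNIV])
    fix c2 :: "'a cchain"
    obtain v cs u u' ds w where eq: "c1 = (v, cs, u)" "c2 = (u', ds, w)" by (metis prod_cases3)
    show "boundary X (conc ?f (Poly_Mapping.single c2 1)) =
      conc (boundary X ?f) (Poly_Mapping.single c2 1) + scal s (conc ?f (boundary X (Poly_Mapping.single c2 1)))"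
    proof (cases "u = u'")
      case True
      have s: "s = (- 1) ^ (sum_list (map fst cs) + length cs)" using c1 eq by (simp add: koszul_parity_def)
      show ?thesis using boundary_append[of cs v u X ds w, where 'r = 'r] c1
        unfolding eq True[symmetric] conc_single s by (simp add: koszul_parity_def)
    next
      case False
      then show ?thesis by (simp add: eq conc_single boundary_single conc_left conc_right boundary_rlinear)
    qed
  qed (rule rlinear_comp[OF rlinear_boundary rlinear_conc_right],
      rule rlinear_add[OF rlinear_conc_right rlinear_scal[OF rlinear_comp[OF rlinear_conc_right rlinear_boundary]]])
qed (rule rlinear_comp[OF rlinear_boundary rlinear_conc_left],
    rule rlinear_add[OF rlinear_comp[OF rlinear_conc_left rlinear_boundary] rlinear_scal[OF rlinear_conc_left]])

section \<open>The square of the boundary\<close>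

definition inversions :: "nat set \<Rightarrow> nat set \<Rightarrow> nat" where
  "inversions A B = (\<Sum>i\<in>A. card {j\<in>B. j < i})"

lemma inversions_Un_left:
  "finite A \<Longrightarrow> finite B \<Longrightarrow> A \<inter> B = {} \<Longrightarrow> inversions (A \<union> B) C = inversions A C + inversions B C"
  by (simp add: inversions_def sum.union_disjoint)

lemma inversions_Un_right:
  assumes "finite B" "finite C" "B \<inter> C = {}"
  shows "inversions A (B \<union> C) = inversions A B + inversions A C"
proof -
  have "card {j\<in>B \<union> C. j < i} = card {j\<in>B. j < i} + card {j\<in>C. j < i}" for i
  proof -
    have "{j\<in>B \<union> C. j < i} = {j\<in>B. j < i} \<union> {j\<in>C. j < i}" by auto
    moreover have "{j\<in>B. j < i} \<inter> {j\<in>C. j < i} = {}" using assms by auto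
    ultimately show ?thesis using assms by (simp add: card_Un_disjoint)
  qed
  then show ?thesis by (simp add: inversions_def sum.distrib)
qed

text \<open>The sum of the positions of \<open>A\<close> in \<open>S\<close>, counted from 1, exceeds the smallest possible sum \<open>1 + \<dots> + card A\<close> by one
for each pair of an element of \<open>A\<close> and a smaller element of \<open>S - A\<close>.\<close>

lemma sgn_set_rank:
  assumes "finite S" "A \<subseteq> S"
  shows "sgn_set (rank S ` A) = ((- 1) ^ inversions A (S - A) :: 'r::field)"
proof -
  have finA: "finite A" using assms by (auto intro: finite_subset)
  have inj: "inj_on (rank S) A"
    using bij_betw_rank[OF assms(1)] assms(2) by (auto simp: bij_betw_def intro: inj_on_subset)
  have rank: "rank S i = rank A i + card {j\<in>S - A. j < i}" for i
  proof -
    have "{j\<in>S. j < i} = {j\<in>A. j < i} \<union> {j\<in>S - A. j < i}" using assms by auto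
    moreover have "{j\<in>A. j < i} \<inter> {j\<in>S - A. j < i} = {}" by auto
    ultimately show ?thesis using finA assms by (simp add: rank_def card_Un_disjoint)
  qed
  have "(\<Sum>i\<in>A. rank A i + 1) = (\<Sum>j<card A. j + 1)"
    by (rule sum.reindex_bij_betw[OF bij_betw_rank[OF finA]])
  also have "\<dots> = (\<Sum>j=1..card A. j)"
    by (rule sum.reindex_bij_witness[where i = "\<lambda>j. j - 1" and j = "\<lambda>j. j + 1"]) auto
  finally have r: "(\<Sum>i\<in>A. rank A i + 1) = (\<Sum>j=1..card A. j)" .
  have "(\<Sum>j\<in>rank S ` A. j + 1) = (\<Sum>i\<in>A. rank S i + 1)"
    by (rule sum.reindex[OF inj, unfolded comp_def])
  also have "\<dots> = (\<Sum>i\<in>A. (rank A i + 1) + card {j\<in>S - A. j < i})"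
    by (simp add: rank)
  also have "\<dots> = (\<Sum>j=1..card A. j) + inversions A (S - A)"
    unfolding sum.distrib[of "\<lambda>i. rank A i + 1"] r inversions_def ..
  finally have "(\<Sum>j\<in>rank S ` A. j + 1) = (\<Sum>j=1..card A. j) + inversions A (S - A)" .
  then have "(\<Sum>j\<in>rank S ` A. j + 1) mod 2 = (\<Sum>j=1..card (rank S ` A). j) mod 2 \<longleftrightarrow> even (inversions A (S - A))"
    unfolding card_image[OF inj] by presburger
  then show ?thesis by (simp add: sgn_set_def)
qed

lemma sgn_set_eq:
  assumes "I \<subseteq> {..<n}"
  shows "sgn_set I = ((- 1) ^ inversions I ({..<n} - I) :: 'r::field)"
proof -
  have "rank {..<n} ` I = (\<lambda>i. i) ` I"
    using assms by (intro image_cong refl rank_lessThan) auto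
  then show ?thesis using sgn_set_rank[of "{..<n}" I] assms by simp
qed

text \<open>The cubes obtained when the directions are traversed in three stages, first those in \<open>A\<close>, then those
in \<open>B\<close>, then the others. They are given by markings of the original directions, so that both ways of
reaching them by two splits can be compared with the same expression.\<close>

definition three_pieces :: "'a precubical \<Rightarrow> nat \<Rightarrow> 'a \<Rightarrow> nat set \<Rightarrow> nat set \<Rightarrow> (nat \<times> 'a) list" where
  "three_pieces X n x A B =
    [(card A, mixed_face X (marks False ({..<n} - A)) n n x),
     (card B, mixed_face X (two_marks True A False ({..<n} - (A \<union> B))) n n x),
     (n - card A - card B, mixed_face X (marks True (A \<union> B)) n n x)]"

lemma card_rank_image:
  assumes "finite S" "A \<subseteq> S"
  shows "card (rank S ` A) = card A"
  using bij_betw_rank[OF assms(1)] assms(2)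
  by (intro card_image) (auto simp: bij_betw_def intro: inj_on_subset)

lemma rank_image_Diff:
  assumes "finite S" "A \<subseteq> S"
  shows "{..<card S} - rank S ` A = rank S ` (S - A)"
proof -
  have "rank S ` (S - A) = rank S ` S - rank S ` A"
    using bij_betw_rank[OF assms(1)] assms(2) by (intro inj_on_image_set_diff[of _ S]) (auto simp: bij_betw_def)
  then show ?thesis using bij_betw_rank[OF assms(1)] by (simp add: bij_betw_def)
qed

lemma split_lower_piece:
  assumes X: "precubical_set X" and x: "x \<in> cells X n" and AB: "A \<inter> B = {}" "A \<union> B \<subseteq> {..<n}"
  defines "a \<equiv> lower_piece X (n, x) (A \<union> B)" and "J \<equiv> rank (A \<union> B) ` A"
  shows "[lower_piece X a J, upper_piece X a J, upper_piece X (n, x) (A \<union> B)] = three_pieces X n x A B"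
proof -
  let ?I = "A \<union> B"
  have fin: "finite ?I" "finite A" "finite B" using AB finite_subset[of ?I "{..<n}"] by auto
  have card: "card ?I = card A + card B" using AB fin by (simp add: card_Un_disjoint)
  have cJ: "card J = card A" unfolding J_def by (rule card_rank_image) (use fin in auto)
  have DD: "{..<n} - ({..<n} - ?I) = ?I" using AB by auto
  have m: "card ?I = n - card ({..<n} - ?I)"
    using AB card_mono[of "{..<n}" ?I] fin by (simp add: card_Diff_subset)
  \<comment> \<open>The directions kept by the lower piece are \<open>A \<union> B\<close>, and splitting them along \<open>A\<close> leaves \<open>B\<close>.\<close>
  have JD: "{..<card ?I} - J = rank ?I ` B"
    unfolding J_def using rank_image_Diff[of ?I A] fin AB by (simp add: Un_Diff Diff_triv Int_commute)
  have 1: "multi_face X False (card ?I) ({..<card ?I} - J) (multi_face X False n ({..<n} - ?I) x)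
      = mixed_face X (marks False ({..<n} - A)) n n x"
    using multi_face_multi_face[OF X x, of "{..<n} - ?I" B "card ?I" "{..<card ?I} - J" False False] AB
    by (simp add: DD m[symmetric] JD)
      (rule mixed_face_cong, auto simp: two_marks_def marks_def)
  have 2: "multi_face X True (card ?I) J (multi_face X False n ({..<n} - ?I) x)
      = mixed_face X (two_marks True A False ({..<n} - ?I)) n n x"
    using multi_face_multi_face[OF X x, of "{..<n} - ?I" A "card ?I" J True False] AB
    by (simp add: DD m[symmetric] J_def)
      (rule mixed_face_cong, auto simp: two_marks_def marks_def)
  show ?thesis
    using 1 2 AB by (simp add: a_def lower_piece_def upper_piece_def three_pieces_def cJ card multi_face_eq_mixed_face)
qed

lemma split_upper_piece:
  assumes X: "precubical_set X" and x: "x \<in> cells X n" and AB: "A \<inter> B = {}" "A \<union> B \<subseteq> {..<n}"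
  defines "b \<equiv> upper_piece X (n, x) A" and "J \<equiv> rank ({..<n} - A) ` B"
  shows "[lower_piece X (n, x) A, lower_piece X b J, upper_piece X b J] = three_pieces X n x A B"
proof -
  have fin: "finite A" "finite B" using AB finite_subset[of "A \<union> B" "{..<n}"] by auto
  have B: "B \<subseteq> {..<n} - A" using AB by auto
  have cJ: "card J = card B" unfolding J_def by (rule card_rank_image) (use B in auto)
  have m: "card ({..<n} - A) = n - card A" using AB fin by (simp add: card_Diff_subset)
  have JD: "{..<n - card A} - J = rank ({..<n} - A) ` ({..<n} - (A \<union> B))"
    unfolding J_def using rank_image_Diff[of "{..<n} - A" B] B
    unfolding m by (simp add: Diff_eq Int_assoc)
  have 1: "multi_face X False (n - card A) ({..<n - card A} - J) (multi_face X True n A x)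
      = mixed_face X (two_marks True A False ({..<n} - (A \<union> B))) n n x"
    by (rule multi_face_multi_face[OF X x _ _ refl JD]) (use AB in auto)
  have 2: "multi_face X True (n - card A) J (multi_face X True n A x) = mixed_face X (marks True (A \<union> B)) n n x"
    using multi_face_multi_face[OF X x _ B refl J_def[THEN meta_eq_to_obj_eq], of True True] AB
    by simp (rule mixed_face_cong, auto simp: two_marks_def marks_def)
  have 3: "multi_face X False n ({..<n} - A) x = mixed_face X (marks False ({..<n} - A)) n n x"
    by (rule multi_face_eq_mixed_face) auto
  show ?thesis
    using 1 2 3 AB by (simp add: b_def lower_piece_def upper_piece_def three_pieces_def cJ)
qed

lemma sum_proper_parts_rank:
  fixes g :: "nat set \<Rightarrow> 'b::comm_monoid_add"
  assumes "finite S" "n = card S"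
  shows "(\<Sum>J\<in>proper_parts {..<n}. g J) = (\<Sum>A\<in>proper_parts S. g (rank S ` A))"
proof -
  have b: "bij_betw (rank S) S {..<card S}" by (rule bij_betw_rank[OF assms(1)])
  have "bij_betw ((`) (rank S)) (proper_parts S) (proper_parts {..<card S})"
    unfolding bij_betw_def
  proof
    show inj: "inj_on ((`) (rank S)) (proper_parts S)"
      using b by (intro inj_onI) (auto simp: proper_parts_def bij_betw_def dest: inj_on_image_eq_iff)
    show "(`) (rank S) ` proper_parts S = proper_parts {..<card S}"
    proof (intro equalityI subsetI)
      fix J assume "J \<in> (`) (rank S) ` proper_parts S"
      then obtain A where A: "A \<subseteq> S" "A \<noteq> S" "A \<noteq> {}" "J = rank S ` A" by (auto simp: proper_parts_def)
      then have "J \<noteq> rank S ` S" using b by (metis bij_betw_def inj_on_image_eq_iff order_refl)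
      then show "J \<in> proper_parts {..<card S}" using A b by (auto simp: proper_parts_def bij_betw_def)
    next
      fix J assume J: "J \<in> proper_parts {..<card S}"
      then have "J \<subseteq> rank S ` S" using b by (auto simp: proper_parts_def bij_betw_def)
      then obtain A where A: "A \<subseteq> S" "J = rank S ` A" by (meson subset_imageE)
      then have "A \<in> proper_parts S" using J b by (auto simp: proper_parts_def bij_betw_def)
      then show "J \<in> (`) (rank S) ` proper_parts S" using A by blast
    qed
  qed
  then show ?thesis unfolding assms(2) by (rule sum.reindex_bij_betw[symmetric])
qed

lemma finite_proper_parts: "finite S \<Longrightarrow> finite (proper_parts S)"
  by (rule finite_subset[of _ "Pow S"]) (auto simp: proper_parts_def)

definition ordered_splits :: "nat \<Rightarrow> (nat set \<times> nat set) set" where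
  "ordered_splits n = {(A, B). A \<inter> B = {} \<and> A \<noteq> {} \<and> B \<noteq> {} \<and> A \<union> B \<subset> {..<n}}"

text \<open>With \<open>C\<close> the remaining directions, both products of signs count the inversions between all pairs of
parts \<open>(A, B)\<close>, \<open>(A, C)\<close>, \<open>(B, C)\<close>. The remaining powers of \<open>- 1\<close> differ by one factor
because the cube in front of the second split contributes \<open>(- 1) ^ (card A + 1)\<close>.\<close>

lemma split_signs_cancel:
  assumes "(A, B) \<in> ordered_splits n"
  shows "split_sign (A \<union> B) * split_sign (rank (A \<union> B) ` A) =
    - (split_sign A * ((- 1) ^ (card A + 1) * split_sign (rank ({..<n} - A) ` B)) :: 'r::field)"
proof -
  let ?C = "{..<n} - (A \<union> B)"
  have AB: "A \<inter> B = {}" "A \<union> B \<subseteq> {..<n}" using assms by (auto simp: ordered_splits_def)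
  have fin: "finite (A \<union> B)" "finite A" "finite B" using AB finite_subset[of "A \<union> B" "{..<n}"] by auto
  have B: "B \<subseteq> {..<n} - A" using AB by auto
  have eqs: "A \<union> B - A = B" "{..<n} - A - B = ?C" "{..<n} - A = B \<union> ?C" using AB by auto
  have c1: "card (rank (A \<union> B) ` A) = card A" by (rule card_rank_image) (use fin in auto)
  have c2: "card (rank ({..<n} - A) ` B) = card B" by (rule card_rank_image) (use B in auto)
  have c3: "card (A \<union> B) = card A + card B" using AB fin by (simp add: card_Un_disjoint)
  have s1: "sgn_set (A \<union> B) = ((- 1) ^ (inversions A ?C + inversions B ?C) :: 'r)"
    using sgn_set_eq[OF AB(2), where 'r = 'r] by (simp add: inversions_Un_left fin AB)
  have s2: "sgn_set (rank (A \<union> B) ` A) = ((- 1) ^ inversions A B :: 'r)"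
    using sgn_set_rank[of "A \<union> B" A, where 'r = 'r] fin by (simp add: eqs)
  have "inversions A ({..<n} - A) = inversions A B + inversions A ?C"
    unfolding eqs(3) by (rule inversions_Un_right) (use fin in auto)
  then have s3: "sgn_set A = ((- 1) ^ (inversions A B + inversions A ?C) :: 'r)"
    using sgn_set_eq[of A n, where 'r = 'r] AB by simp
  have s4: "sgn_set (rank ({..<n} - A) ` B) = ((- 1) ^ inversions B ?C :: 'r)"
    using sgn_set_rank[OF _ B, where 'r = 'r] unfolding eqs(2) by simp
  show ?thesis
    unfolding split_sign_def c1 c2 c3 s1 s2 s3 s4 by (simp add: power_add mult_ac)
qed

text \<open>Splitting the first of the two pieces again, or the second one, yields sums over the same ordered
triples of parts. They cancel term by term.\<close>

lemma boundary_boundary_single_cube: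
  assumes X: "precubical_set X" and x: "x \<in> cells X n"
  shows "boundary X (boundary X (Poly_Mapping.single (v, [(n, x)], w) 1 :: ('a, 'r::field) chains)) = 0"
proof -
  let ?c = "(n, x)"
  let ?lo = "lower_piece X" and ?up = "upper_piece X"
  let ?t = "\<lambda>A B. Poly_Mapping.single (v, three_pieces X n x A B, w)
    (split_sign (A \<union> B) * split_sign (rank (A \<union> B) ` A) :: 'r)"
  have two: "boundary X (Poly_Mapping.single (v, [a, b], w) s :: ('a, 'r) chains) =
     (\<Sum>J\<in>proper_parts {..<fst a}. Poly_Mapping.single (v, [?lo a J, ?up a J, b], w) (s * split_sign J)) +
     (\<Sum>J\<in>proper_parts {..<fst b}. Poly_Mapping.single (v, [a, ?lo b J, ?up b J], w)
        (s * ((- 1) ^ (fst a + 1) * split_sign J)))" for a b s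
  proof -
    have "Poly_Mapping.single (v, [a, b], w) s = scal s (Poly_Mapping.single (v, [a, b], w) 1)" by simp
    then have "boundary X (Poly_Mapping.single (v, [a, b], w) s) =
      scal s (boundary X (Poly_Mapping.single (v, [a, b], w) 1))" by (simp only: boundary_rlinear)
    then show ?thesis
      by (simp add: boundary_Cons[of X v a "[b]" w w] boundary_single_cube conc_right conc_single scal_add scal_sum
          del: power_Suc)
  qed
  have "(\<Sum>I\<in>proper_parts {..<n}. \<Sum>J\<in>proper_parts {..<fst (?lo ?c I)}.
      Poly_Mapping.single (v, [?lo (?lo ?c I) J, ?up (?lo ?c I) J, ?up ?c I], w) (split_sign I * split_sign J))
    = (\<Sum>I\<in>proper_parts {..<n}. \<Sum>A\<in>proper_parts I. ?t A (I - A))"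
  proof (rule sum.cong[OF refl])
    fix I assume I: "I \<in> proper_parts {..<n}"
    then have fin: "finite I" by (auto simp: proper_parts_def intro: finite_subset)
    have "(\<Sum>J\<in>proper_parts {..<fst (?lo ?c I)}.
        Poly_Mapping.single (v, [?lo (?lo ?c I) J, ?up (?lo ?c I) J, ?up ?c I], w) (split_sign I * split_sign J :: 'r))
      = (\<Sum>A\<in>proper_parts I. Poly_Mapping.single
          (v, [?lo (?lo ?c I) (rank I ` A), ?up (?lo ?c I) (rank I ` A), ?up ?c I], w)
          (split_sign I * split_sign (rank I ` A)))"
      by (rule sum_proper_parts_rank[OF fin]) (simp add: lower_piece_def)
    also have "\<dots> = (\<Sum>A\<in>proper_parts I. ?t A (I - A))"
    proof (intro sum.cong refl)
      fix A assume A: "A \<in> proper_parts I"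
      then have un: "A \<union> (I - A) = I" by (auto simp: proper_parts_def)
      have "[?lo (?lo ?c I) (rank I ` A), ?up (?lo ?c I) (rank I ` A), ?up ?c I] = three_pieces X n x A (I - A)"
        using split_lower_piece[OF X x, of A "I - A"] I A unfolding un by (auto simp: proper_parts_def)
      then show "Poly_Mapping.single (v, [?lo (?lo ?c I) (rank I ` A), ?up (?lo ?c I) (rank I ` A), ?up ?c I], w)
          (split_sign I * split_sign (rank I ` A)) = ?t A (I - A)"
        unfolding un by simp
    qed
    finally show "(\<Sum>J\<in>proper_parts {..<fst (?lo ?c I)}.
        Poly_Mapping.single (v, [?lo (?lo ?c I) J, ?up (?lo ?c I) J, ?up ?c I], w) (split_sign I * split_sign J))
      = (\<Sum>A\<in>proper_parts I. ?t A (I - A))" .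
  qed
  also have "\<dots> = (\<Sum>(I, A)\<in>(SIGMA I:proper_parts {..<n}. proper_parts I). ?t A (I - A))"
    by (rule sum.Sigma) (auto simp: finite_proper_parts proper_parts_def[of "{..<n}"] intro: finite_proper_parts finite_subset)
  also have "\<dots> = (\<Sum>(A, B)\<in>ordered_splits n. ?t A B)"
    by (rule sum.reindex_bij_witness[where i = "\<lambda>(A, B). (A \<union> B, A)" and j = "\<lambda>(I, A). (A, I - A)"])
      (auto simp: ordered_splits_def proper_parts_def)
  finally have first: "(\<Sum>I\<in>proper_parts {..<n}. \<Sum>J\<in>proper_parts {..<fst (?lo ?c I)}.
      Poly_Mapping.single (v, [?lo (?lo ?c I) J, ?up (?lo ?c I) J, ?up ?c I], w) (split_sign I * split_sign J))
    = (\<Sum>(A, B)\<in>ordered_splits n. ?t A B)" .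
  have "(\<Sum>I\<in>proper_parts {..<n}. \<Sum>J\<in>proper_parts {..<fst (?up ?c I)}.
      Poly_Mapping.single (v, [?lo ?c I, ?lo (?up ?c I) J, ?up (?up ?c I) J], w)
        (split_sign I * ((- 1) ^ (fst (?lo ?c I) + 1) * split_sign J)))
    = (\<Sum>A\<in>proper_parts {..<n}. \<Sum>B\<in>proper_parts ({..<n} - A). - ?t A B)"
  proof (rule sum.cong[OF refl])
    fix A assume A: "A \<in> proper_parts {..<n}"
    let ?r = "\<lambda>B. rank ({..<n} - A) ` B"
    have "(\<Sum>J\<in>proper_parts {..<fst (?up ?c A)}.
      Poly_Mapping.single (v, [?lo ?c A, ?lo (?up ?c A) J, ?up (?up ?c A) J], w)
        (split_sign A * ((- 1) ^ (fst (?lo ?c A) + 1) * split_sign J) :: 'r))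
      = (\<Sum>B\<in>proper_parts ({..<n} - A).
          Poly_Mapping.single (v, [?lo ?c A, ?lo (?up ?c A) (?r B), ?up (?up ?c A) (?r B)], w)
        (split_sign A * ((- 1) ^ (fst (?lo ?c A) + 1) * split_sign (?r B))))"
      using A by (intro sum_proper_parts_rank)
        (auto simp: upper_piece_def proper_parts_def card_Diff_subset finite_subset[of A "{..<n}"])
    also have "\<dots> = (\<Sum>B\<in>proper_parts ({..<n} - A). - ?t A B)"
    proof (intro sum.cong refl)
      fix B assume B: "B \<in> proper_parts ({..<n} - A)"
      then have os: "(A, B) \<in> ordered_splits n" using A by (auto simp: ordered_splits_def proper_parts_def)
      have "[?lo ?c A, ?lo (?up ?c A) (?r B), ?up (?up ?c A) (?r B)] = three_pieces X n x A B"
        by (rule split_upper_piece[OF X x]) (use os in \<open>auto simp: ordered_splits_def\<close>)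
      moreover have "split_sign A * ((- 1) ^ (fst (?lo ?c A) + 1) * split_sign (?r B)) =
        - (split_sign (A \<union> B) * split_sign (rank (A \<union> B) ` A) :: 'r)"
        using split_signs_cancel[OF os, where 'r = 'r] by (simp add: lower_piece_def)
      ultimately show "Poly_Mapping.single (v, [?lo ?c A, ?lo (?up ?c A) (?r B), ?up (?up ?c A) (?r B)], w)
        (split_sign A * ((- 1) ^ (fst (?lo ?c A) + 1) * split_sign (?r B))) = - ?t A B"
        by (simp only: single_uminus)
    qed
    finally show "(\<Sum>J\<in>proper_parts {..<fst (?up ?c A)}.
      Poly_Mapping.single (v, [?lo ?c A, ?lo (?up ?c A) J, ?up (?up ?c A) J], w)
        (split_sign A * ((- 1) ^ (fst (?lo ?c A) + 1) * split_sign J)))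
      = (\<Sum>B\<in>proper_parts ({..<n} - A). - ?t A B)" .
  qed
  also have "\<dots> = (\<Sum>(A, B)\<in>(SIGMA A:proper_parts {..<n}. proper_parts ({..<n} - A)). - ?t A B)"
    by (rule sum.Sigma) (auto simp: finite_proper_parts)
  also have "(SIGMA A:proper_parts {..<n}. proper_parts ({..<n} - A)) = ordered_splits n"
    by (auto simp: ordered_splits_def proper_parts_def)
  finally have second: "(\<Sum>I\<in>proper_parts {..<n}. \<Sum>J\<in>proper_parts {..<fst (?up ?c I)}.
      Poly_Mapping.single (v, [?lo ?c I, ?lo (?up ?c I) J, ?up (?up ?c I) J], w)
        (split_sign I * ((- 1) ^ (fst (?lo ?c I) + 1) * split_sign J)))
    = (\<Sum>(A, B)\<in>ordered_splits n. - ?t A B)" .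
  have "boundary X (boundary X (Poly_Mapping.single (v, [?c], w) 1 :: ('a, 'r) chains))
    = (\<Sum>(A, B)\<in>ordered_splits n. ?t A B) + (\<Sum>(A, B)\<in>ordered_splits n. - ?t A B)"
    unfolding boundary_single_cube boundary_rlinear two sum.distrib fst_conv[of n x] first second ..
  then show ?thesis by (simp add: sum.distrib[symmetric] case_prod_unfold)
qed

text \<open>The boundary of a cube has the opposite parity, so in the double application of the Leibniz rule to
\<open>c\<close> followed by \<open>cs\<close> the two mixed terms cancel.\<close>

lemma boundary_boundary_single:
  assumes X: "precubical_set X" and cs: "set cs \<subseteq> cubes X"
  shows "boundary X (boundary X (Poly_Mapping.single (v, cs, w) 1 :: ('a, 'r::field) chains)) = 0"
  using cs
proof (induction cs arbitrary: v)
  case (Cons c cs)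
  let ?c = "Poly_Mapping.single (v, [c], w) 1 :: ('a, 'r) chains"
  let ?g = "Poly_Mapping.single (w, cs, w) 1 :: ('a, 'r) chains"
  let ?s = "(- 1) ^ (fst c + 1) :: 'r"
  have c: "boundary X (boundary X ?c) = 0"
    using boundary_boundary_single_cube[OF X, of "snd c" "fst c"] Cons.prems by (auto simp: cubes_def)
  have dc: "Poly_Mapping.keys (boundary X ?c) \<subseteq> koszul_parity (- ?s)"
  proof -
    have "Poly_Mapping.keys (boundary X ?c) \<subseteq> (\<Union>I\<in>proper_parts {..<fst c}.
        Poly_Mapping.keys (Poly_Mapping.single (v, [lower_piece X c I, upper_piece X c I], w) (split_sign I :: 'r)))"
      unfolding boundary_single_cube by (rule keys_sum)
    also have "\<dots> \<subseteq> koszul_parity (- ?s)"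
    proof -
      have "(v, [lower_piece X c I, upper_piece X c I], w) \<in> koszul_parity (- ?s)" if "I \<in> proper_parts {..<fst c}" for I
      proof -
        have "card I \<le> fst c" using that card_mono[of "{..<fst c}" I] by (auto simp: proper_parts_def)
        then show ?thesis by (simp add: koszul_parity_def lower_piece_def upper_piece_def)
      qed
      then show ?thesis by auto
    qed
    finally show ?thesis .
  qed
  have "Poly_Mapping.keys ?c \<subseteq> koszul_parity ?s" by (simp add: koszul_parity_def)
  note dcg = boundary_conc[OF this, of X]
  have "Poly_Mapping.single (v, c # cs, w) 1 = conc ?c ?g" by (simp add: conc_single)
  then have "boundary X (boundary X (Poly_Mapping.single (v, c # cs, w) 1)) =
    conc (boundary X (boundary X ?c)) ?g + scal (- ?s) (conc (boundary X ?c) (boundary X ?g)) +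
    scal ?s (conc (boundary X ?c) (boundary X ?g) + scal ?s (conc ?c (boundary X (boundary X ?g))))"
    by (simp only: dcg boundary_rlinear boundary_conc[OF dc])
  moreover have "boundary X (boundary X ?g) = 0" using Cons by simp
  moreover have "scal (- ?s) f + scal ?s f = 0" for f :: "('a, 'r) chains"
    by (rule poly_mapping_eqI) (simp add: lookup_add)
  ultimately show ?case by (simp add: c conc_left conc_right)
qed (simp add: boundary_rlinear)

lemma boundary_boundary:
  fixes f :: "('a, 'r::field) chains"
  assumes X: "precubical_set X" and f: "\<And>v cs w. (v, cs, w) \<in> Poly_Mapping.keys f \<Longrightarrow> set cs \<subseteq> cubes X"
  shows "boundary X (boundary X f) = 0"
proof (rule rlinear_eqI[where f = f and G = "\<lambda>_. 0", OF rlinear_comp[OF rlinear_boundary rlinear_boundary] rlinear_zero order_refl])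
  fix c assume c: "c \<in> Poly_Mapping.keys f"
  obtain v cs w where eq: "c = (v, cs, w)" by (rule prod_cases3)
  show "boundary X (boundary X (Poly_Mapping.single c 1 :: ('a, 'r) chains)) = 0"
    using boundary_boundary_single[OF X f] c unfolding eq by blast
qed

section \<open>Chains as paths\<close>

text \<open>Cube chains in a recursive form that is suited to induction and to splitting a chain at a vertex.\<close>

primrec dpath :: "'a precubical \<Rightarrow> 'a \<Rightarrow> (nat \<times> 'a) list \<Rightarrow> 'a \<Rightarrow> bool" where
  "dpath X v [] w \<longleftrightarrow> v \<in> cells X 0 \<and> v = w"
| "dpath X v (c # cs) w \<longleftrightarrow> c \<in> cubes X \<and> 0 < fst c \<and> vertex X False c = v \<and> dpath X (vertex X True c) cs w"

lemma dpath_ends: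
  assumes "precubical_set X"
  shows "dpath X v cs w \<Longrightarrow> v \<in> cells X 0 \<and> w \<in> cells X 0"
  by (induction cs arbitrary: v) (auto simp: vertex_in_cells[OF assms])

lemma dpath_unique_end: "dpath X v cs w \<Longrightarrow> dpath X v cs w' \<Longrightarrow> w = w'"
  by (induction cs arbitrary: v) auto

lemma dpath_append:
  assumes "precubical_set X"
  shows "dpath X v (cs @ ds) w \<longleftrightarrow> (\<exists>u. dpath X v cs u \<and> dpath X u ds w)"
  by (induction cs arbitrary: v) (auto dest: dpath_ends[OF assms])

lemma dpath_cubes: "dpath X v cs w \<Longrightarrow> set cs \<subseteq> cubes X \<and> (\<forall>c\<in>set cs. 0 < fst c)"
  by (induction cs arbitrary: v) auto

lemma cube_chain_iff_dpath:
  assumes X: "precubical_set X"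
  shows "cube_chain X (v, cs, w) \<longleftrightarrow> dpath X v cs w"
proof (induction cs arbitrary: v)
  case (Cons c cs)
  show ?case
  proof (cases cs)
    case Nil
    then show ?thesis by (auto simp: cube_chain_def vertex_in_cells[OF X])
  next
    case (Cons d ds)
    have all: "(\<forall>k. Q k) \<longleftrightarrow> Q 0 \<and> (\<forall>k. Q (Suc k))" for Q :: "nat \<Rightarrow> bool"
      by (metis not0_implies_Suc)
    have "cube_chain X (v, c # cs, w) \<longleftrightarrow>
      c \<in> cubes X \<and> 0 < fst c \<and> vertex X False c = v \<and> cube_chain X (vertex X True c, cs, w)"
      unfolding cube_chain_def Cons
      by (subst all) (auto simp: vertex_in_cells[OF X])
    then show ?thesis using Cons.IH by simp
  qed
qed (auto simp: cube_chain_def)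

text \<open>The dimension of a chain in a form that is additive under concatenation. For cubes of positive dimension
it agrees with \<open>cdim\<close>, where the subtraction is done once, at the end.\<close>

definition weight :: "(nat \<times> 'a) list \<Rightarrow> nat" where
  "weight cs = (\<Sum>c\<leftarrow>cs. fst c - 1)"

lemma weight_simps [simp]:
  "weight [] = 0" "weight (c # cs) = fst c - 1 + weight cs" "weight (cs @ ds) = weight cs + weight ds"
  by (simp_all add: weight_def)

lemma weight_eq: "(\<forall>c\<in>set cs. 0 < fst c) \<Longrightarrow> weight cs + length cs = sum_list (map fst cs)"
  by (induction cs) auto

lemma Ch_iff:
  assumes X: "precubical_set X"
  shows "(v, cs, w) \<in> Ch X m \<longleftrightarrow> dpath X v cs w \<and> weight cs = m"
proof -
  have "cdim (v, cs, w) = weight cs" if "dpath X v cs w"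
    using weight_eq[of cs] dpath_cubes[OF that] by (simp add: cdim_def)
  then show ?thesis by (auto simp: Ch_def cube_chain_iff_dpath[OF X])
qed

text \<open>The two pieces of a split fit together: the pieces meet in the vertex where the directions in \<open>I\<close>
have been traversed and the others have not.\<close>

lemma vertex_lower_upper:
  assumes X: "precubical_set X" and c: "c \<in> cubes X" and I: "I \<in> proper_parts {..<fst c}"
  shows "lower_piece X c I \<in> cubes X" "upper_piece X c I \<in> cubes X"
    "0 < fst (lower_piece X c I)" "0 < fst (upper_piece X c I)"
    "fst (lower_piece X c I) + fst (upper_piece X c I) = fst c"
    "vertex X False (lower_piece X c I) = vertex X False c"
    "vertex X True (upper_piece X c I) = vertex X True c"
    "vertex X True (lower_piece X c I) = vertex X False (upper_piece X c I)"
proof -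
  obtain n x where nx: "c = (n, x)" by force
  have x: "x \<in> cells X n" using c nx by (simp add: cubes_def)
  have IS: "I \<subseteq> {..<n}" "I \<noteq> {}" "I \<noteq> {..<n}" using I nx by (auto simp: proper_parts_def)
  have fin: "finite I" using IS finite_subset by blast
  have lt: "card I < n" using IS psubset_card_mono[of "{..<n}" I] by (simp add: psubset_eq)
  have pos: "0 < card I" using IS fin by (simp add: card_gt_0_iff)
  have m: "card I = n - card ({..<n} - I)" using IS fin lt by (simp add: card_Diff_subset)
  have DD: "{..<n} - ({..<n} - I) = I" using IS by auto
  show "lower_piece X c I \<in> cubes X"
    using multi_face_in_cells[OF X x, of "{..<n} - I" False] m by (simp add: nx lower_piece_def cubes_def)
  show "upper_piece X c I \<in> cubes X"
    using multi_face_in_cells[OF X x, of I True] IS by (simp add: nx upper_piece_def cubes_def)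
  show "0 < fst (lower_piece X c I)" "0 < fst (upper_piece X c I)"
    "fst (lower_piece X c I) + fst (upper_piece X c I) = fst c"
    using pos lt by (simp_all add: nx lower_piece_def upper_piece_def)
  have lo: "vertex X e (lower_piece X c I) = mixed_face X (two_marks False ({..<n} - I) e I) n n x" for e
    using vertex_multi_face[OF X x _ m, of e False] by (simp add: nx lower_piece_def DD)
  have up: "vertex X e (upper_piece X c I) = mixed_face X (two_marks True I e ({..<n} - I)) n n x" for e
    using vertex_multi_face[OF X x IS(1) refl, of e True] by (simp add: nx upper_piece_def)
  show "vertex X False (lower_piece X c I) = vertex X False c"
    unfolding lo unfolding nx vertex_eq_mixed_face by (rule mixed_face_cong) (auto simp: two_marks_def)
  show "vertex X True (upper_piece X c I) = vertex X True c"
    unfolding up unfolding nx vertex_eq_mixed_face by (rule mixed_face_cong) (auto simp: two_marks_def)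
  show "vertex X True (lower_piece X c I) = vertex X False (upper_piece X c I)"
    unfolding lo up by (rule mixed_face_cong) (auto simp: two_marks_def)
qed

lemma boundary_single_keys:
  assumes X: "precubical_set X" and cs: "dpath X v cs w"
  shows "Poly_Mapping.keys (boundary X (Poly_Mapping.single (v, cs, w) 1 :: ('a, 'r::field) chains)) \<subseteq>
    {(v, ds, w) | ds. dpath X v ds w \<and> weight cs = Suc (weight ds)}"
proof -
  let ?d = "\<lambda>k I. take k cs @ [lower_piece X (cs ! k) I, upper_piece X (cs ! k) I] @ drop (Suc k) cs"
  have "dpath X v (?d k I) w \<and> weight cs = Suc (weight (?d k I))"
    if k: "k < length cs" and I: "I \<in> proper_parts {..<fst (cs ! k)}" for k I
  proof -
    let ?c = "cs ! k"
    have split: "cs = take k cs @ ?c # drop (Suc k) cs" by (rule id_take_nth_drop[OF k])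
    obtain u where u: "dpath X v (take k cs) u" "dpath X u (?c # drop (Suc k) cs) w"
      using cs dpath_append[OF X] split by metis
    then have c: "?c \<in> cubes X" by simp
    note pieces = vertex_lower_upper[OF X c I]
    have "dpath X u ([lower_piece X ?c I, upper_piece X ?c I] @ drop (Suc k) cs) w"
      using u(2) pieces by simp
    then have "dpath X v (?d k I) w" using u(1) dpath_append[OF X] by blast
    moreover have "weight cs = Suc (weight (?d k I))"
      using pieces by (subst split) simp
    ultimately show ?thesis ..
  qed
  then have "Poly_Mapping.keys (Poly_Mapping.single (v, ?d k I, w) a :: ('a, 'r) chains) \<subseteq>
      {(v, ds, w) | ds. dpath X v ds w \<and> weight cs = Suc (weight ds)}"
    if "k < length cs" "I \<in> proper_parts {..<fst (cs ! k)}" for k I a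
    using that by auto
  then have "(\<Union>k\<in>{..<length cs}. \<Union>I\<in>proper_parts {..<fst (cs ! k)}. Poly_Mapping.keys
      (Poly_Mapping.single (v, ?d k I, w) ((- 1) ^ ((\<Sum>j<k. fst (cs ! j)) + k) * split_sign I) :: ('a, 'r) chains))
    \<subseteq> {(v, ds, w) | ds. dpath X v ds w \<and> weight cs = Suc (weight ds)}"
    by blast
  moreover have "Poly_Mapping.keys (boundary X (Poly_Mapping.single (v, cs, w) 1 :: ('a, 'r) chains)) \<subseteq>
    (\<Union>k\<in>{..<length cs}. \<Union>I\<in>proper_parts {..<fst (cs ! k)}. Poly_Mapping.keys
      (Poly_Mapping.single (v, ?d k I, w) ((- 1) ^ ((\<Sum>j<k. fst (cs ! j)) + k) * split_sign I) :: ('a, 'r) chains))"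
    unfolding boundary_single by (rule order.trans[OF keys_sum]) (blast dest: subsetD[OF keys_sum])
  ultimately show ?thesis by (rule order.trans[rotated])
qed

lemma boundary_keys:
  assumes X: "precubical_set X" and f: "Poly_Mapping.keys f \<subseteq> Ch X (Suc m)"
  shows "Poly_Mapping.keys (boundary X f) \<subseteq> Ch X m"
proof (rule rlinear_keys[OF rlinear_boundary f])
  fix c :: "'a cchain" assume "c \<in> Ch X (Suc m)"
  then obtain v cs w where c: "c = (v, cs, w)" "dpath X v cs w" "weight cs = Suc m"
    by (metis Ch_iff[OF X] prod_cases3)
  then show "Poly_Mapping.keys (boundary X (Poly_Mapping.single c 1 :: ('a, 'b) chains)) \<subseteq> Ch X m"
    using boundary_single_keys[OF X c(2), where 'r = 'b] by (auto simp: Ch_iff[OF X])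
qed

lemma boundary_dim_0:
  fixes f :: "('a, 'r::field) chains"
  assumes X: "precubical_set X" and f: "Poly_Mapping.keys f \<subseteq> Ch X 0"
  shows "boundary X f = 0"
proof (rule rlinear_eqI[OF rlinear_boundary rlinear_zero f])
  fix c :: "'a cchain" assume "c \<in> Ch X 0"
  then obtain v cs w where c: "c = (v, cs, w)" "dpath X v cs w" "weight cs = 0"
    by (metis Ch_iff[OF X] prod_cases3)
  then have "Poly_Mapping.keys (boundary X (Poly_Mapping.single c 1 :: ('a, 'r) chains)) \<subseteq> {}"
    using boundary_single_keys[OF X c(2), where 'r = 'r] by auto
  then show "boundary X (Poly_Mapping.single c 1 :: ('a, 'r) chains) = 0"
    by (simp add: keys_eq_empty)
qed

lemma Ch_koszul_parity:
  assumes X: "precubical_set X"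
  shows "Ch X m \<subseteq> koszul_parity ((- 1) ^ m)"
proof
  fix c assume "c \<in> Ch X m"
  then obtain v cs w where c: "c = (v, cs, w)" "dpath X v cs w" "weight cs = m"
    by (metis Ch_iff[OF X] prod_cases3)
  have "sum_list (map fst cs) + length cs = m + 2 * length cs"
    using weight_eq[of cs] dpath_cubes[OF c(2)] c(3) by simp
  then show "c \<in> koszul_parity ((- 1) ^ m)" using c by (auto simp: koszul_parity_def power_add)
qed

lemma boundary_conc_path_left:
  fixes p f :: "('a, 'r::field) chains"
  assumes X: "precubical_set X" and p: "Poly_Mapping.keys p \<subseteq> Ch X 0"
  shows "boundary X (conc p f) = conc p (boundary X f)"
  using boundary_conc[of p 1 X f] order.trans[OF p Ch_koszul_parity[OF X, of 0, where 'b = 'r]] boundary_dim_0[OF X p]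
  by (simp add: conc_left)

lemma boundary_conc_path_right:
  fixes f q :: "('a, 'r::field) chains"
  assumes X: "precubical_set X" and f: "Poly_Mapping.keys f \<subseteq> Ch X m" and q: "Poly_Mapping.keys q \<subseteq> Ch X 0"
  shows "boundary X (conc f q) = conc (boundary X f) q"
  using boundary_conc[of f "(- 1) ^ m" X q] order.trans[OF f Ch_koszul_parity[OF X, of m, where 'b = 'r]] boundary_dim_0[OF X q]
  by (simp add: conc_right)

lemma conc_keys:
  fixes f g :: "('a, 'r::field) chains"
  assumes X: "precubical_set X" and f: "Poly_Mapping.keys f \<subseteq> Ch X m" and g: "Poly_Mapping.keys g \<subseteq> Ch X n"
  shows "Poly_Mapping.keys (conc f g) \<subseteq> Ch X (m + n)"
proof (rule rlinear_keys[OF rlinear_conc_left f])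
  fix c assume c: "c \<in> Ch X m"
  show "Poly_Mapping.keys (conc (Poly_Mapping.single c 1) g) \<subseteq> Ch X (m + n)"
  proof (rule rlinear_keys[OF rlinear_conc_right g])
    fix d assume d: "d \<in> Ch X n"
    obtain v cs u u' ds w where eq: "c = (v, cs, u)" "d = (u', ds, w)" by (metis prod_cases3)
    then show "Poly_Mapping.keys (conc (Poly_Mapping.single c 1) (Poly_Mapping.single d 1) :: ('a, 'r) chains) \<subseteq> Ch X (m + n)"
      using c d by (auto simp: conc_single Ch_iff[OF X] dpath_append[OF X])
  qed
qed

section \<open>Sub-precubical sets\<close>

lemma sub_precubicalD:
  assumes "sub_precubical Y X"
  shows "precubical_set Y" "cells Y n \<subseteq> cells X n"
    "x \<in> cells Y n \<Longrightarrow> i < n \<Longrightarrow> face Y e n i x = face X e n i x"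
  using assms by (auto simp: sub_precubical_def)

lemma mixed_face_sub:
  assumes "sub_precubical Y X"
  shows "x \<in> cells Y d \<Longrightarrow> i \<le> d \<Longrightarrow> mixed_face Y g i d x = mixed_face X g i d x"
proof (induction i arbitrary: d x)
  case (Suc i)
  have "face Y e d i x \<in> cells Y (d - 1)" for e
    using Suc.prems face_in_cells[OF sub_precubicalD(1)[OF assms]] by auto
  then show ?case using Suc sub_precubicalD(3)[OF assms, of x d i]
    by (auto split: option.splits)
qed simp

lemma multi_face_sub:
  assumes "sub_precubical Y X" "x \<in> cells Y n" "I \<subseteq> {..<n}"
  shows "multi_face Y e n I x = multi_face X e n I x"
  using mixed_face_sub[OF assms(1,2)] assms(3) by (simp add: multi_face_eq_mixed_face)

lemma vertex_sub: "sub_precubical Y X \<Longrightarrow> c \<in> cubes Y \<Longrightarrow> vertex Y e c = vertex X e c"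
  by (auto simp: vertex_def multi_face_sub cubes_def)

lemma cubes_sub: "sub_precubical Y X \<Longrightarrow> cubes Y \<subseteq> cubes X"
  using sub_precubicalD(2) by (fastforce simp: cubes_def)

lemma dpath_sub_iff:
  assumes "sub_precubical Y X"
  shows "dpath Y v cs w \<longleftrightarrow> dpath X v cs w \<and> set cs \<subseteq> cubes Y \<and> v \<in> cells Y 0"
proof (induction cs arbitrary: v)
  case Nil
  then show ?case using sub_precubicalD(2)[OF assms, of 0] by auto
next
  case (Cons c cs)
  show ?case
  proof (cases "c \<in> cubes Y")
    case True
    have "vertex Y e c = vertex X e c" "vertex X e c \<in> cells Y 0" for e
      using vertex_sub[OF assms True] vertex_in_cells[OF sub_precubicalD(1)[OF assms] True] by metis+
    then show ?thesis using Cons.IH True cubes_sub[OF assms] by auto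
  qed simp
qed

lemma Ch_sub:
  assumes "precubical_set X" "sub_precubical Y X"
  shows "Ch Y m \<subseteq> Ch X m"
  using dpath_sub_iff[OF assms(2)] Ch_iff[OF assms(1)] Ch_iff[OF sub_precubicalD(1)[OF assms(2)]] by auto

lemma boundary_sub:
  fixes f :: "('a, 'r::field) chains"
  assumes sub: "sub_precubical Y X" and f: "Poly_Mapping.keys f \<subseteq> Ch Y m"
  shows "boundary Y f = boundary X f"
proof (rule rlinear_eqI[OF rlinear_boundary rlinear_boundary f])
  fix c assume "c \<in> Ch Y m"
  then obtain v cs w where c: "c = (v, cs, w)" "dpath Y v cs w"
    by (metis Ch_iff[OF sub_precubicalD(1)[OF sub]] prod_cases3)
  have "lower_piece Y (cs ! k) I = lower_piece X (cs ! k) I \<and> upper_piece Y (cs ! k) I = upper_piece X (cs ! k) I"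
    if "k < length cs" "I \<in> proper_parts {..<fst (cs ! k)}" for k I
  proof -
    have "cs ! k \<in> cubes Y" using dpath_cubes[OF c(2)] that(1) by (auto dest: nth_mem)
    then show ?thesis using that(2)
      by (auto simp: lower_piece_def upper_piece_def multi_face_sub[OF sub] cubes_def proper_parts_def)
  qed
  then show "boundary Y (Poly_Mapping.single c 1 :: ('a, 'r) chains) = boundary X (Poly_Mapping.single c 1)"
    unfolding c boundary_single by (intro sum.cong refl) auto
qed

section \<open>Quotients of bimodules\<close>

text \<open>Bimodules without the unit laws. They are needed because the unit of \<open>R[Y]\<close> acts on \<open>R[X]\<close> as the
projection to the paths that start, or end, in \<open>Y\<close>, so that the outer factors of an extension of scalars
are not unital over \<open>R[Y]\<close>.\<close>

locale biaction = A?: ring A + B?: ring B + M?: abelian_group M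
  for A :: "('l, 'x) ring_scheme" and B :: "('r, 'y) ring_scheme"
    and M :: "('l, 'm, 'r) bimodule" +
  assumes lact_closed: "\<lbrakk>a \<in> carrier A; x \<in> carrier M\<rbrakk> \<Longrightarrow> smult M a x \<in> carrier M"
    and ract_closed: "\<lbrakk>x \<in> carrier M; b \<in> carrier B\<rbrakk> \<Longrightarrow> rsmult M x b \<in> carrier M"
    and lact_add: "\<lbrakk>a \<in> carrier A; x \<in> carrier M; y \<in> carrier M\<rbrakk> \<Longrightarrow>
      smult M a (x \<oplus>\<^bsub>M\<^esub> y) = smult M a x \<oplus>\<^bsub>M\<^esub> smult M a y"
    and ract_add: "\<lbrakk>x \<in> carrier M; y \<in> carrier M; b \<in> carrier B\<rbrakk> \<Longrightarrow>
      rsmult M (x \<oplus>\<^bsub>M\<^esub> y) b = rsmult M x b \<oplus>\<^bsub>M\<^esub> rsmult M y b"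
    and add_lact: "\<lbrakk>a \<in> carrier A; a' \<in> carrier A; x \<in> carrier M\<rbrakk> \<Longrightarrow>
      smult M (a \<oplus>\<^bsub>A\<^esub> a') x = smult M a x \<oplus>\<^bsub>M\<^esub> smult M a' x"
    and add_ract: "\<lbrakk>x \<in> carrier M; b \<in> carrier B; b' \<in> carrier B\<rbrakk> \<Longrightarrow>
      rsmult M x (b \<oplus>\<^bsub>B\<^esub> b') = rsmult M x b \<oplus>\<^bsub>M\<^esub> rsmult M x b'"
    and lact_assoc: "\<lbrakk>a \<in> carrier A; a' \<in> carrier A; x \<in> carrier M\<rbrakk> \<Longrightarrow>
      smult M (a \<otimes>\<^bsub>A\<^esub> a') x = smult M a (smult M a' x)"
    and ract_assoc: "\<lbrakk>x \<in> carrier M; b \<in> carrier B; b' \<in> carrier B\<rbrakk> \<Longrightarrow>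
      rsmult M x (b \<otimes>\<^bsub>B\<^esub> b') = rsmult M (rsmult M x b) b'"
    and lact_ract: "\<lbrakk>a \<in> carrier A; x \<in> carrier M; b \<in> carrier B\<rbrakk> \<Longrightarrow>
      rsmult M (smult M a x) b = smult M a (rsmult M x b)"

lemma bimodule_iff_biaction:
  "bimodule A B M \<longleftrightarrow> biaction A B M \<and> (\<forall>x\<in>carrier M. smult M \<one>\<^bsub>A\<^esub> x = x) \<and> (\<forall>x\<in>carrier M. rsmult M x \<one>\<^bsub>B\<^esub> = x)"
  unfolding bimodule_def biaction_def bimodule_axioms_def biaction_axioms_def Ball_def
  by (rule iffI; elim conjE; intro conjI; assumption)

abbreviation add_hom :: "('m, 'a) ring_scheme \<Rightarrow> ('p, 'b) ring_scheme \<Rightarrow> ('m \<Rightarrow> 'p) set" where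
  "add_hom M P \<equiv> hom (add_monoid M) (add_monoid P)"

lemma add_homI:
  assumes "\<And>x. x \<in> carrier M \<Longrightarrow> f x \<in> carrier P"
    and "\<And>x y. x \<in> carrier M \<Longrightarrow> y \<in> carrier M \<Longrightarrow> f (x \<oplus>\<^bsub>M\<^esub> y) = f x \<oplus>\<^bsub>P\<^esub> f y"
  shows "f \<in> add_hom M P"
  using assms by (auto simp: hom_def)

lemma add_homD:
  assumes "f \<in> add_hom M P"
  shows "x \<in> carrier M \<Longrightarrow> f x \<in> carrier P"
    and "x \<in> carrier M \<Longrightarrow> y \<in> carrier M \<Longrightarrow> f (x \<oplus>\<^bsub>M\<^esub> y) = f x \<oplus>\<^bsub>P\<^esub> f y"
  using assms by (auto simp: hom_def)

lemma add_hom_group: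
  assumes "abelian_group M" "abelian_group P" "f \<in> add_hom M P"
  shows "f \<zero>\<^bsub>M\<^esub> = \<zero>\<^bsub>P\<^esub>"
    and "x \<in> carrier M \<Longrightarrow> f (\<ominus>\<^bsub>M\<^esub> x) = \<ominus>\<^bsub>P\<^esub> f x"
    and "x \<in> carrier M \<Longrightarrow> y \<in> carrier M \<Longrightarrow> f (x \<ominus>\<^bsub>M\<^esub> y) = f x \<ominus>\<^bsub>P\<^esub> f y"
proof -
  interpret M: abelian_group M by fact
  interpret P: abelian_group P by fact
  have "group_hom (add_monoid M) (add_monoid P) f"
    using M.a_group P.a_group assms(3) by (simp add: group_hom_def group_hom_axioms_def)
  then interpret abelian_group_hom M P f
    using assms by (simp add: abelian_group_hom_def abelian_group_hom_axioms_def)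
  show "f \<zero>\<^bsub>M\<^esub> = \<zero>\<^bsub>P\<^esub>" by simp
  show "x \<in> carrier M \<Longrightarrow> f (\<ominus>\<^bsub>M\<^esub> x) = \<ominus>\<^bsub>P\<^esub> f x" for x by simp
  then show "x \<in> carrier M \<Longrightarrow> y \<in> carrier M \<Longrightarrow> f (x \<ominus>\<^bsub>M\<^esub> y) = f x \<ominus>\<^bsub>P\<^esub> f y"
    by (simp add: a_minus_def)
qed

lemma additive_subgroup_mem:
  assumes "additive_subgroup N M"
  shows "\<zero>\<^bsub>M\<^esub> \<in> N" "x \<in> N \<Longrightarrow> x \<in> carrier M" "x \<in> N \<Longrightarrow> y \<in> N \<Longrightarrow> x \<oplus>\<^bsub>M\<^esub> y \<in> N"
    "abelian_group M \<Longrightarrow> x \<in> N \<Longrightarrow> \<ominus>\<^bsub>M\<^esub> x \<in> N"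
proof -
  interpret additive_subgroup N M by fact
  show "\<zero>\<^bsub>M\<^esub> \<in> N" "x \<in> N \<Longrightarrow> x \<in> carrier M" "x \<in> N \<Longrightarrow> y \<in> N \<Longrightarrow> x \<oplus>\<^bsub>M\<^esub> y \<in> N"
    "abelian_group M \<Longrightarrow> x \<in> N \<Longrightarrow> \<ominus>\<^bsub>M\<^esub> x \<in> N"
    using a_subset by auto
qed

lemma additive_subgroupI':
  assumes "abelian_group M" "N \<subseteq> carrier M" "\<zero>\<^bsub>M\<^esub> \<in> N"
    and "\<And>x y. x \<in> N \<Longrightarrow> y \<in> N \<Longrightarrow> x \<oplus>\<^bsub>M\<^esub> y \<in> N" and "\<And>x. x \<in> N \<Longrightarrow> \<ominus>\<^bsub>M\<^esub> x \<in> N"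
  shows "additive_subgroup N M"
proof (rule additive_subgroupI)
  interpret M: abelian_group M by fact
  show "subgroup N (add_monoid M)"
    using assms by (intro subgroup.intro) (auto simp: a_inv_def)
qed

lemma coset_eq_iff:
  assumes "abelian_group M" "additive_subgroup N M" "x \<in> carrier M" "y \<in> carrier M"
  shows "N +>\<^bsub>M\<^esub> x = N +>\<^bsub>M\<^esub> y \<longleftrightarrow> x \<ominus>\<^bsub>M\<^esub> y \<in> N"
proof -
  interpret abelian_subgroup N M using assms by (simp add: abelian_subgroupI3)
  show ?thesis
    using a_rcos_module[OF assms(4,3)] a_repr_independence'[of x y] a_rcos_self assms(3,4)
    by (auto simp: a_minus_def)
qed

lemma coset_zero:
  assumes "abelian_group M" "additive_subgroup N M"
  shows "N +>\<^bsub>M\<^esub> \<zero>\<^bsub>M\<^esub> = N" "x \<in> carrier M \<Longrightarrow> N +>\<^bsub>M\<^esub> x = N \<longleftrightarrow> x \<in> N"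
proof -
  interpret abelian_subgroup N M using assms by (simp add: abelian_subgroupI3)
  show "N +>\<^bsub>M\<^esub> \<zero>\<^bsub>M\<^esub> = N" using a_subset by simp
  show "x \<in> carrier M \<Longrightarrow> N +>\<^bsub>M\<^esub> x = N \<longleftrightarrow> x \<in> N"
    using a_rcos_const[of x] a_rcos_self[of x] by blast
qed

lemma coset_restrict [simp]: "N +>\<^bsub>M\<lparr>carrier := K\<rparr>\<^esub> x = N +>\<^bsub>M\<^esub> x"
  by (simp add: a_r_coset_def r_coset_def)

lemma quot_carrier: "carrier (quot_bimodule M N) = (\<lambda>x. N +>\<^bsub>M\<^esub> x) ` carrier M"
  unfolding quot_bimodule_def A_RCOSETS_defs RCOSETS_def a_r_coset_def by auto

lemma quot_simps:
  "zero (quot_bimodule M N) = N" "add (quot_bimodule M N) = set_add M"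
  "smult (quot_bimodule M N) a = quot_map M N (\<lambda>x. smult M a x)"
  "rsmult (quot_bimodule M N) C b = quot_map M N (\<lambda>x. rsmult M x b) C"
  by (simp_all add: quot_bimodule_def)

lemma quot_add:
  assumes "abelian_group M" "additive_subgroup N M" "x \<in> carrier M" "y \<in> carrier M"
  shows "(N +>\<^bsub>M\<^esub> x) \<oplus>\<^bsub>quot_bimodule M N\<^esub> (N +>\<^bsub>M\<^esub> y) = N +>\<^bsub>M\<^esub> (x \<oplus>\<^bsub>M\<^esub> y)"
proof -
  interpret abelian_subgroup N M using assms by (simp add: abelian_subgroupI3)
  show ?thesis using assms by (simp add: quot_simps a_rcos_sum)
qed

lemma quot_abelian_group:
  assumes "abelian_group M" "additive_subgroup N M"
  shows "abelian_group (quot_bimodule M N)"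
proof -
  interpret M: abelian_group M by fact
  note [simp] = quot_carrier quot_add[OF assms]
  have zero: "\<zero>\<^bsub>quot_bimodule M N\<^esub> = N +>\<^bsub>M\<^esub> \<zero>\<^bsub>M\<^esub>"
    using coset_zero(1)[OF assms] by (simp add: quot_simps)
  show ?thesis
  proof (rule abelian_groupI)
    fix C assume "C \<in> carrier (quot_bimodule M N)"
    then obtain x where x: "x \<in> carrier M" "C = N +>\<^bsub>M\<^esub> x" by auto
    then have "(N +>\<^bsub>M\<^esub> (\<ominus>\<^bsub>M\<^esub> x)) \<oplus>\<^bsub>quot_bimodule M N\<^esub> C = \<zero>\<^bsub>quot_bimodule M N\<^esub>"
      by (simp add: zero M.l_neg)
    then show "\<exists>D\<in>carrier (quot_bimodule M N). D \<oplus>\<^bsub>quot_bimodule M N\<^esub> C = \<zero>\<^bsub>quot_bimodule M N\<^esub>"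
      using x by (intro bexI[of _ "N +>\<^bsub>M\<^esub> (\<ominus>\<^bsub>M\<^esub> x)"]) auto
  next
    fix C D assume "C \<in> carrier (quot_bimodule M N)" "D \<in> carrier (quot_bimodule M N)"
    then obtain x y where x: "x \<in> carrier M" "C = N +>\<^bsub>M\<^esub> x" and y: "y \<in> carrier M" "D = N +>\<^bsub>M\<^esub> y" by auto
    show "C \<oplus>\<^bsub>quot_bimodule M N\<^esub> D = D \<oplus>\<^bsub>quot_bimodule M N\<^esub> C"
      using x y M.a_comm[of x y] by simp
    fix E assume "E \<in> carrier (quot_bimodule M N)"
    then obtain z where z: "z \<in> carrier M" "E = N +>\<^bsub>M\<^esub> z" by auto
    show "C \<oplus>\<^bsub>quot_bimodule M N\<^esub> D \<oplus>\<^bsub>quot_bimodule M N\<^esub> E =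
        C \<oplus>\<^bsub>quot_bimodule M N\<^esub> (D \<oplus>\<^bsub>quot_bimodule M N\<^esub> E)"
      using x y z M.a_assoc[of x y z] by simp
  qed (auto simp: zero)
qed

lemma coset_hom:
  assumes "abelian_group M" "additive_subgroup N M"
  shows "(\<lambda>x. N +>\<^bsub>M\<^esub> x) \<in> add_hom M (quot_bimodule M N)"
  by (rule add_homI) (auto simp: quot_carrier quot_add[OF assms])

lemma quot_map_coset:
  assumes "abelian_group M" "additive_subgroup N M" "abelian_group P" "additive_subgroup N' P"
    and f: "f \<in> add_hom M P" and fN: "\<And>x. x \<in> N \<Longrightarrow> f x \<in> N'" and x: "x \<in> carrier M"
  shows "quot_map P N' f (N +>\<^bsub>M\<^esub> x) = N' +>\<^bsub>P\<^esub> f x"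
proof -
  interpret N: abelian_subgroup N M using assms by (simp add: abelian_subgroupI3)
  have eq: "N' +>\<^bsub>P\<^esub> f z = N' +>\<^bsub>P\<^esub> f x" if z: "z \<in> N +>\<^bsub>M\<^esub> x" for z
  proof -
    have zM: "z \<in> carrier M" using z x N.a_elemrcos_carrier by blast
    have "z \<ominus>\<^bsub>M\<^esub> x \<in> N" using N.a_rcos_module[OF x zM] z by (simp add: a_minus_def)
    then have "f z \<ominus>\<^bsub>P\<^esub> f x \<in> N'" using fN add_hom_group(3)[OF assms(1,3) f zM x] by metis
    then show ?thesis using coset_eq_iff[OF assms(3,4)] add_homD(1)[OF f] zM x by blast
  qed
  have "x \<in> N +>\<^bsub>M\<^esub> x" using N.a_rcos_self x by blast
  then show ?thesis unfolding quot_map_def using eq by blast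
qed

lemma quot_map_hom:
  assumes "abelian_group M" "additive_subgroup N M" "abelian_group P" "additive_subgroup N' P"
    and f: "f \<in> add_hom M P" and fN: "\<And>x. x \<in> N \<Longrightarrow> f x \<in> N'"
  shows "quot_map P N' f \<in> add_hom (quot_bimodule M N) (quot_bimodule P N')"
proof -
  interpret M: abelian_group M by fact
  show ?thesis
    by (rule add_homI)
      (auto simp: quot_carrier quot_add assms(1-4) quot_map_coset[OF assms] add_homD[OF f])
qed

definition sub_biaction :: "('l, 'x) ring_scheme \<Rightarrow> ('r, 'y) ring_scheme \<Rightarrow> ('l, 'm, 'r) bimodule \<Rightarrow> 'm set \<Rightarrow> bool" where
  "sub_biaction A B M N \<longleftrightarrow> additive_subgroup N M \<and>
     (\<forall>a\<in>carrier A. \<forall>x\<in>N. smult M a x \<in> N) \<and> (\<forall>b\<in>carrier B. \<forall>x\<in>N. rsmult M x b \<in> N)"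

lemma lact_hom: "biaction A B M \<Longrightarrow> a \<in> carrier A \<Longrightarrow> (\<lambda>x. smult M a x) \<in> add_hom M M"
  by (rule add_homI) (auto simp: biaction.lact_closed biaction.lact_add)

lemma ract_hom: "biaction A B M \<Longrightarrow> b \<in> carrier B \<Longrightarrow> (\<lambda>x. rsmult M x b) \<in> add_hom M M"
  by (rule add_homI) (auto simp: biaction.ract_closed biaction.ract_add)

lemma quot_act:
  assumes M: "biaction A B M" and N: "sub_biaction A B M N" and x: "x \<in> carrier M"
  shows "a \<in> carrier A \<Longrightarrow> smult (quot_bimodule M N) a (N +>\<^bsub>M\<^esub> x) = N +>\<^bsub>M\<^esub> smult M a x"
    and "b \<in> carrier B \<Longrightarrow> rsmult (quot_bimodule M N) (N +>\<^bsub>M\<^esub> x) b = N +>\<^bsub>M\<^esub> rsmult M x b"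
proof -
  interpret M: biaction A B M by fact
  have N': "additive_subgroup N M" using N by (simp add: sub_biaction_def)
  show "a \<in> carrier A \<Longrightarrow> smult (quot_bimodule M N) a (N +>\<^bsub>M\<^esub> x) = N +>\<^bsub>M\<^esub> smult M a x"
    unfolding quot_simps
    by (rule quot_map_coset[OF M.abelian_group_axioms N' M.abelian_group_axioms N' lact_hom[OF M] _ x])
      (use N in \<open>auto simp: sub_biaction_def\<close>)
  show "b \<in> carrier B \<Longrightarrow> rsmult (quot_bimodule M N) (N +>\<^bsub>M\<^esub> x) b = N +>\<^bsub>M\<^esub> rsmult M x b"
    unfolding quot_simps
    by (rule quot_map_coset[OF M.abelian_group_axioms N' M.abelian_group_axioms N' ract_hom[OF M] _ x])
      (use N in \<open>auto simp: sub_biaction_def\<close>)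
qed

lemma quot_biaction:
  assumes M: "biaction A B M" and N: "sub_biaction A B M N"
  shows "biaction A B (quot_bimodule M N)"
proof -
  interpret M: biaction A B M by fact
  have N': "additive_subgroup N M" using N by (simp add: sub_biaction_def)
  note ag = M.abelian_group_axioms
  note [simp] = quot_act[OF M N] quot_add[OF ag N'] M.lact_closed M.ract_closed M.lact_add M.ract_add
    M.add_lact M.add_ract M.lact_assoc M.ract_assoc M.lact_ract
  show ?thesis
    by (intro biaction.intro biaction_axioms.intro M.A.ring_axioms M.B.ring_axioms quot_abelian_group[OF ag N'])
      (auto simp: quot_carrier)
qed

lemma quot_bimodule_bimodule:
  assumes "bimodule A B M" "sub_biaction A B M N"
  shows "bimodule A B (quot_bimodule M N)"
proof -
  have M: "biaction A B M" using assms by (simp add: bimodule_iff_biaction)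
  interpret bimodule A B M by fact
  show ?thesis
    using assms quot_biaction[OF M assms(2)]
    by (auto simp: bimodule_iff_biaction quot_carrier quot_act[OF M assms(2)])
qed

lemma restrict_simps [simp]:
  "zero (M\<lparr>carrier := K\<rparr>) = zero M" "add (M\<lparr>carrier := K\<rparr>) = add M"
  "smult (M\<lparr>carrier := K\<rparr>) = smult M" "rsmult (M\<lparr>carrier := K\<rparr>) = rsmult M"
  for M :: "('l, 'm, 'r) bimodule"
  by (simp_all)

lemma restrict_biaction:
  assumes M: "biaction A B M" and K: "sub_biaction A B M K"
  shows "biaction A B (M\<lparr>carrier := K\<rparr>)"
proof -
  interpret M: biaction A B M by fact
  have K': "additive_subgroup K M" using K by (simp add: sub_biaction_def)
  note mem = additive_subgroup_mem[OF K']
  have ag: "abelian_group (M\<lparr>carrier := K\<rparr>)"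
  proof (rule abelian_groupI)
    fix x assume "x \<in> carrier (M\<lparr>carrier := K\<rparr>)"
    then have "\<ominus>\<^bsub>M\<^esub> x \<in> K" "\<ominus>\<^bsub>M\<^esub> x \<oplus>\<^bsub>M\<^esub> x = \<zero>\<^bsub>M\<^esub>"
      using mem M.abelian_group_axioms M.l_neg by auto
    then show "\<exists>y\<in>carrier (M\<lparr>carrier := K\<rparr>). y \<oplus>\<^bsub>M\<lparr>carrier := K\<rparr>\<^esub> x = \<zero>\<^bsub>M\<lparr>carrier := K\<rparr>\<^esub>"
      by auto
  next
    fix x y assume "x \<in> carrier (M\<lparr>carrier := K\<rparr>)" "y \<in> carrier (M\<lparr>carrier := K\<rparr>)"
    then have xy: "x \<in> K" "y \<in> K" by simp_all
    show "x \<oplus>\<^bsub>M\<lparr>carrier := K\<rparr>\<^esub> y = y \<oplus>\<^bsub>M\<lparr>carrier := K\<rparr>\<^esub> x"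
      using xy M.a_comm[of x y] by (simp add: mem(2))
    fix z assume "z \<in> carrier (M\<lparr>carrier := K\<rparr>)"
    then show "x \<oplus>\<^bsub>M\<lparr>carrier := K\<rparr>\<^esub> y \<oplus>\<^bsub>M\<lparr>carrier := K\<rparr>\<^esub> z =
        x \<oplus>\<^bsub>M\<lparr>carrier := K\<rparr>\<^esub> (y \<oplus>\<^bsub>M\<lparr>carrier := K\<rparr>\<^esub> z)"
      using xy M.a_assoc[of x y z] by (simp add: mem(2))
  qed (simp_all add: mem(1-3))
  let ?K = "M\<lparr>carrier := K\<rparr>"
  have car: "carrier ?K = K" by simp
  show ?thesis
  proof (intro biaction.intro biaction_axioms.intro M.A.ring_axioms M.B.ring_axioms ag)
    show "smult ?K a x \<in> carrier ?K" if "a \<in> carrier A" "x \<in> carrier ?K" for a x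
      using that K by (simp add: sub_biaction_def)
    show "rsmult ?K x b \<in> carrier ?K" if "x \<in> carrier ?K" "b \<in> carrier B" for x b
      using that K by (simp add: sub_biaction_def)
    show "smult ?K a (x \<oplus>\<^bsub>?K\<^esub> y) = smult ?K a x \<oplus>\<^bsub>?K\<^esub> smult ?K a y" if "a \<in> carrier A" "x \<in> carrier ?K" "y \<in> carrier ?K" for a x y
      using that mem(2)[of x] mem(2)[of y] unfolding car restrict_simps by (simp only: M.lact_add)
    show "rsmult ?K (x \<oplus>\<^bsub>?K\<^esub> y) b = rsmult ?K x b \<oplus>\<^bsub>?K\<^esub> rsmult ?K y b" if "x \<in> carrier ?K" "y \<in> carrier ?K" "b \<in> carrier B" for x y b
      using that mem(2)[of x] mem(2)[of y] unfolding car restrict_simps by (simp only: M.ract_add)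
    show "smult ?K (a \<oplus>\<^bsub>A\<^esub> a') x = smult ?K a x \<oplus>\<^bsub>?K\<^esub> smult ?K a' x" if "a \<in> carrier A" "a' \<in> carrier A" "x \<in> carrier ?K" for a a' x
      using that mem(2)[of x] unfolding car restrict_simps by (simp only: M.add_lact)
    show "rsmult ?K x (b \<oplus>\<^bsub>B\<^esub> b') = rsmult ?K x b \<oplus>\<^bsub>?K\<^esub> rsmult ?K x b'" if "x \<in> carrier ?K" "b \<in> carrier B" "b' \<in> carrier B" for x b b'
      using that mem(2)[of x] unfolding car restrict_simps by (simp only: M.add_ract)
    show "smult ?K (a \<otimes>\<^bsub>A\<^esub> a') x = smult ?K a (smult ?K a' x)" if "a \<in> carrier A" "a' \<in> carrier A" "x \<in> carrier ?K" for a a' x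
      using that mem(2)[of x] unfolding car restrict_simps by (simp only: M.lact_assoc)
    show "rsmult ?K x (b \<otimes>\<^bsub>B\<^esub> b') = rsmult ?K (rsmult ?K x b) b'" if "x \<in> carrier ?K" "b \<in> carrier B" "b' \<in> carrier B" for x b b'
      using that mem(2)[of x] unfolding car restrict_simps by (simp only: M.ract_assoc)
    show "rsmult ?K (smult ?K a x) b = smult ?K a (rsmult ?K x b)" if "a \<in> carrier A" "x \<in> carrier ?K" "b \<in> carrier B" for a x b
      using that mem(2)[of x] unfolding car restrict_simps by (simp only: M.lact_ract)
  qed
qed

lemma restrict_bimodule:
  assumes "bimodule A B M" "sub_biaction A B M K"
  shows "bimodule A B (M\<lparr>carrier := K\<rparr>)"
proof -
  have "biaction A B (M\<lparr>carrier := K\<rparr>)"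
    using assms by (intro restrict_biaction) (simp_all add: bimodule_iff_biaction)
  moreover have "K \<subseteq> carrier M" using assms(2) additive_subgroup_mem(2)[of K M] by (auto simp: sub_biaction_def)
  ultimately show ?thesis using assms(1) unfolding bimodule_iff_biaction by auto
qed

lemma quot_map_restrict: "quot_map (M\<lparr>carrier := K\<rparr>) N f = quot_map M N f"
  by (intro ext) (simp add: quot_map_def)

lemma quot_restrict:
  "quot_bimodule (M\<lparr>carrier := K\<rparr>) N = (quot_bimodule M N)\<lparr>carrier := (\<lambda>x. N +>\<^bsub>M\<^esub> x) ` K\<rparr>"
proof -
  have "set_add (M\<lparr>carrier := K\<rparr>) = set_add M" by (intro ext) (simp add: set_add_def set_mult_def)
  moreover have "a_rcosets\<^bsub>M\<lparr>carrier := K\<rparr>\<^esub> N = (\<lambda>x. N +>\<^bsub>M\<^esub> x) ` K"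
    using quot_carrier[of "M\<lparr>carrier := K\<rparr>" N] by (simp add: quot_bimodule_def)
  ultimately show ?thesis by (simp add: quot_bimodule_def quot_map_restrict)
qed

text \<open>The quotient of the kernel is the quotient of the whole module with a smaller carrier. This allows the
quotient constructions to be carried out with a full module and restricted afterwards.\<close>

lemma homology_eq:
  "homology L M N f g = (quot_bimodule M (f ` carrier L))\<lparr>carrier := (\<lambda>x. (f ` carrier L) +>\<^bsub>M\<^esub> x) ` a_kernel M N g\<rparr>"
  by (simp add: homology_def quot_restrict)

lemma bimodule_homD:
  assumes "f \<in> bimodule_hom A B M P"
  shows "f \<in> add_hom M P" "a \<in> carrier A \<Longrightarrow> x \<in> carrier M \<Longrightarrow> f (smult M a x) = smult P a (f x)"
    "x \<in> carrier M \<Longrightarrow> b \<in> carrier B \<Longrightarrow> f (rsmult M x b) = rsmult P (f x) b"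
    "x \<in> carrier M \<Longrightarrow> f x \<in> carrier P"
    "x \<in> carrier M \<Longrightarrow> y \<in> carrier M \<Longrightarrow> f (x \<oplus>\<^bsub>M\<^esub> y) = f x \<oplus>\<^bsub>P\<^esub> f y"
  using assms add_homD[of f M P] by (auto simp: bimodule_hom_def)

lemma image_sub_biaction:
  assumes M: "biaction A B M" and P: "biaction A B P" and f: "f \<in> bimodule_hom A B M P" and K: "sub_biaction A B M K"
  shows "sub_biaction A B P (f ` K)"
proof -
  interpret M: biaction A B M by fact
  interpret P: biaction A B P by fact
  have K': "additive_subgroup K M" using K by (simp add: sub_biaction_def)
  note mem = additive_subgroup_mem[OF K']
  note fD = bimodule_homD[OF f]
  note gr = add_hom_group[OF M.abelian_group_axioms P.abelian_group_axioms fD(1)]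
  have "additive_subgroup (f ` K) P"
  proof (rule additive_subgroupI'[OF P.abelian_group_axioms])
    show "\<zero>\<^bsub>P\<^esub> \<in> f ` K" using gr(1) mem(1) by (simp add: image_eqI[of _ f "\<zero>\<^bsub>M\<^esub>"])
    fix x assume "x \<in> f ` K"
    then obtain k where k: "k \<in> K" "x = f k" by blast
    show "\<ominus>\<^bsub>P\<^esub> x \<in> f ` K"
      using k gr(2)[of k] mem(2)[of k] mem(4)[OF M.abelian_group_axioms, of k] by (simp add: image_eqI[of _ f "\<ominus>\<^bsub>M\<^esub> k"])
    fix y assume "y \<in> f ` K"
    then obtain l where l: "l \<in> K" "y = f l" by blast
    show "x \<oplus>\<^bsub>P\<^esub> y \<in> f ` K"
      using k l fD(5)[of k l] mem(2)[of k] mem(2)[of l] mem(3)[of k l] by (simp add: image_eqI[of _ f "k \<oplus>\<^bsub>M\<^esub> l"])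
  qed (use mem fD(4) in auto)
  moreover have "smult P a (f x) \<in> f ` K" if "a \<in> carrier A" "x \<in> K" for a x
    using that fD(2)[of a x] K mem(2)[of x] by (simp add: sub_biaction_def image_eqI[of _ f "smult M a x"])
  moreover have "rsmult P (f x) b \<in> f ` K" if "b \<in> carrier B" "x \<in> K" for b x
    using that fD(3)[of x b] K mem(2)[of x] by (simp add: sub_biaction_def image_eqI[of _ f "rsmult M x b"])
  ultimately show ?thesis by (auto simp: sub_biaction_def)
qed

lemma kernel_sub_biaction:
  assumes M: "biaction A B M" and P: "biaction A B P" and f: "f \<in> bimodule_hom A B M P"
  shows "sub_biaction A B M (a_kernel M P f)"
proof -
  interpret M: biaction A B M by fact
  interpret P: biaction A B P by fact
  note fD = bimodule_homD[OF f]
  note gr = add_hom_group[OF M.abelian_group_axioms P.abelian_group_axioms fD(1)]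
  have lz: "smult P a \<zero>\<^bsub>P\<^esub> = \<zero>\<^bsub>P\<^esub>" if "a \<in> carrier A" for a
    using add_hom_group(1)[OF P.abelian_group_axioms P.abelian_group_axioms lact_hom[OF P that]] .
  have rz: "rsmult P \<zero>\<^bsub>P\<^esub> b = \<zero>\<^bsub>P\<^esub>" if "b \<in> carrier B" for b
    using add_hom_group(1)[OF P.abelian_group_axioms P.abelian_group_axioms ract_hom[OF P that]] .
  have "additive_subgroup (a_kernel M P f) M"
    by (rule additive_subgroupI'[OF M.abelian_group_axioms]) (auto simp: a_kernel_def' gr fD)
  then show ?thesis
    by (auto simp: sub_biaction_def a_kernel_def' fD lz rz M.lact_closed M.ract_closed)
qed

lemma carrier_sub_biaction:
  assumes M: "biaction A B M"
  shows "sub_biaction A B M (carrier M)"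
proof -
  interpret M: biaction A B M by fact
  have "additive_subgroup (carrier M) M"
    by (rule additive_subgroupI'[OF M.abelian_group_axioms]) auto
  then show ?thesis by (auto simp: sub_biaction_def M.lact_closed M.ract_closed)
qed

lemma coset_bimodule_hom:
  assumes M: "biaction A B M" and N: "sub_biaction A B M N"
  shows "(\<lambda>x. N +>\<^bsub>M\<^esub> x) \<in> bimodule_hom A B M (quot_bimodule M N)"
proof -
  interpret M: biaction A B M by fact
  have N': "additive_subgroup N M" using N by (simp add: sub_biaction_def)
  show ?thesis
    using coset_hom[OF M.abelian_group_axioms N'] by (auto simp: bimodule_hom_def quot_act[OF M N])
qed

lemma homology_bimodule:
  assumes L: "bimodule A B L" and M: "bimodule A B M" and N: "bimodule A B N"
    and f: "f \<in> bimodule_hom A B L M" and g: "g \<in> bimodule_hom A B M N"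
  shows "bimodule A B (homology L M N f g)"
proof -
  have b: "biaction A B L" "biaction A B M" "biaction A B N" using L M N by (auto simp: bimodule_iff_biaction)
  have fL: "sub_biaction A B M (f ` carrier L)"
    by (rule image_sub_biaction[OF b(1,2) f carrier_sub_biaction[OF b(1)]])
  have "sub_biaction A B (quot_bimodule M (f ` carrier L)) ((\<lambda>x. (f ` carrier L) +>\<^bsub>M\<^esub> x) ` a_kernel M N g)"
    by (rule image_sub_biaction[OF b(2) quot_biaction[OF b(2) fL] coset_bimodule_hom[OF b(2) fL]
        kernel_sub_biaction[OF b(2,3) g]])
  then show ?thesis unfolding homology_eq
    by (rule restrict_bimodule[OF quot_bimodule_bimodule[OF M fL]])
qed

lemma quot_map_bimodule_hom:
  assumes M: "biaction A B M" and N: "sub_biaction A B M N" and P: "biaction A B P" and N': "sub_biaction A B P N'"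
    and f: "f \<in> bimodule_hom A B M P" and fN: "\<And>x. x \<in> N \<Longrightarrow> f x \<in> N'"
  shows "quot_map P N' f \<in> bimodule_hom A B (quot_bimodule M N) (quot_bimodule P N')"
proof -
  interpret M: biaction A B M by fact
  interpret P: biaction A B P by fact
  have s: "additive_subgroup N M" "additive_subgroup N' P" using N N' by (auto simp: sub_biaction_def)
  note fD = bimodule_homD[OF f]
  note qc = quot_map_coset[OF M.abelian_group_axioms s(1) P.abelian_group_axioms s(2) fD(1) fN]
  show ?thesis
    using quot_map_hom[OF M.abelian_group_axioms s(1) P.abelian_group_axioms s(2) fD(1) fN]
    by (auto simp: bimodule_hom_def quot_carrier quot_act[OF M N] quot_act[OF P N'] qc fD M.lact_closed M.ract_closed)
qed

lemma restrict_bimodule_hom: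
  assumes "f \<in> bimodule_hom A B M P" "K \<subseteq> carrier M" "f ` K \<subseteq> K'"
  shows "f \<in> bimodule_hom A B (M\<lparr>carrier := K\<rparr>) (P\<lparr>carrier := K'\<rparr>)"
  using assms(3) bimodule_homD[OF assms(1)] subsetD[OF assms(2)] by (auto simp: bimodule_hom_def hom_def)

section \<open>Tensor products\<close>

lemma add_hom_comp: "f \<in> add_hom M P \<Longrightarrow> g \<in> add_hom P Q \<Longrightarrow> (\<lambda>x. g (f x)) \<in> add_hom M Q"
  by (rule add_homI) (simp_all add: add_homD[of f M P] add_homD[of g P Q])

lemma add_hom_add:
  assumes "abelian_group P" "f \<in> add_hom M P" "g \<in> add_hom M P"
  shows "(\<lambda>x. f x \<oplus>\<^bsub>P\<^esub> g x) \<in> add_hom M P"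
proof -
  interpret P: abelian_group P by fact
  show ?thesis
  proof (rule add_homI)
    fix x y assume xy: "x \<in> carrier M" "y \<in> carrier M"
    note cl = xy[THEN add_homD(1)[OF assms(2)]] xy[THEN add_homD(1)[OF assms(3)]]
    show "f (x \<oplus>\<^bsub>M\<^esub> y) \<oplus>\<^bsub>P\<^esub> g (x \<oplus>\<^bsub>M\<^esub> y) = f x \<oplus>\<^bsub>P\<^esub> g x \<oplus>\<^bsub>P\<^esub> (f y \<oplus>\<^bsub>P\<^esub> g y)"
      using cl by (simp add: add_homD(2)[OF assms(2) xy] add_homD(2)[OF assms(3) xy] P.a_assoc P.a_lcomm)
  qed (auto simp: add_homD[OF assms(2)] add_homD[OF assms(3)])
qed

lemma a_inv_zero: "abelian_group P \<Longrightarrow> \<ominus>\<^bsub>P\<^esub> \<zero>\<^bsub>P\<^esub> = \<zero>\<^bsub>P\<^esub>"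
  by (rule abelian_group.minus_equality) (auto simp: abelian_groupE)

lemma a_minus_eq_zero_iff:
  assumes "abelian_group P" "x \<in> carrier P" "y \<in> carrier P"
  shows "x \<ominus>\<^bsub>P\<^esub> y = \<zero>\<^bsub>P\<^esub> \<longleftrightarrow> x = y"
proof -
  interpret P: abelian_group P by fact
  have "(x \<ominus>\<^bsub>P\<^esub> y) \<oplus>\<^bsub>P\<^esub> y = x" using assms by (simp add: a_minus_def P.a_assoc P.l_neg)
  then show ?thesis using assms by (auto simp: a_minus_def P.r_neg)
qed

text \<open>The expression in the definition of \<open>tensor_lift\<close>: the map out of the free abelian group that extends
\<open>\<phi>\<close>.\<close>

definition free_lift :: "('p, 'z) ring_scheme \<Rightarrow> ('k \<Rightarrow> 'p) \<Rightarrow> ('k \<Rightarrow>\<^sub>0 int) \<Rightarrow> 'p" where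
  "free_lift P \<phi> f = (\<Oplus>\<^bsub>P\<^esub>k\<in>Poly_Mapping.keys f. [Poly_Mapping.lookup f k] \<cdot>\<^bsub>P\<^esub> \<phi> k)"

context
  fixes P :: "('p, 'z) ring_scheme" and \<phi> :: "'k \<Rightarrow> 'p" and K :: "'k set"
  assumes P: "abelian_group P" and \<phi>: "\<And>k. k \<in> K \<Longrightarrow> \<phi> k \<in> carrier P"
begin

interpretation P: abelian_group P by (rule P)

lemma free_lift_closed: "Poly_Mapping.keys f \<subseteq> K \<Longrightarrow> free_lift P \<phi> f \<in> carrier P"
  unfolding free_lift_def by (intro P.finsum_closed) (auto intro!: P.add.int_pow_closed \<phi>)

lemma free_lift_superset:
  assumes "finite T" "Poly_Mapping.keys f \<subseteq> T" "T \<subseteq> K"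
  shows "free_lift P \<phi> f = (\<Oplus>\<^bsub>P\<^esub>k\<in>T. [Poly_Mapping.lookup f k] \<cdot>\<^bsub>P\<^esub> \<phi> k)"
  unfolding free_lift_def
proof (rule P.add.finprod_mono_neutral_cong_left[OF assms(1,2)])
  fix k assume "k \<in> T - Poly_Mapping.keys f"
  then have "Poly_Mapping.lookup f k = 0" by (simp add: in_keys_iff)
  then show "[Poly_Mapping.lookup f k] \<cdot>\<^bsub>P\<^esub> \<phi> k = \<zero>\<^bsub>P\<^esub>" by (simp add: add_pow_def)
qed (use assms in \<open>auto intro!: P.add.int_pow_closed \<phi>\<close>)

lemma free_lift_add:
  assumes "Poly_Mapping.keys f \<subseteq> K" "Poly_Mapping.keys g \<subseteq> K"
  shows "free_lift P \<phi> (f + g) = free_lift P \<phi> f \<oplus>\<^bsub>P\<^esub> free_lift P \<phi> g"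
proof -
  let ?T = "Poly_Mapping.keys f \<union> Poly_Mapping.keys g"
  have T: "finite ?T" "Poly_Mapping.keys (f + g) \<subseteq> ?T" "?T \<subseteq> K" using assms keys_add[of f g] by auto
  have cl: "(\<lambda>k. [Poly_Mapping.lookup h k] \<cdot>\<^bsub>P\<^esub> \<phi> k) \<in> ?T \<rightarrow> carrier P" for h :: "'k \<Rightarrow>\<^sub>0 int"
  proof (rule Pi_I)
    fix k assume "k \<in> ?T"
    then have "\<phi> k \<in> carrier P" using T(3) \<phi> by blast
    then show "[Poly_Mapping.lookup h k] \<cdot>\<^bsub>P\<^esub> \<phi> k \<in> carrier P" by (rule P.add.int_pow_closed)
  qed
  have "free_lift P \<phi> (f + g) = (\<Oplus>\<^bsub>P\<^esub>k\<in>?T. [Poly_Mapping.lookup (f + g) k] \<cdot>\<^bsub>P\<^esub> \<phi> k)"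
    by (rule free_lift_superset[OF T])
  also have "\<dots> = (\<Oplus>\<^bsub>P\<^esub>k\<in>?T. [Poly_Mapping.lookup f k] \<cdot>\<^bsub>P\<^esub> \<phi> k \<oplus>\<^bsub>P\<^esub> [Poly_Mapping.lookup g k] \<cdot>\<^bsub>P\<^esub> \<phi> k)"
  proof (rule P.finsum_cong'[OF refl])
    fix k assume "k \<in> ?T"
    then have "\<phi> k \<in> carrier P" using T \<phi> by blast
    then show "[Poly_Mapping.lookup (f + g) k] \<cdot>\<^bsub>P\<^esub> \<phi> k =
        [Poly_Mapping.lookup f k] \<cdot>\<^bsub>P\<^esub> \<phi> k \<oplus>\<^bsub>P\<^esub> [Poly_Mapping.lookup g k] \<cdot>\<^bsub>P\<^esub> \<phi> k"
      by (simp add: lookup_add P.add.int_pow_mult)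
  qed (use cl in auto)
  also have "\<dots> = free_lift P \<phi> f \<oplus>\<^bsub>P\<^esub> free_lift P \<phi> g"
    using free_lift_superset[of ?T f] free_lift_superset[of ?T g] T cl by (simp add: P.finsum_addf)
  finally show ?thesis .
qed

lemma free_lift_of: "k \<in> K \<Longrightarrow> free_lift P \<phi> (frag_of k) = \<phi> k"
  using \<phi> free_lift_superset[of "{k}" "frag_of k"] by (simp add: P.add.int_pow_1)

lemma free_lift_0: "free_lift P \<phi> 0 = \<zero>\<^bsub>P\<^esub>"
  by (simp add: free_lift_def)

lemma free_lift_diff:
  assumes "Poly_Mapping.keys f \<subseteq> K" "Poly_Mapping.keys g \<subseteq> K"
  shows "free_lift P \<phi> (f - g) = free_lift P \<phi> f \<ominus>\<^bsub>P\<^esub> free_lift P \<phi> g"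
proof -
  have "Poly_Mapping.keys (f - g) \<subseteq> K" using assms keys_diff[of f g] by auto
  then have "free_lift P \<phi> f = free_lift P \<phi> (f - g) \<oplus>\<^bsub>P\<^esub> free_lift P \<phi> g"
    "free_lift P \<phi> (f - g) \<in> carrier P" "free_lift P \<phi> g \<in> carrier P"
    using assms free_lift_add[of "f - g" g] free_lift_closed by auto
  then show ?thesis by (simp add: a_minus_def P.a_assoc P.r_neg)
qed

end

lemma free_pairs_simps:
  "carrier (free_pairs M N) = {f. Poly_Mapping.keys f \<subseteq> carrier M \<times> carrier N}"
  "zero (free_pairs M N) = 0" "add (free_pairs M N) = (+)"
  "smult (free_pairs M N) a = frag_extend (\<lambda>(m, n). frag_of (smult M a m, n))"
  "rsmult (free_pairs M N) f b = frag_extend (\<lambda>(m, n). frag_of (m, rsmult N n b)) f"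
  by (auto simp: free_pairs_def)

lemma free_pairs_abelian_group: "abelian_group (free_pairs M N)"
proof (rule abelian_groupI)
  fix x assume "x \<in> carrier (free_pairs M N)"
  then show "\<exists>y\<in>carrier (free_pairs M N). y \<oplus>\<^bsub>free_pairs M N\<^esub> x = \<zero>\<^bsub>free_pairs M N\<^esub>"
    by (intro bexI[of _ "- x"]) (auto simp: free_pairs_simps)
qed (auto simp: free_pairs_simps algebra_simps dest: subsetD[OF keys_add])

lemma free_pairs_minus:
  "f \<in> carrier (free_pairs M N) \<Longrightarrow> \<ominus>\<^bsub>free_pairs M N\<^esub> f = - f"
  by (rule abelian_group.minus_equality[OF free_pairs_abelian_group]) (auto simp: free_pairs_simps)

text \<open>The relators of a tensor product, named separately from the subgroup that they generate.\<close>

definition tensor_gens :: "('s, 'x) ring_scheme \<Rightarrow> ('l, 'm, 's) bimodule \<Rightarrow> ('s, 'n, 'r) bimodule \<Rightarrow>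
    (('m \<times> 'n) \<Rightarrow>\<^sub>0 int) set" where
  "tensor_gens A M N =
     {frag_of (m \<oplus>\<^bsub>M\<^esub> m', n) - frag_of (m, n) - frag_of (m', n) | m m' n.
         m \<in> carrier M \<and> m' \<in> carrier M \<and> n \<in> carrier N} \<union>
      {frag_of (m, n \<oplus>\<^bsub>N\<^esub> n') - frag_of (m, n) - frag_of (m, n') | m n n'.
         m \<in> carrier M \<and> n \<in> carrier N \<and> n' \<in> carrier N} \<union>
      {frag_of (rsmult M m a, n) - frag_of (m, smult N a n) | m a n.
         m \<in> carrier M \<and> a \<in> carrier A \<and> n \<in> carrier N}"

lemma tensor_gensI:
  "\<lbrakk>m \<in> carrier M; m' \<in> carrier M; n \<in> carrier N\<rbrakk> \<Longrightarrow>
     frag_of (m \<oplus>\<^bsub>M\<^esub> m', n) - frag_of (m, n) - frag_of (m', n) \<in> tensor_gens A M N"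
  "\<lbrakk>m \<in> carrier M; n \<in> carrier N; n' \<in> carrier N\<rbrakk> \<Longrightarrow>
     frag_of (m, n \<oplus>\<^bsub>N\<^esub> n') - frag_of (m, n) - frag_of (m, n') \<in> tensor_gens A M N"
  "\<lbrakk>m \<in> carrier M; a \<in> carrier A; n \<in> carrier N\<rbrakk> \<Longrightarrow>
     frag_of (rsmult M m a, n) - frag_of (m, smult N a n) \<in> tensor_gens A M N"
  unfolding tensor_gens_def by blast+

lemma tensor_gens_cases:
  assumes "g \<in> tensor_gens A M N"
  obtains (left) m m' n where "m \<in> carrier M" "m' \<in> carrier M" "n \<in> carrier N"
      "g = frag_of (m \<oplus>\<^bsub>M\<^esub> m', n) - frag_of (m, n) - frag_of (m', n)"
    | (right) m n n' where "m \<in> carrier M" "n \<in> carrier N" "n' \<in> carrier N"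
      "g = frag_of (m, n \<oplus>\<^bsub>N\<^esub> n') - frag_of (m, n) - frag_of (m, n')"
    | (balanced) m a n where "m \<in> carrier M" "a \<in> carrier A" "n \<in> carrier N"
      "g = frag_of (rsmult M m a, n) - frag_of (m, smult N a n)"
  using assms unfolding tensor_gens_def by blast

lemma tensor_rels_eq: "tensor_rels S M N = generate (free_Abelian_group (carrier M \<times> carrier N)) (tensor_gens S M N)"
  by (simp add: tensor_rels_def tensor_gens_def)

text \<open>The outer rings \<open>A\<close> and \<open>B\<close> act on the tensor product over \<open>S\<close>; all three actions may fail to be
unital.\<close>

locale tensor_factors =
  fixes A :: "('l, 'x) ring_scheme" and S :: "('s, 'y) ring_scheme" and B :: "('r, 'z) ring_scheme"
    and M :: "('l, 'm, 's) bimodule" and N :: "('s, 'n, 'r) bimodule"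
  assumes M: "biaction A S M" and N: "biaction S B N"
begin

sublocale M: biaction A S M by (rule M)
sublocale N: biaction S B N by (rule N)

abbreviation "F \<equiv> free_pairs M N"
abbreviation "T \<equiv> tensor S M N"
abbreviation "rels \<equiv> tensor_rels S M N"
abbreviation "pt \<equiv> pure_tensor S M N"

lemma frag_of_in_F: "m \<in> carrier M \<Longrightarrow> n \<in> carrier N \<Longrightarrow> frag_of (m, n) \<in> carrier F"
  by (simp add: free_pairs_simps)

lemma F_diff: "f \<in> carrier F \<Longrightarrow> g \<in> carrier F \<Longrightarrow> f - g \<in> carrier F"
  using keys_diff[of f g] by (auto simp: free_pairs_simps)

lemma gens_in_F: "tensor_gens S M N \<subseteq> carrier F"
proof
  fix g assume "g \<in> tensor_gens S M N"
  then show "g \<in> carrier F"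
    by (cases rule: tensor_gens_cases) (simp_all add: F_diff frag_of_in_F M.ract_closed N.lact_closed)
qed

lemma rels_induct [consumes 1, case_names zero gen add minus]:
  assumes "f \<in> rels" and "Q 0" and "\<And>g. g \<in> tensor_gens S M N \<Longrightarrow> Q g"
    and "\<And>f g. f \<in> carrier F \<Longrightarrow> g \<in> carrier F \<Longrightarrow> Q f \<Longrightarrow> Q g \<Longrightarrow> Q (f + g)"
    and "\<And>f. f \<in> carrier F \<Longrightarrow> Q f \<Longrightarrow> Q (- f)"
  shows "Q f"
proof -
  have "f \<in> carrier F \<and> Q f" using assms(1) unfolding tensor_rels_eq
  proof (induction rule: generate.induct)
    case (inv h)
    then have h: "Poly_Mapping.keys h \<subseteq> carrier M \<times> carrier N" using gens_in_F by (auto simp: free_pairs_simps)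
    then show ?case using inv assms(3,5) gens_in_F by (auto simp: free_pairs_simps)
  next
    case (eng f g)
    then show ?case using assms(4)[of f g] keys_add[of f g] by (auto simp: free_pairs_simps)
  qed (use assms gens_in_F in \<open>auto simp: free_pairs_simps\<close>)
  then show ?thesis ..
qed

lemma rels_subgroup: "additive_subgroup rels F"
proof (rule additive_subgroupI'[OF free_pairs_abelian_group])
  interpret G: group "free_Abelian_group (carrier M \<times> carrier N)" by simp
  have sub: "subgroup rels (free_Abelian_group (carrier M \<times> carrier N))"
    unfolding tensor_rels_eq using gens_in_F by (intro G.generate_is_subgroup) (auto simp: free_pairs_simps)
  show incl: "rels \<subseteq> carrier F"
    using subgroup.subset[OF sub] unfolding free_pairs_simps free_Abelian_group_def by simp
  show "\<zero>\<^bsub>F\<^esub> \<in> rels" using subgroup.one_closed[OF sub] by (simp add: free_pairs_simps)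
  show "x \<oplus>\<^bsub>F\<^esub> y \<in> rels" if "x \<in> rels" "y \<in> rels" for x y
    using subgroup.m_closed[OF sub that] by (simp add: free_pairs_simps)
  show "\<ominus>\<^bsub>F\<^esub> x \<in> rels" if "x \<in> rels" for x
    using subgroup.m_inv_closed[OF sub that] incl that free_pairs_minus[of x M N]
    by (auto simp: free_pairs_simps)
qed

lemma gens_in_rels: "g \<in> tensor_gens S M N \<Longrightarrow> g \<in> rels"
  unfolding tensor_rels_eq by (rule generate.incl)

lemma T_group: "abelian_group T"
  unfolding tensor_def by (rule quot_abelian_group[OF free_pairs_abelian_group rels_subgroup])

sublocale T: abelian_group T by (rule T_group)

lemma T_carrier: "carrier T = (\<lambda>f. rels +>\<^bsub>F\<^esub> f) ` carrier F"
  unfolding tensor_def by (rule quot_carrier)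

lemma T_coset_hom: "(\<lambda>f. rels +>\<^bsub>F\<^esub> f) \<in> add_hom F T"
  unfolding tensor_def by (rule coset_hom[OF free_pairs_abelian_group rels_subgroup])

lemma T_coset_eq:
  assumes "f \<in> carrier F" "g \<in> carrier F" "f - g \<in> rels"
  shows "rels +>\<^bsub>F\<^esub> f = rels +>\<^bsub>F\<^esub> g"
  using assms coset_eq_iff[OF free_pairs_abelian_group rels_subgroup, of f g] free_pairs_minus[of g M N]
  by (simp add: a_minus_def free_pairs_simps)

lemma pt_closed [simp]: "m \<in> carrier M \<Longrightarrow> n \<in> carrier N \<Longrightarrow> pt m n \<in> carrier T"
  by (auto simp: pure_tensor_def T_carrier frag_of_in_F)

lemma pt_add_left:
  assumes "m \<in> carrier M" "m' \<in> carrier M" "n \<in> carrier N"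
  shows "pt (m \<oplus>\<^bsub>M\<^esub> m') n = pt m n \<oplus>\<^bsub>T\<^esub> pt m' n"
proof -
  have "frag_of (m \<oplus>\<^bsub>M\<^esub> m', n) - (frag_of (m, n) + frag_of (m', n)) \<in> rels"
    using assms by (simp add: gens_in_rels tensor_gensI diff_diff_eq[symmetric])
  then have "rels +>\<^bsub>F\<^esub> frag_of (m \<oplus>\<^bsub>M\<^esub> m', n) = rels +>\<^bsub>F\<^esub> (frag_of (m, n) \<oplus>\<^bsub>F\<^esub> frag_of (m', n))"
    using assms abelian_group.axioms(1)[OF free_pairs_abelian_group, THEN abelian_monoid.a_closed]
    by (intro T_coset_eq) (auto simp: free_pairs_simps dest!: subsetD[OF keys_add])
  then show ?thesis
    using assms add_homD(2)[OF T_coset_hom, of "frag_of (m, n)" "frag_of (m', n)"]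
    by (simp add: pure_tensor_def frag_of_in_F)
qed

lemma pt_add_right:
  assumes "m \<in> carrier M" "n \<in> carrier N" "n' \<in> carrier N"
  shows "pt m (n \<oplus>\<^bsub>N\<^esub> n') = pt m n \<oplus>\<^bsub>T\<^esub> pt m n'"
proof -
  have "frag_of (m, n \<oplus>\<^bsub>N\<^esub> n') - (frag_of (m, n) + frag_of (m, n')) \<in> rels"
    using assms by (simp add: gens_in_rels tensor_gensI diff_diff_eq[symmetric])
  then have "rels +>\<^bsub>F\<^esub> frag_of (m, n \<oplus>\<^bsub>N\<^esub> n') = rels +>\<^bsub>F\<^esub> (frag_of (m, n) \<oplus>\<^bsub>F\<^esub> frag_of (m, n'))"
    using assms by (intro T_coset_eq) (auto simp: free_pairs_simps dest!: subsetD[OF keys_add])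
  then show ?thesis
    using assms add_homD(2)[OF T_coset_hom, of "frag_of (m, n)" "frag_of (m, n')"]
    by (simp add: pure_tensor_def frag_of_in_F)
qed

lemma pt_balanced:
  assumes "m \<in> carrier M" "s \<in> carrier S" "n \<in> carrier N"
  shows "pt (rsmult M m s) n = pt m (smult N s n)"
  unfolding pure_tensor_def using assms
  by (intro T_coset_eq gens_in_rels tensor_gensI frag_of_in_F) (simp_all add: M.ract_closed N.lact_closed)

lemma pt_hom_left: "n \<in> carrier N \<Longrightarrow> (\<lambda>m. pt m n) \<in> add_hom M T"
  by (rule add_homI) (auto simp: pt_add_left)

text \<open>Differences need no separate case because \<open>- (m \<otimes> n) = (- m) \<otimes> n\<close>. To use this, the induction over the
free abelian group carries \<open>Q\<close> for an element together with \<open>Q\<close> for its negative.\<close>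

lemma T_induct [consumes 1, case_names zero add pure]:
  assumes t: "t \<in> carrier T" and zero: "Q \<zero>\<^bsub>T\<^esub>"
    and add: "\<And>t u. t \<in> carrier T \<Longrightarrow> u \<in> carrier T \<Longrightarrow> Q t \<Longrightarrow> Q u \<Longrightarrow> Q (t \<oplus>\<^bsub>T\<^esub> u)"
    and pure: "\<And>m n. m \<in> carrier M \<Longrightarrow> n \<in> carrier N \<Longrightarrow> Q (pt m n)"
  shows "Q t"
proof -
  let ?c = "\<lambda>f. rels +>\<^bsub>F\<^esub> f"
  note hom = add_hom_group[OF free_pairs_abelian_group T_group T_coset_hom]
  obtain f where f: "f \<in> carrier F" "t = ?c f" using t by (auto simp: T_carrier)
  have cl: "?c f \<in> carrier T" if "f \<in> carrier F" for f using add_homD(1)[OF T_coset_hom that] .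
  have "Poly_Mapping.keys f \<subseteq> carrier M \<times> carrier N" using f by (simp add: free_pairs_simps)
  then have "Q (?c f) \<and> Q (\<ominus>\<^bsub>T\<^esub> ?c f)"
  proof (induction f rule: free_Abelian_group_induct[consumes 1])
    case 1
    then show ?case using hom(1) zero by (simp add: free_pairs_simps a_inv_zero[OF T_group])
  next
    case (2 x y)
    then have xy: "x \<in> carrier F" "y \<in> carrier F" by (auto simp: free_pairs_simps)
    have "?c (x - y) = ?c x \<oplus>\<^bsub>T\<^esub> \<ominus>\<^bsub>T\<^esub> ?c y"
      using hom(3)[OF xy] free_pairs_minus[OF xy(2)] by (simp add: a_minus_def free_pairs_simps)
    moreover have "\<ominus>\<^bsub>T\<^esub> (?c x \<oplus>\<^bsub>T\<^esub> \<ominus>\<^bsub>T\<^esub> ?c y) = \<ominus>\<^bsub>T\<^esub> ?c x \<oplus>\<^bsub>T\<^esub> ?c y"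
      using cl[OF xy(1)] cl[OF xy(2)] by (simp add: T.minus_add T.minus_minus)
    ultimately show ?case using 2 add cl[OF xy(1)] cl[OF xy(2)] by simp
  next
    case (3 a)
    then obtain m n where mn: "a = (m, n)" "m \<in> carrier M" "n \<in> carrier N" by auto
    have "\<ominus>\<^bsub>T\<^esub> pt m n = pt (\<ominus>\<^bsub>M\<^esub> m) n"
      using add_hom_group(2)[OF M.abelian_group_axioms T_group pt_hom_left[OF mn(3)] mn(2)] by simp
    moreover have "?c (frag_of a) = pt m n" by (simp add: mn pure_tensor_def)
    ultimately show ?case using pure mn by simp
  qed
  then show ?thesis using f by simp
qed

lemma T_hom_eq:
  assumes P: "abelian_group P" and f: "f \<in> add_hom T P" and g: "g \<in> add_hom T P"
    and eq: "\<And>m n. m \<in> carrier M \<Longrightarrow> n \<in> carrier N \<Longrightarrow> f (pt m n) = g (pt m n)" and t: "t \<in> carrier T"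
  shows "f t = g t"
  using t
proof (induction rule: T_induct)
  case zero
  show ?case using add_hom_group(1)[OF T_group P f] add_hom_group(1)[OF T_group P g] by simp
qed (simp_all add: eq add_homD(2)[OF f] add_homD(2)[OF g])

lemma frag_extend_hom:
  assumes "\<And>m n. m \<in> carrier M \<Longrightarrow> n \<in> carrier N \<Longrightarrow> \<psi> (m, n) \<in> carrier F"
  shows "frag_extend \<psi> \<in> add_hom F F"
proof (rule add_homI)
  fix f assume f: "f \<in> carrier F"
  have "Poly_Mapping.keys (frag_extend \<psi> f) \<subseteq> (\<Union>x\<in>Poly_Mapping.keys f. Poly_Mapping.keys (\<psi> x))"
    by (rule keys_frag_extend)
  also have "\<dots> \<subseteq> carrier M \<times> carrier N"
  proof (rule UN_least)
    fix k assume "k \<in> Poly_Mapping.keys f"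
    then have "k \<in> carrier M \<times> carrier N" using f by (auto simp: free_pairs_simps)
    then have "\<psi> k \<in> carrier F" using assms by (cases k) blast
    then show "Poly_Mapping.keys (\<psi> k) \<subseteq> carrier M \<times> carrier N" by (simp add: free_pairs_simps)
  qed
  finally show "frag_extend \<psi> f \<in> carrier F" by (simp add: free_pairs_simps)
qed (simp add: free_pairs_simps frag_extend_add)

lemma frag_extend_rels:
  assumes "\<And>g. g \<in> tensor_gens S M N \<Longrightarrow> frag_extend \<psi> g \<in> rels" and f: "f \<in> rels"
  shows "frag_extend \<psi> f \<in> rels"
  using f
proof (induction rule: rels_induct)
  case zero
  then show ?case using additive_subgroup_mem(1)[OF rels_subgroup] by (simp add: free_pairs_simps)
next
  case (add f g)
  then show ?case
    using additive_subgroup_mem(3)[OF rels_subgroup, of "frag_extend \<psi> f" "frag_extend \<psi> g"]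
    by (simp add: free_pairs_simps frag_extend_add)
next
  case (minus f)
  have "frag_extend \<psi> f \<in> carrier F" by (rule additive_subgroup_mem(2)[OF rels_subgroup minus(2)])
  then have "\<ominus>\<^bsub>F\<^esub> frag_extend \<psi> f = - frag_extend \<psi> f" by (rule free_pairs_minus)
  then show ?case
    using additive_subgroup_mem(4)[OF rels_subgroup free_pairs_abelian_group minus(2)] by (simp add: frag_extend_minus)
qed (rule assms(1))

lemma T_lact:
  assumes a: "a \<in> carrier A"
  shows "(\<lambda>t. smult T a t) \<in> add_hom T T"
    and "m \<in> carrier M \<Longrightarrow> n \<in> carrier N \<Longrightarrow> smult T a (pt m n) = pt (smult M a m) n"
proof -
  let ?\<psi> = "\<lambda>(m, n). frag_of (smult M a m, n)"
  have h: "frag_extend ?\<psi> \<in> add_hom F F"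
    by (rule frag_extend_hom) (simp add: a frag_of_in_F M.lact_closed)
  have r: "frag_extend ?\<psi> f \<in> rels" if "f \<in> rels" for f
  proof (rule frag_extend_rels[OF _ that], rule gens_in_rels)
    fix g assume "g \<in> tensor_gens S M N"
    then show "frag_extend ?\<psi> g \<in> tensor_gens S M N"
      by (cases rule: tensor_gens_cases)
        (simp_all add: a frag_extend_diff M.lact_add M.lact_closed M.lact_ract[symmetric] tensor_gensI)
  qed
  have eq: "(\<lambda>t. smult T a t) = quot_map F rels (frag_extend ?\<psi>)"
    by (simp add: tensor_def quot_simps free_pairs_simps)
  show "(\<lambda>t. smult T a t) \<in> add_hom T T"
    unfolding eq unfolding tensor_def
    by (rule quot_map_hom[OF free_pairs_abelian_group rels_subgroup free_pairs_abelian_group rels_subgroup h r])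
  show "m \<in> carrier M \<Longrightarrow> n \<in> carrier N \<Longrightarrow> smult T a (pt m n) = pt (smult M a m) n"
    unfolding tensor_def quot_simps free_pairs_simps pure_tensor_def
    by (subst quot_map_coset[OF free_pairs_abelian_group rels_subgroup free_pairs_abelian_group rels_subgroup h r])
      (simp_all add: frag_of_in_F)
qed

lemma T_ract:
  assumes b: "b \<in> carrier B"
  shows "(\<lambda>t. rsmult T t b) \<in> add_hom T T"
    and "m \<in> carrier M \<Longrightarrow> n \<in> carrier N \<Longrightarrow> rsmult T (pt m n) b = pt m (rsmult N n b)"
proof -
  let ?\<psi> = "\<lambda>(m, n). frag_of (m, rsmult N n b)"
  have h: "frag_extend ?\<psi> \<in> add_hom F F"
    by (rule frag_extend_hom) (simp add: b frag_of_in_F N.ract_closed)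
  have r: "frag_extend ?\<psi> f \<in> rels" if "f \<in> rels" for f
  proof (rule frag_extend_rels[OF _ that], rule gens_in_rels)
    fix g assume "g \<in> tensor_gens S M N"
    then show "frag_extend ?\<psi> g \<in> tensor_gens S M N"
      by (cases rule: tensor_gens_cases)
        (simp_all add: b frag_extend_diff N.ract_add N.ract_closed N.lact_ract tensor_gensI)
  qed
  have eq: "(\<lambda>t. rsmult T t b) = quot_map F rels (frag_extend ?\<psi>)"
    by (simp add: tensor_def quot_simps free_pairs_simps)
  show "(\<lambda>t. rsmult T t b) \<in> add_hom T T"
    unfolding eq unfolding tensor_def
    by (rule quot_map_hom[OF free_pairs_abelian_group rels_subgroup free_pairs_abelian_group rels_subgroup h r])
  show "m \<in> carrier M \<Longrightarrow> n \<in> carrier N \<Longrightarrow> rsmult T (pt m n) b = pt m (rsmult N n b)"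
    unfolding tensor_def quot_simps free_pairs_simps pure_tensor_def
    by (subst quot_map_coset[OF free_pairs_abelian_group rels_subgroup free_pairs_abelian_group rels_subgroup h r])
      (simp_all add: frag_of_in_F)
qed

lemma T_biaction: "biaction A B T"
proof (intro biaction.intro biaction_axioms.intro M.A.ring_axioms N.B.ring_axioms T_group)
  note [simp] = T_lact(2) T_ract(2) M.lact_closed N.ract_closed
  show "smult T a t \<in> carrier T" if "a \<in> carrier A" "t \<in> carrier T" for a t
    using add_homD(1)[OF T_lact(1)] that by blast
  show "rsmult T t b \<in> carrier T" if "t \<in> carrier T" "b \<in> carrier B" for t b
    using add_homD(1)[OF T_ract(1)] that by blast
  show "smult T a (t \<oplus>\<^bsub>T\<^esub> u) = smult T a t \<oplus>\<^bsub>T\<^esub> smult T a u"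
    if "a \<in> carrier A" "t \<in> carrier T" "u \<in> carrier T" for a t u
    using add_homD(2)[OF T_lact(1)] that by blast
  show "rsmult T (t \<oplus>\<^bsub>T\<^esub> u) b = rsmult T t b \<oplus>\<^bsub>T\<^esub> rsmult T u b"
    if "t \<in> carrier T" "u \<in> carrier T" "b \<in> carrier B" for t u b
    using add_homD(2)[OF T_ract(1)] that by blast
  show "smult T (a \<oplus>\<^bsub>A\<^esub> a') t = smult T a t \<oplus>\<^bsub>T\<^esub> smult T a' t"
    if "a \<in> carrier A" "a' \<in> carrier A" "t \<in> carrier T" for a a' t
    by (rule T_hom_eq[OF T_group T_lact(1) add_hom_add[OF T_group T_lact(1) T_lact(1)]])
      (use that in \<open>simp_all add: M.add_lact pt_add_left\<close>)
  show "rsmult T t (b \<oplus>\<^bsub>B\<^esub> b') = rsmult T t b \<oplus>\<^bsub>T\<^esub> rsmult T t b'"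
    if "t \<in> carrier T" "b \<in> carrier B" "b' \<in> carrier B" for t b b'
    by (rule T_hom_eq[OF T_group T_ract(1) add_hom_add[OF T_group T_ract(1) T_ract(1)]])
      (use that in \<open>simp_all add: N.add_ract pt_add_right\<close>)
  show "smult T (a \<otimes>\<^bsub>A\<^esub> a') t = smult T a (smult T a' t)"
    if "a \<in> carrier A" "a' \<in> carrier A" "t \<in> carrier T" for a a' t
    by (rule T_hom_eq[OF T_group T_lact(1) add_hom_comp[OF T_lact(1) T_lact(1)]])
      (use that in \<open>simp_all add: M.lact_assoc\<close>)
  show "rsmult T t (b \<otimes>\<^bsub>B\<^esub> b') = rsmult T (rsmult T t b) b'"
    if "t \<in> carrier T" "b \<in> carrier B" "b' \<in> carrier B" for t b b'
    by (rule T_hom_eq[OF T_group T_ract(1) add_hom_comp[OF T_ract(1) T_ract(1)]])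
      (use that in \<open>simp_all add: N.ract_assoc\<close>)
  show "rsmult T (smult T a t) b = smult T a (rsmult T t b)"
    if "a \<in> carrier A" "t \<in> carrier T" "b \<in> carrier B" for a t b
    by (rule T_hom_eq[OF T_group add_hom_comp[OF T_lact(1) T_ract(1)] add_hom_comp[OF T_ract(1) T_lact(1)]])
      (use that in simp_all)
qed

lemma T_one_left:
  assumes "\<And>m. m \<in> carrier M \<Longrightarrow> smult M \<one>\<^bsub>A\<^esub> m = m" and t: "t \<in> carrier T"
  shows "smult T \<one>\<^bsub>A\<^esub> t = t"
  by (rule T_hom_eq[OF T_group T_lact(1) _ _ t]) (auto simp: T_lact assms intro!: add_homI)

lemma T_one_right:
  assumes "\<And>n. n \<in> carrier N \<Longrightarrow> rsmult N n \<one>\<^bsub>B\<^esub> = n" and t: "t \<in> carrier T"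
  shows "rsmult T t \<one>\<^bsub>B\<^esub> = t"
  by (rule T_hom_eq[OF T_group T_ract(1) _ _ t]) (auto simp: T_ract assms intro!: add_homI)

text \<open>A biadditive balanced map kills all relators, so its extension to the free abelian group is constant on
cosets and the image of a coset is a singleton.\<close>

lemma tensor_lift:
  assumes P: "abelian_group P"
    and \<phi>: "\<And>m n. m \<in> carrier M \<Longrightarrow> n \<in> carrier N \<Longrightarrow> \<phi> (m, n) \<in> carrier P"
    and addl: "\<And>m m' n. m \<in> carrier M \<Longrightarrow> m' \<in> carrier M \<Longrightarrow> n \<in> carrier N \<Longrightarrow>
      \<phi> (m \<oplus>\<^bsub>M\<^esub> m', n) = \<phi> (m, n) \<oplus>\<^bsub>P\<^esub> \<phi> (m', n)"
    and addr: "\<And>m n n'. m \<in> carrier M \<Longrightarrow> n \<in> carrier N \<Longrightarrow> n' \<in> carrier N \<Longrightarrow>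
      \<phi> (m, n \<oplus>\<^bsub>N\<^esub> n') = \<phi> (m, n) \<oplus>\<^bsub>P\<^esub> \<phi> (m, n')"
    and bal: "\<And>m s n. m \<in> carrier M \<Longrightarrow> s \<in> carrier S \<Longrightarrow> n \<in> carrier N \<Longrightarrow>
      \<phi> (rsmult M m s, n) = \<phi> (m, smult N s n)"
  shows "tensor_lift P \<phi> \<in> add_hom T P"
    and "m \<in> carrier M \<Longrightarrow> n \<in> carrier N \<Longrightarrow> tensor_lift P \<phi> (pt m n) = \<phi> (m, n)"
proof -
  interpret P: abelian_group P by fact
  let ?h = "free_lift P \<phi>"
  have \<phi>': "\<phi> k \<in> carrier P" if "k \<in> carrier M \<times> carrier N" for k using that \<phi> by auto
  note fl_add = free_lift_add[OF P \<phi>'] and fl_diff = free_lift_diff[OF P \<phi>'] and fl_of = free_lift_of[OF P \<phi>']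
    and fl_cl = free_lift_closed[OF P \<phi>']
  have hom: "?h \<in> add_hom F P"
    by (rule add_homI) (auto simp: free_pairs_simps fl_cl fl_add)
  have kd: "Poly_Mapping.keys (frag_of k - frag_of l) \<subseteq> carrier M \<times> carrier N"
    if "k \<in> carrier M \<times> carrier N" "l \<in> carrier M \<times> carrier N" for k l
    using that keys_diff[of "frag_of k" "frag_of l"] by auto
  have rel0: "?h f = \<zero>\<^bsub>P\<^esub>" if "f \<in> rels" for f
    using that
  proof (induction rule: rels_induct)
    case (gen g)
    have z: "(x \<oplus>\<^bsub>P\<^esub> y) \<ominus>\<^bsub>P\<^esub> x \<ominus>\<^bsub>P\<^esub> y = \<zero>\<^bsub>P\<^esub>" if "x \<in> carrier P" "y \<in> carrier P" for x y
    proof -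
      have "(x \<oplus>\<^bsub>P\<^esub> y) \<oplus>\<^bsub>P\<^esub> \<ominus>\<^bsub>P\<^esub> x = y" using that by (metis P.a_comm P.a_closed P.a_inv_closed P.r_neg2)
      then show ?thesis using that by (simp add: a_minus_def P.r_neg)
    qed
    from gen show ?case
    proof (cases rule: tensor_gens_cases)
      case (left m m' n)
      then show ?thesis using kd[of "(m \<oplus>\<^bsub>M\<^esub> m', n)" "(m, n)"]
        by (simp add: fl_diff fl_of addl z \<phi>)
    next
      case (right m n n')
      then show ?thesis using kd[of "(m, n \<oplus>\<^bsub>N\<^esub> n')" "(m, n)"]
        by (simp add: fl_diff fl_of addr z \<phi>)
    next
      case (balanced m s n)
      then show ?thesis
        by (simp add: fl_diff fl_of bal \<phi> M.ract_closed N.lact_closed a_minus_def P.r_neg)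
    qed
  next
    case (add f g)
    then show ?case using add_homD(2)[OF hom, of f g] by (simp add: free_pairs_simps)
  next
    case (minus f)
    then show ?case using add_hom_group(2)[OF free_pairs_abelian_group P hom, of f] free_pairs_minus[of f M N]
      by (simp add: a_inv_zero[OF P])
  qed (simp add: free_lift_0[OF P \<phi>'])
  have lift: "tensor_lift P \<phi> (rels +>\<^bsub>F\<^esub> f) = ?h f" if f: "f \<in> carrier F" for f
  proof -
    interpret R: abelian_subgroup rels F
      by (rule abelian_subgroupI3[OF rels_subgroup free_pairs_abelian_group])
    have const: "?h g = ?h f" if g: "g \<in> rels +>\<^bsub>F\<^esub> f" for g
    proof -
      have "g \<in> carrier F" using g f R.a_elemrcos_carrier by blast
      then have "g \<ominus>\<^bsub>F\<^esub> f \<in> rels" using R.a_rcos_module[OF f] g by (simp add: a_minus_def)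
      then have "?h g \<ominus>\<^bsub>P\<^esub> ?h f = \<zero>\<^bsub>P\<^esub>"
        using rel0 add_hom_group(3)[OF free_pairs_abelian_group P hom \<open>g \<in> carrier F\<close> f] by simp
      then show ?thesis
        using add_homD(1)[OF hom \<open>g \<in> carrier F\<close>] add_homD(1)[OF hom f] by (simp add: a_minus_eq_zero_iff[OF P])
    qed
    have "?h ` (rels +>\<^bsub>F\<^esub> f) = (\<lambda>_. ?h f) ` (rels +>\<^bsub>F\<^esub> f)"
      by (rule image_cong[OF refl const])
    also have "\<dots> = {?h f}"
      using R.a_rcos_self[OF f] by (rule image_constant)
    finally have "?h ` (rels +>\<^bsub>F\<^esub> f) = {?h f}" .
    then show ?thesis unfolding tensor_lift_def free_lift_def by simp
  qed
  show "tensor_lift P \<phi> \<in> add_hom T P"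
  proof (rule add_homI)
    fix t assume "t \<in> carrier T"
    then obtain f where f: "f \<in> carrier F" "t = rels +>\<^bsub>F\<^esub> f" by (auto simp: T_carrier)
    then show "tensor_lift P \<phi> t \<in> carrier P" using lift add_homD(1)[OF hom] by simp
    fix u assume "u \<in> carrier T"
    then obtain g where g: "g \<in> carrier F" "u = rels +>\<^bsub>F\<^esub> g" by (auto simp: T_carrier)
    have fg: "f \<oplus>\<^bsub>F\<^esub> g \<in> carrier F"
      using f g abelian_groupE(1)[OF free_pairs_abelian_group] by blast
    have "t \<oplus>\<^bsub>T\<^esub> u = rels +>\<^bsub>F\<^esub> (f \<oplus>\<^bsub>F\<^esub> g)"
      using f g add_homD(2)[OF T_coset_hom] by simp
    then show "tensor_lift P \<phi> (t \<oplus>\<^bsub>T\<^esub> u) = tensor_lift P \<phi> t \<oplus>\<^bsub>P\<^esub> tensor_lift P \<phi> u"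
      using f g fg by (simp add: lift add_homD(2)[OF hom])
  qed
  show "m \<in> carrier M \<Longrightarrow> n \<in> carrier N \<Longrightarrow> tensor_lift P \<phi> (pt m n) = \<phi> (m, n)"
    by (simp add: pure_tensor_def lift frag_of_in_F fl_of)
qed

end

section \<open>The path algebra and its bimodules of chains\<close>

text \<open>The basis of \<open>R_i[X]\<close>, in a form that is evaluated by distinguishing \<open>i = 0\<close>.\<close>

definition deg_chains :: "'a precubical \<Rightarrow> nat \<Rightarrow> 'a cchain set" where
  "deg_chains X i = (if i = 0 then {} else Ch X (i - 1))"

lemma path_algebra_simps:
  "carrier (path_algebra R X) = {f. Poly_Mapping.keys f \<subseteq> Ch X 0}"
  "mult (path_algebra R X) = conc" "one (path_algebra R X) = (\<Sum>v\<in>cells X 0. Poly_Mapping.single (v, [], v) 1)"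
  "zero (path_algebra R X) = 0" "add (path_algebra R X) = (+)"
  by (simp_all add: path_algebra_def)

lemma chain_bimodule_simps:
  "carrier (chain_bimodule R X i) = {f. Poly_Mapping.keys f \<subseteq> deg_chains X i}"
  "zero (chain_bimodule R X i) = 0" "add (chain_bimodule R X i) = (+)"
  "smult (chain_bimodule R X i) = conc" "rsmult (chain_bimodule R X i) = conc"
proof -
  have "(\<exists>m. m + 1 = i \<and> c \<in> Ch X m) \<longleftrightarrow> c \<in> deg_chains X i" for c
    by (cases i) (auto simp: deg_chains_def)
  then show "carrier (chain_bimodule R X i) = {f. Poly_Mapping.keys f \<subseteq> deg_chains X i}"
    by (auto simp: chain_bimodule_def)
qed (simp_all add: chain_bimodule_def)

lemma carrier_chain_bimodule_1: "carrier (chain_bimodule R X (Suc 0)) = {f. Poly_Mapping.keys f \<subseteq> Ch X 0}"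
  by (simp add: chain_bimodule_simps deg_chains_def)

lemma carrier_chain_bimodule_0: "carrier (chain_bimodule R X 0) = {0}"
  by (auto simp: chain_bimodule_simps deg_chains_def keys_eq_empty)

lemma keys_add_subset: "Poly_Mapping.keys f \<subseteq> S \<Longrightarrow> Poly_Mapping.keys g \<subseteq> S \<Longrightarrow> Poly_Mapping.keys (f + g) \<subseteq> S"
  using keys_add[of f g] by blast

lemma additive_keys_abelian_group:
  assumes "carrier P = {f :: 'c \<Rightarrow>\<^sub>0 'r::field. Poly_Mapping.keys f \<subseteq> S}" "zero P = 0" "add P = (+)"
  shows "abelian_group P"
proof (rule abelian_groupI)
  fix x assume "x \<in> carrier P"
  then show "\<exists>y\<in>carrier P. y \<oplus>\<^bsub>P\<^esub> x = \<zero>\<^bsub>P\<^esub>"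
    using assms by (intro bexI[of _ "- x"]) auto
next
  fix x y assume "x \<in> carrier P" "y \<in> carrier P"
  then show "x \<oplus>\<^bsub>P\<^esub> y \<in> carrier P" using assms keys_add_subset[of x S y] by simp
qed (auto simp: assms add.assoc add.commute)

lemma path_unit_left:
  fixes f :: "('a, 'r::field) chains"
  assumes X: "precubical_set X" "finite (cells X 0)"
    and f: "\<And>v cs w. (v, cs, w) \<in> Poly_Mapping.keys f \<Longrightarrow> v \<in> cells X 0"
  shows "conc (\<Sum>v\<in>cells X 0. Poly_Mapping.single (v, [], v) 1) f = f"
proof (rule rlinear_eqI[OF rlinear_conc_right rlinear_id order_refl])
  fix c assume c: "c \<in> Poly_Mapping.keys f"
  obtain v cs w where eq: "c = (v, cs, w)" by (rule prod_cases3)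
  show "conc (\<Sum>v\<in>cells X 0. Poly_Mapping.single (v, [], v) 1) (Poly_Mapping.single c 1) = (Poly_Mapping.single c 1 :: ('a, 'r) chains)"
    using f[of v cs w] c X(2) by (simp add: eq conc_left conc_single sum.delta)
qed

lemma path_unit_right:
  fixes f :: "('a, 'r::field) chains"
  assumes X: "precubical_set X" "finite (cells X 0)"
    and f: "\<And>v cs w. (v, cs, w) \<in> Poly_Mapping.keys f \<Longrightarrow> w \<in> cells X 0"
  shows "conc f (\<Sum>v\<in>cells X 0. Poly_Mapping.single (v, [], v) 1) = f"
proof (rule rlinear_eqI[OF rlinear_conc_left rlinear_id order_refl])
  fix c assume c: "c \<in> Poly_Mapping.keys f"
  obtain v cs w where eq: "c = (v, cs, w)" by (rule prod_cases3)
  show "conc (Poly_Mapping.single c 1) (\<Sum>v\<in>cells X 0. Poly_Mapping.single (v, [], v) 1) = (Poly_Mapping.single c 1 :: ('a, 'r) chains)"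
    using f[of v cs w] c X(2) by (simp add: eq conc_right conc_single sum.delta')
qed

lemma Ch_ends:
  assumes "precubical_set X" "(v, cs, w) \<in> Ch X m"
  shows "v \<in> cells X 0" "w \<in> cells X 0"
  using assms dpath_ends[OF assms(1)] by (auto simp: Ch_iff[OF assms(1)])

lemma unit_in_carrier:
  assumes "precubical_set X"
  shows "Poly_Mapping.keys (\<Sum>v\<in>cells X 0. Poly_Mapping.single (v, [], v) 1 :: ('a, 'r::field) chains) \<subseteq> Ch X 0"
proof -
  have "Poly_Mapping.keys (\<Sum>v\<in>cells X 0. Poly_Mapping.single (v, [], v) 1 :: ('a, 'r) chains) \<subseteq>
    (\<Union>v\<in>cells X 0. Poly_Mapping.keys (Poly_Mapping.single (v, [], v) 1 :: ('a, 'r) chains))"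
    by (rule keys_sum)
  also have "\<dots> \<subseteq> Ch X 0" by (auto simp: Ch_iff[OF assms])
  finally show ?thesis .
qed

lemma path_algebra_ring:
  fixes R :: "'r::field itself"
  assumes X: "precubical_set X" "finite (cells X 0)"
  shows "ring (path_algebra R X)"
proof (rule ringI)
  show "abelian_group (path_algebra R X)"
    by (rule additive_keys_abelian_group) (simp_all add: path_algebra_simps)
  have "Poly_Mapping.keys (conc f g) \<subseteq> Ch X 0"
    if "Poly_Mapping.keys f \<subseteq> Ch X 0" "Poly_Mapping.keys g \<subseteq> Ch X 0" for f g :: "('a, 'r) chains"
    using conc_keys[OF X(1) that] by simp
  moreover have "conc (\<Sum>v\<in>cells X 0. Poly_Mapping.single (v, [], v) 1) f = f"
    "conc f (\<Sum>v\<in>cells X 0. Poly_Mapping.single (v, [], v) 1) = f"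
    if "Poly_Mapping.keys f \<subseteq> Ch X 0" for f :: "('a, 'r) chains"
    using that Ch_ends[OF X(1)] by (blast intro!: path_unit_left[OF X] path_unit_right[OF X])+
  ultimately show "monoid (path_algebra R X)"
    by (intro monoidI) (auto simp: path_algebra_simps conc_assoc intro: subsetD[OF unit_in_carrier[OF X(1)]])
qed (simp_all add: path_algebra_simps conc_left conc_right)

lemma conc_deg:
  fixes f g :: "('a, 'r::field) chains"
  assumes X: "precubical_set X"
  shows "Poly_Mapping.keys f \<subseteq> Ch X 0 \<Longrightarrow> Poly_Mapping.keys g \<subseteq> deg_chains X i \<Longrightarrow> Poly_Mapping.keys (conc f g) \<subseteq> deg_chains X i"
    and "Poly_Mapping.keys f \<subseteq> deg_chains X i \<Longrightarrow> Poly_Mapping.keys g \<subseteq> Ch X 0 \<Longrightarrow> Poly_Mapping.keys (conc f g) \<subseteq> deg_chains X i"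
proof -
  show "Poly_Mapping.keys f \<subseteq> Ch X 0 \<Longrightarrow> Poly_Mapping.keys g \<subseteq> deg_chains X i \<Longrightarrow> Poly_Mapping.keys (conc f g) \<subseteq> deg_chains X i"
    using conc_keys[OF X, of f 0 g "i - 1"]
    by (cases "i = 0") (simp_all add: deg_chains_def keys_eq_empty conc_right)
  show "Poly_Mapping.keys f \<subseteq> deg_chains X i \<Longrightarrow> Poly_Mapping.keys g \<subseteq> Ch X 0 \<Longrightarrow> Poly_Mapping.keys (conc f g) \<subseteq> deg_chains X i"
    using conc_keys[OF X, of f "i - 1" g 0]
    by (cases "i = 0") (simp_all add: deg_chains_def keys_eq_empty conc_left)
qed

lemma sub_precubical_refl: "precubical_set X \<Longrightarrow> sub_precubical X X"
  by (simp add: sub_precubical_def)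

text \<open>The two path algebras may belong to different subsets of \<open>X\<close>. In degree 1 this covers every role of
\<open>R[X]\<close> in an extension of scalars.\<close>

lemma chain_biaction:
  fixes R :: "'r::field itself"
  assumes X: "precubical_set X" "finite (cells X 0)" and Z: "sub_precubical Z X" "sub_precubical Z' X"
  shows "biaction (path_algebra R Z) (path_algebra R Z') (chain_bimodule R X i)"
proof -
  have fin: "finite (cells Z 0)" "finite (cells Z' 0)"
    using X(2) sub_precubicalD(2)[OF Z(1), of 0] sub_precubicalD(2)[OF Z(2), of 0] by (auto intro: finite_subset)
  have l: "Poly_Mapping.keys (conc f g) \<subseteq> deg_chains X i"
    if "Poly_Mapping.keys f \<subseteq> Ch Z 0" "Poly_Mapping.keys g \<subseteq> deg_chains X i" for f g :: "('a, 'r) chains"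
    using conc_deg(1)[OF X(1) _ that(2)] that(1) Ch_sub[OF X(1) Z(1), of 0] by blast
  have r: "Poly_Mapping.keys (conc f g) \<subseteq> deg_chains X i"
    if "Poly_Mapping.keys f \<subseteq> deg_chains X i" "Poly_Mapping.keys g \<subseteq> Ch Z' 0" for f g :: "('a, 'r) chains"
    using conc_deg(2)[OF X(1) that(1)] that(2) Ch_sub[OF X(1) Z(2), of 0] by blast
  have ag: "abelian_group (chain_bimodule R X i)"
    by (rule additive_keys_abelian_group) (simp_all add: chain_bimodule_simps)
  show ?thesis
    by (intro biaction.intro biaction_axioms.intro ag path_algebra_ring sub_precubicalD(1)[OF Z(1)]
        sub_precubicalD(1)[OF Z(2)] fin)
      (simp_all add: chain_bimodule_simps path_algebra_simps l r conc_left conc_right conc_assoc)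
qed

lemma deg_chains_ends:
  assumes "precubical_set X" "(v, cs, w) \<in> deg_chains X i"
  shows "v \<in> cells X 0" "w \<in> cells X 0"
  using assms Ch_ends[OF assms(1)] by (auto simp: deg_chains_def split: if_splits)

lemma chain_bimodule_bimodule:
  fixes R :: "'r::field itself"
  assumes X: "precubical_set X" "finite (cells X 0)"
  shows "bimodule (path_algebra R X) (path_algebra R X) (chain_bimodule R X i)"
proof -
  have "conc (\<Sum>v\<in>cells X 0. Poly_Mapping.single (v, [], v) 1) f = f"
    "conc f (\<Sum>v\<in>cells X 0. Poly_Mapping.single (v, [], v) 1) = f"
    if "Poly_Mapping.keys f \<subseteq> deg_chains X i" for f :: "('a, 'r) chains"
    using that deg_chains_ends[OF X(1)] by (blast intro!: path_unit_left[OF X] path_unit_right[OF X])+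
  then show ?thesis
    unfolding bimodule_iff_biaction
    using chain_biaction[OF X sub_precubical_refl sub_precubical_refl, of R i] X
    by (simp add: chain_bimodule_simps path_algebra_simps)
qed

lemma boundary_deg:
  fixes f :: "('a, 'r::field) chains"
  assumes X: "precubical_set X" and f: "Poly_Mapping.keys f \<subseteq> deg_chains X (Suc i)"
  shows "Poly_Mapping.keys (boundary X f) \<subseteq> deg_chains X i"
proof (cases i)
  case 0
  then show ?thesis using boundary_dim_0[OF X, of f] f by (simp add: deg_chains_def)
next
  case (Suc j)
  then show ?thesis using boundary_keys[OF X, of f j] f by (simp add: deg_chains_def)
qed

lemma boundary_bimodule_hom:
  assumes X: "precubical_set X"
  shows "boundary X \<in> bimodule_hom (path_algebra R X) (path_algebra R X) (chain_bimodule R X (Suc i)) (chain_bimodule R X i)"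
proof -
  have "boundary X \<in> add_hom (chain_bimodule R X (Suc i)) (chain_bimodule R X i)"
    by (rule add_homI) (simp_all add: chain_bimodule_simps boundary_rlinear boundary_deg[OF X])
  then show ?thesis
    by (simp add: bimodule_hom_def chain_bimodule_simps path_algebra_simps boundary_conc_path_left[OF X]
        deg_chains_def boundary_conc_path_right[OF X])
qed

lemma boundary_boundary_deg:
  fixes f :: "('a, 'r::field) chains"
  assumes X: "precubical_set X" and f: "Poly_Mapping.keys f \<subseteq> deg_chains X i"
  shows "boundary X (boundary X f) = 0"
proof (rule boundary_boundary[OF X])
  fix v cs w assume "(v, cs, w) \<in> Poly_Mapping.keys f"
  then have "dpath X v cs w" using f by (auto simp: deg_chains_def Ch_iff[OF X] split: if_splits)
  from dpath_cubes[OF this] show "set cs \<subseteq> cubes X" ..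
qed

section \<open>Extension of scalars\<close>

locale precubical_pair =
  fixes X Y :: "'a precubical" and R :: "'r::field itself"
  assumes X: "precubical_set X" and finite_vertices: "finite (cells X 0)" and sub: "sub_precubical Y X"
begin

lemma Y: "precubical_set Y" "finite (cells Y 0)"
  using sub_precubicalD(1,2)[OF sub] finite_vertices by (auto intro: finite_subset)

abbreviation "A \<equiv> path_algebra R X"
abbreviation "S \<equiv> path_algebra R Y"
abbreviation "C \<equiv> chain_bimodule R X"
abbreviation "CY \<equiv> chain_bimodule R Y"

lemma A_ring: "ring A" by (rule path_algebra_ring[OF X finite_vertices])
lemma S_ring: "ring S" by (rule path_algebra_ring[OF Y])

lemma S_in_A: "y \<in> carrier S \<Longrightarrow> y \<in> carrier A"
  using Ch_sub[OF X sub, of 0] by (auto simp: path_algebra_simps)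

lemma C_bimodule: "bimodule A A (C i)"
  by (rule chain_bimodule_bimodule[OF X finite_vertices])

lemma CY_bimodule: "bimodule S S (CY i)"
  by (rule chain_bimodule_bimodule[OF Y])

lemma C_biaction: "biaction A A (C i)" "biaction A S (C i)" "biaction S A (C i)" "biaction S S (C i)"
  by (intro chain_biaction[OF X finite_vertices] sub sub_precubical_refl[OF X])+

lemma carrier_C1: "carrier (C (Suc 0)) = carrier A"
  unfolding carrier_chain_bimodule_1 path_algebra_simps ..

end

text \<open>An extension of scalars is a tensor product of a tensor product; the two interpretations of
\<open>tensor_factors\<close> below supply the inner and the outer one.\<close>

locale ext_module = precubical_pair X Y R
  for X Y :: "'a precubical" and R :: "'r::field itself" +
  fixes M :: "(('a, 'r) chains, 'm, ('a, 'r) chains) bimodule"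
  assumes M: "bimodule S S M"
begin

lemma M_biaction: "biaction S S M" using M by (simp add: bimodule_iff_biaction)

sublocale M: bimodule S S M by (rule M)

sublocale T1: tensor_factors A S S "C (Suc 0)" M
  by (intro tensor_factors.intro C_biaction M_biaction)

sublocale T2: tensor_factors A S A "tensor S (C (Suc 0)) M" "C (Suc 0)"
  by (intro tensor_factors.intro C_biaction T1.T_biaction)

abbreviation "E \<equiv> ext_scalars R X Y M"
abbreviation "ep \<equiv> ext_pure R X Y M"

lemma E_eq: "E = tensor S (tensor S (C (Suc 0)) M) (C (Suc 0))"
  by (simp add: ext_scalars_def)

lemma ep_eq: "ep p m q = pure_tensor S (tensor S (C (Suc 0)) M) (C (Suc 0)) (pure_tensor S (C (Suc 0)) M p m) q"
  by (simp add: ext_pure_def)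

lemma E_group: "abelian_group E"
  unfolding E_eq by (rule T2.T_group)

lemma E_bimodule: "bimodule A A E"
proof -
  interpret C1: bimodule A A "C (Suc 0)" by (rule C_bimodule)
  show ?thesis
    unfolding bimodule_iff_biaction E_eq
  proof (intro conjI ballI T2.T_biaction)
    fix t assume t: "t \<in> carrier (tensor S (tensor S (C (Suc 0)) M) (C (Suc 0)))"
    show "smult (tensor S (tensor S (C (Suc 0)) M) (C (Suc 0))) \<one>\<^bsub>A\<^esub> t = t"
      by (rule T2.T_one_left[OF T1.T_one_left[OF C1.one_lact] t])
    show "rsmult (tensor S (tensor S (C (Suc 0)) M) (C (Suc 0))) t \<one>\<^bsub>A\<^esub> = t"
      by (rule T2.T_one_right[OF C1.ract_one t])
  qed
qed

lemma ep_closed [simp]: "p \<in> carrier A \<Longrightarrow> m \<in> carrier M \<Longrightarrow> q \<in> carrier A \<Longrightarrow> ep p m q \<in> carrier E"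
  unfolding E_eq ep_eq by (intro T2.pt_closed T1.pt_closed) (simp_all only: carrier_C1)

lemma ep_add:
  assumes "p \<in> carrier A" "m \<in> carrier M" "q \<in> carrier A"
  shows "p' \<in> carrier A \<Longrightarrow> ep (p + p') m q = ep p m q \<oplus>\<^bsub>E\<^esub> ep p' m q"
    and "m' \<in> carrier M \<Longrightarrow> ep p (m \<oplus>\<^bsub>M\<^esub> m') q = ep p m q \<oplus>\<^bsub>E\<^esub> ep p m' q"
    and "q' \<in> carrier A \<Longrightarrow> ep p m (q + q') = ep p m q \<oplus>\<^bsub>E\<^esub> ep p m q'"
proof -
  note a = assms[folded carrier_C1]
  have add: "x + y = x \<oplus>\<^bsub>C (Suc 0)\<^esub> y" for x y by (simp add: chain_bimodule_simps)
  show "ep (p + p') m q = ep p m q \<oplus>\<^bsub>E\<^esub> ep p' m q" if p': "p' \<in> carrier A"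
    using T1.pt_add_left[OF a(1) p'[folded carrier_C1] a(2)]
      T2.pt_add_left[OF T1.pt_closed[OF a(1,2)] T1.pt_closed[OF p'[folded carrier_C1] a(2)] a(3)]
    unfolding E_eq ep_eq add by (simp only:)
  show "ep p (m \<oplus>\<^bsub>M\<^esub> m') q = ep p m q \<oplus>\<^bsub>E\<^esub> ep p m' q" if m': "m' \<in> carrier M"
    using T1.pt_add_right[OF a(1,2) m'] T2.pt_add_left[OF T1.pt_closed[OF a(1,2)] T1.pt_closed[OF a(1) m'] a(3)]
    unfolding E_eq ep_eq by (simp only:)
  show "ep p m (q + q') = ep p m q \<oplus>\<^bsub>E\<^esub> ep p m q'" if q': "q' \<in> carrier A"
    using T2.pt_add_right[OF T1.pt_closed[OF a(1,2)] a(3) q'[folded carrier_C1]]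
    unfolding E_eq ep_eq add by (simp only:)
qed

lemma ep_balanced:
  assumes "p \<in> carrier A" "m \<in> carrier M" "q \<in> carrier A" "y \<in> carrier S"
  shows "ep (conc p y) m q = ep p (smult M y m) q" "ep p (rsmult M m y) q = ep p m (conc y q)"
proof -
  note a = assms(1-3)[folded carrier_C1]
  show "ep (conc p y) m q = ep p (smult M y m) q"
    using T1.pt_balanced[OF a(1) assms(4) a(2)] unfolding ep_eq chain_bimodule_simps by (simp only:)
  show "ep p (rsmult M m y) q = ep p m (conc y q)"
    using T1.T_ract(2)[OF assms(4) a(1,2)] T2.pt_balanced[OF T1.pt_closed[OF a(1,2)] assms(4) a(3)]
    unfolding ep_eq chain_bimodule_simps by (simp only:)
qed

lemma ep_act:
  assumes "p \<in> carrier A" "m \<in> carrier M" "q \<in> carrier A" "a \<in> carrier A"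
  shows "smult E a (ep p m q) = ep (conc a p) m q" "rsmult E (ep p m q) a = ep p m (conc q a)"
proof -
  note a = assms(1-3)[folded carrier_C1]
  show "smult E a (ep p m q) = ep (conc a p) m q"
    using T2.T_lact(2)[OF assms(4) T1.pt_closed[OF a(1,2)] a(3)] T1.T_lact(2)[OF assms(4) a(1,2)]
    unfolding ep_eq E_eq chain_bimodule_simps by (simp only:)
  show "rsmult E (ep p m q) a = ep p m (conc q a)"
    using T2.T_ract(2)[OF assms(4) T1.pt_closed[OF a(1,2)] a(3)]
    unfolding ep_eq E_eq chain_bimodule_simps by (simp only:)
qed

lemma E_induct [consumes 1, case_names zero add pure]:
  assumes t: "t \<in> carrier E" and zero: "Q \<zero>\<^bsub>E\<^esub>"
    and add: "\<And>t u. t \<in> carrier E \<Longrightarrow> u \<in> carrier E \<Longrightarrow> Q t \<Longrightarrow> Q u \<Longrightarrow> Q (t \<oplus>\<^bsub>E\<^esub> u)"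
    and pure: "\<And>p m q. p \<in> carrier A \<Longrightarrow> m \<in> carrier M \<Longrightarrow> q \<in> carrier A \<Longrightarrow> Q (ep p m q)"
  shows "Q t"
  using t unfolding E_eq
proof (induction rule: T2.T_induct)
  case zero
  show ?case using assms(2) unfolding E_eq .
next
  case (add t u)
  then show ?case using assms(3)[of t u] unfolding E_eq by blast
next
  case (pure t q)
  show ?case using pure(1)
  proof (induction rule: T1.T_induct)
    case zero
    show ?case
      using add_hom_group(1)[OF T1.T_group T2.T_group T2.pt_hom_left[OF pure(2)]] assms(2)
      unfolding E_eq by simp
  next
    case (add t u)
    then have "Q (T2.pt t q \<oplus>\<^bsub>E\<^esub> T2.pt u q)"
      using pure(2) unfolding E_eq by (intro assms(3)[unfolded E_eq]) auto
    then show ?case using T2.pt_add_left[OF add(1,2) pure(2)] unfolding E_eq by simp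
  next
    case (pure p m)
    then show ?case
      using assms(4)[of p m q] \<open>q \<in> carrier (C (Suc 0))\<close> unfolding ep_eq carrier_C1 by blast
  qed
qed

lemma E_hom_eq:
  assumes P: "abelian_group P" and f: "f \<in> add_hom E P" and g: "g \<in> add_hom E P"
    and eq: "\<And>p m q. p \<in> carrier A \<Longrightarrow> m \<in> carrier M \<Longrightarrow> q \<in> carrier A \<Longrightarrow> f (ep p m q) = g (ep p m q)"
    and t: "t \<in> carrier E"
  shows "f t = g t"
  using t
proof (induction rule: E_induct)
  case zero
  show ?case using add_hom_group(1)[OF E_group P f] add_hom_group(1)[OF E_group P g] by simp
qed (simp_all add: eq add_homD(2)[OF f] add_homD(2)[OF g])

text \<open>Maps out of the two nested tensor products, in the form shared by \<open>ext_hom\<close> and by the coordinate maps: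
the left factor acts on \<open>M\<close> through \<open>f\<close>, the right factor on the result through \<open>g\<close>.\<close>

lemma ext_lift:
  fixes f :: "('a, 'r) chains \<Rightarrow> 'm \<Rightarrow> 'p" and g :: "'p \<Rightarrow> ('a, 'r) chains \<Rightarrow> 'p"
  assumes P: "abelian_group P"
    and f: "\<And>p m. p \<in> carrier A \<Longrightarrow> m \<in> carrier M \<Longrightarrow> f p m \<in> carrier P"
    and f_addl: "\<And>p p' m. p \<in> carrier A \<Longrightarrow> p' \<in> carrier A \<Longrightarrow> m \<in> carrier M \<Longrightarrow> f (p + p') m = f p m \<oplus>\<^bsub>P\<^esub> f p' m"
    and f_addr: "\<And>p m m'. p \<in> carrier A \<Longrightarrow> m \<in> carrier M \<Longrightarrow> m' \<in> carrier M \<Longrightarrow> f p (m \<oplus>\<^bsub>M\<^esub> m') = f p m \<oplus>\<^bsub>P\<^esub> f p m'"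
    and f_bal: "\<And>p y m. p \<in> carrier A \<Longrightarrow> y \<in> carrier S \<Longrightarrow> m \<in> carrier M \<Longrightarrow> f (conc p y) m = f p (smult M y m)"
    and g: "\<And>x q. x \<in> carrier P \<Longrightarrow> q \<in> carrier A \<Longrightarrow> g x q \<in> carrier P"
    and g_addl: "\<And>x x' q. x \<in> carrier P \<Longrightarrow> x' \<in> carrier P \<Longrightarrow> q \<in> carrier A \<Longrightarrow> g (x \<oplus>\<^bsub>P\<^esub> x') q = g x q \<oplus>\<^bsub>P\<^esub> g x' q"
    and g_addr: "\<And>x q q'. x \<in> carrier P \<Longrightarrow> q \<in> carrier A \<Longrightarrow> q' \<in> carrier A \<Longrightarrow> g x (q + q') = g x q \<oplus>\<^bsub>P\<^esub> g x q'"
    and g_bal: "\<And>p m y q. p \<in> carrier A \<Longrightarrow> m \<in> carrier M \<Longrightarrow> y \<in> carrier S \<Longrightarrow> q \<in> carrier A \<Longrightarrow>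
      g (f p (rsmult M m y)) q = g (f p m) (conc y q)"
  defines "L \<equiv> tensor_lift P (\<lambda>(t, q). g (tensor_lift P (\<lambda>(p, m). f p m) t) q)"
  shows "L \<in> add_hom E P"
    and "p \<in> carrier A \<Longrightarrow> m \<in> carrier M \<Longrightarrow> q \<in> carrier A \<Longrightarrow> L (ep p m q) = g (f p m) q"
proof -
  let ?L1 = "tensor_lift P (\<lambda>(p, m). f p m)"
  have L1: "?L1 \<in> add_hom (tensor S (C (Suc 0)) M) P"
    by (rule T1.tensor_lift(1)[OF P], unfold carrier_C1) (simp_all add: f f_addl f_addr f_bal chain_bimodule_simps(3-5))
  have L1_pt: "?L1 (T1.pt p m) = f p m" if "p \<in> carrier A" "m \<in> carrier M" for p m
  proof -
    have "?L1 (T1.pt p m) = (\<lambda>(p, m). f p m) (p, m)"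
      by (rule T1.tensor_lift(2)[OF P], unfold carrier_C1)
        (simp_all add: f f_addl f_addr f_bal chain_bimodule_simps(3-5) that)
    then show ?thesis by simp
  qed
  have L1_bal: "g (?L1 (rsmult (tensor S (C (Suc 0)) M) t y)) q = g (?L1 t) (conc y q)"
    if t: "t \<in> carrier (tensor S (C (Suc 0)) M)" and y: "y \<in> carrier S" and q: "q \<in> carrier A" for t y q
  proof -
    have yq: "conc y q \<in> carrier A"
      using ring.ring_simprules(5)[OF A_ring S_in_A[OF y] q] by (simp add: path_algebra_simps)
    have g1: "(\<lambda>x. g x q) \<in> add_hom P P" and g2: "(\<lambda>x. g x (conc y q)) \<in> add_hom P P"
      using q yq by (auto intro!: add_homI simp: g g_addl)
    show ?thesis
    proof (rule T1.T_hom_eq[OF P add_hom_comp[OF add_hom_comp[OF T1.T_ract(1)[OF y] L1] g1]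
          add_hom_comp[OF L1 g2] _ t], unfold carrier_C1)
      fix p m assume pm: "p \<in> carrier A" "m \<in> carrier M"
      then show "g (?L1 (rsmult (tensor S (C (Suc 0)) M) (T1.pt p m) y)) q = g (?L1 (T1.pt p m)) (conc y q)"
        using T1.T_ract(2)[OF y, unfolded carrier_C1, OF pm] M.ract_closed[OF pm(2) y]
        by (simp add: L1_pt g_bal y q)
    qed
  qed
  note L1_cl = add_homD(1)[OF L1]
  show "L \<in> add_hom E P"
    unfolding L_def E_eq
    by (rule T2.tensor_lift(1)[OF P], unfold carrier_C1)
      (simp_all add: g g_addl g_addr L1_cl add_homD(2)[OF L1] L1_bal chain_bimodule_simps(3-5))
  assume pmq: "p \<in> carrier A" "m \<in> carrier M" "q \<in> carrier A"
  have "L (ep p m q) = (\<lambda>(t, q). g (?L1 t) q) (T1.pt p m, q)"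
    unfolding L_def ep_eq
    by (rule T2.tensor_lift(2)[OF P], unfold carrier_C1)
      (use pmq in \<open>simp_all add: g g_addl g_addr L1_cl add_homD(2)[OF L1] L1_bal chain_bimodule_simps(3-5)
        T1.pt_closed[unfolded carrier_C1]\<close>)
  then show "L (ep p m q) = g (f p m) q" using pmq by (simp add: L1_pt)
qed

end

section \<open>Coordinates on the extension of scalars\<close>

context precubical_pair
begin

text \<open>The reduced prefixes: directed paths of \<open>X\<close> into \<open>Y\<close> whose last edge, if there is one, lies outside
\<open>Y\<close>. They are a basis of the part of \<open>R[X]\<close> that ends in \<open>Y\<close> as a right module over \<open>R[Y]\<close>, up to
the constant paths at their ends; suffixes are the mirror image.\<close>

definition prefixes :: "'a cchain set" where
  "prefixes = {(v, cs, w). dpath X v cs w \<and> weight cs = 0 \<and> w \<in> cells Y 0 \<and> (cs \<noteq> [] \<longrightarrow> last cs \<notin> cubes Y)}"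

definition suffixes :: "'a cchain set" where
  "suffixes = {(v, cs, w). dpath X v cs w \<and> weight cs = 0 \<and> v \<in> cells Y 0 \<and> (cs \<noteq> [] \<longrightarrow> hd cs \<notin> cubes Y)}"

text \<open>The component of a chain along the prefix \<open>p\<close>: a path \<open>p y\<close> with \<open>y\<close> in \<open>Y\<close> goes to \<open>y\<close>, every other
path to 0.\<close>

definition strip_prefix :: "'a cchain \<Rightarrow> ('a, 'r) chains \<Rightarrow> ('a, 'r) chains" where
  "strip_prefix = (\<lambda>(v0, cs0, w0). lin (\<lambda>(v, cs, w).
     if v = v0 \<and> (\<exists>ds. cs = cs0 @ ds \<and> dpath Y w0 ds w)
     then Poly_Mapping.single (w0, drop (length cs0) cs, w) 1 else 0))"

definition strip_suffix :: "'a cchain \<Rightarrow> ('a, 'r) chains \<Rightarrow> ('a, 'r) chains" where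
  "strip_suffix = (\<lambda>(v0, cs0, w0). lin (\<lambda>(v, cs, w).
     if w = w0 \<and> (\<exists>ds. cs = ds @ cs0 \<and> dpath Y v ds v0)
     then Poly_Mapping.single (v, take (length cs - length cs0) cs, v0) 1 else 0))"

lemma Y_dpath_X: "dpath Y v cs w \<Longrightarrow> dpath X v cs w"
  using dpath_sub_iff[OF sub] by blast

lemma strip_prefix_single:
  "strip_prefix (v0, cs0, w0) (Poly_Mapping.single (v, cs, w) a) =
    (if v = v0 \<and> (\<exists>ds. cs = cs0 @ ds \<and> dpath Y w0 ds w)
     then Poly_Mapping.single (w0, drop (length cs0) cs, w) a else 0)"
  by (auto simp: strip_prefix_def)

lemma strip_suffix_single:
  "strip_suffix (v0, cs0, w0) (Poly_Mapping.single (v, cs, w) a) =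
    (if w = w0 \<and> (\<exists>ds. cs = ds @ cs0 \<and> dpath Y v ds v0)
     then Poly_Mapping.single (v, take (length cs - length cs0) cs, v0) a else 0)"
  by (auto simp: strip_suffix_def)

lemma rlinear_strip: "rlinear (strip_prefix p)" "rlinear (strip_suffix p)"
  by (cases p; simp add: strip_prefix_def strip_suffix_def rlinear_lin)+

lemma strip_keys:
  assumes f: "Poly_Mapping.keys f \<subseteq> Ch X 0"
  shows "Poly_Mapping.keys (strip_prefix p f) \<subseteq> Ch Y 0" "Poly_Mapping.keys (strip_suffix p f) \<subseteq> Ch Y 0"
proof -
  obtain v0 cs0 w0 where p: "p = (v0, cs0, w0)" by (rule prod_cases3)
  show "Poly_Mapping.keys (strip_prefix p f) \<subseteq> Ch Y 0"
  proof (rule rlinear_keys[OF rlinear_strip(1) f])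
    fix c assume c: "c \<in> Ch X 0"
    obtain v cs w where eq: "c = (v, cs, w)" by (rule prod_cases3)
    show "Poly_Mapping.keys (strip_prefix p (Poly_Mapping.single c 1)) \<subseteq> Ch Y 0"
      using c by (auto simp: p eq strip_prefix_single Ch_iff[OF X] Ch_iff[OF Y(1)])
  qed
  show "Poly_Mapping.keys (strip_suffix p f) \<subseteq> Ch Y 0"
  proof (rule rlinear_keys[OF rlinear_strip(2) f])
    fix c assume c: "c \<in> Ch X 0"
    obtain v cs w where eq: "c = (v, cs, w)" by (rule prod_cases3)
    show "Poly_Mapping.keys (strip_suffix p (Poly_Mapping.single c 1)) \<subseteq> Ch Y 0"
      using c by (auto simp: p eq strip_suffix_single Ch_iff[OF X] Ch_iff[OF Y(1)])
  qed
qed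

lemma strip_carrier:
  assumes "f \<in> carrier A"
  shows "strip_prefix p f \<in> carrier S" "strip_suffix p f \<in> carrier S"
  using assms strip_keys[of f p] by (auto simp: path_algebra_simps)

text \<open>Appending a path \<open>ys\<close> of \<open>Y\<close> does not change whether a path has the form \<open>p y\<close>: the last edge of
\<open>p\<close> is not in \<open>Y\<close>, so \<open>p\<close> cannot extend into \<open>ys\<close>.\<close>

lemma prefix_after_Y:
  assumes p: "(v, cs0, w0) \<in> prefixes" and c: "dpath X v cs w" and y: "dpath Y w ys u"
  shows "(\<exists>ds. cs @ ys = cs0 @ ds \<and> dpath Y w0 ds u) \<longleftrightarrow> (\<exists>ds. cs = cs0 @ ds \<and> dpath Y w0 ds w)"
proof
  assume "\<exists>ds. cs = cs0 @ ds \<and> dpath Y w0 ds w"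
  then show "\<exists>ds. cs @ ys = cs0 @ ds \<and> dpath Y w0 ds u"
    using y dpath_append[OF Y(1)] by (metis append_assoc)
next
  assume "\<exists>ds. cs @ ys = cs0 @ ds \<and> dpath Y w0 ds u"
  then obtain ds where ds: "cs @ ys = cs0 @ ds" "dpath Y w0 ds u" by blast
  have p': "dpath X v cs0 w0" "cs0 \<noteq> [] \<Longrightarrow> last cs0 \<notin> cubes Y" using p by (auto simp: prefixes_def)
  have "\<exists>us. cs = cs0 @ us \<and> us @ ys = ds"
  proof -
    from ds(1) consider us where "cs = cs0 @ us" "us @ ys = ds" | us where "cs @ us = cs0" "ys = us @ ds"
      by (auto simp: append_eq_append_conv2)
    then show ?thesis
    proof cases
      case (2 us)
      have "us = []"
      proof (rule ccontr)
        assume "us \<noteq> []"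
        then have "last cs0 \<in> set ys" "cs0 \<noteq> []" using 2 by auto
        then show False using p'(2) dpath_cubes[OF y] by blast
      qed
      then show ?thesis using 2 by simp
    qed blast
  qed
  then obtain us where us: "cs = cs0 @ us" "us @ ys = ds" by blast
  then obtain u' where u': "dpath Y w0 us u'" using ds(2) dpath_append[OF Y(1)] by blast
  have "dpath X w0 us w"
    using c p'(1) us dpath_append[OF X] dpath_unique_end by metis
  then have "u' = w" using Y_dpath_X[OF u'] dpath_unique_end by metis
  then show "\<exists>ds. cs = cs0 @ ds \<and> dpath Y w0 ds w" using us u' by blast
qed

lemma suffix_before_Y:
  assumes p: "(v0, cs0, w) \<in> suffixes" and c: "dpath X v cs w" and y: "dpath Y u ys v"
  shows "(\<exists>ds. ys @ cs = ds @ cs0 \<and> dpath Y u ds v0) \<longleftrightarrow> (\<exists>ds. cs = ds @ cs0 \<and> dpath Y v ds v0)"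
proof
  assume "\<exists>ds. cs = ds @ cs0 \<and> dpath Y v ds v0"
  then show "\<exists>ds. ys @ cs = ds @ cs0 \<and> dpath Y u ds v0"
    using y dpath_append[OF Y(1)] by (metis append_assoc)
next
  assume "\<exists>ds. ys @ cs = ds @ cs0 \<and> dpath Y u ds v0"
  then obtain ds where ds: "ys @ cs = ds @ cs0" "dpath Y u ds v0" by blast
  have p': "dpath X v0 cs0 w" "cs0 \<noteq> [] \<Longrightarrow> hd cs0 \<notin> cubes Y" using p by (auto simp: suffixes_def)
  have "\<exists>us. cs = us @ cs0 \<and> ys @ us = ds"
  proof -
    from ds(1) consider us where "ys @ us = ds" "cs = us @ cs0" | us where "ys = ds @ us" "us @ cs = cs0"
      by (auto simp: append_eq_append_conv2)
    then show ?thesis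
    proof cases
      case (2 us)
      have "us = []"
      proof (rule ccontr)
        assume "us \<noteq> []"
        then have "hd cs0 \<in> set ys" "cs0 \<noteq> []" using 2 by auto
        then show False using p'(2) dpath_cubes[OF y] by blast
      qed
      then show ?thesis using 2 by simp
    qed blast
  qed
  then obtain us where us: "cs = us @ cs0" "ys @ us = ds" by blast
  then obtain u' where u': "dpath Y u ys u'" "dpath Y u' us v0" using ds(2) dpath_append[OF Y(1)] by blast
  then have "u' = v" using y dpath_unique_end by metis
  then show "\<exists>ds. cs = ds @ cs0 \<and> dpath Y v ds v0" using us u' by blast
qed

text \<open>Right \<open>R[Y]\<close>-linearity is what makes stripping compatible with the balancing relations of the tensor
product.\<close>

lemma strip_prefix_conc:
  assumes p: "p \<in> prefixes" and f: "f \<in> carrier A" and y: "y \<in> carrier S"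
  shows "strip_prefix p (conc f y) = conc (strip_prefix p f) y"
proof -
  obtain v0 cs0 w0 where p0: "p = (v0, cs0, w0)" by (rule prod_cases3)
  have f': "Poly_Mapping.keys f \<subseteq> Ch X 0" and y': "Poly_Mapping.keys y \<subseteq> Ch Y 0"
    using f y by (auto simp: path_algebra_simps)
  show ?thesis
  proof (rule rlinear_eqI[OF rlinear_comp[OF rlinear_strip(1) rlinear_conc_left]
        rlinear_comp[OF rlinear_conc_left rlinear_strip(1)] f'])
    fix c assume c: "c \<in> Ch X 0"
    show "strip_prefix p (conc (Poly_Mapping.single c 1) y) = conc (strip_prefix p (Poly_Mapping.single c 1)) y"
    proof (rule rlinear_eqI[OF rlinear_comp[OF rlinear_strip(1) rlinear_conc_right] rlinear_conc_right y'])
      fix d assume d: "d \<in> Ch Y 0"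
      obtain v cs w w' ys u where eq: "c = (v, cs, w)" "d = (w', ys, u)" by (metis prod_cases3)
      show "strip_prefix p (conc (Poly_Mapping.single c 1) (Poly_Mapping.single d 1)) =
          conc (strip_prefix p (Poly_Mapping.single c 1)) (Poly_Mapping.single d 1)"
      proof (cases "w = w' \<and> v = v0")
        case True
        have cd: "dpath X v0 cs w" "dpath Y w ys u"
          using c d True by (auto simp: eq Ch_iff[OF X] Ch_iff[OF Y(1)])
        show ?thesis
          using prefix_after_Y[OF p[unfolded p0] cd] True
          by (auto simp: p0 eq conc_single strip_prefix_single conc_left)
      next
        case False
        then show ?thesis by (auto simp: p0 eq conc_single strip_prefix_single conc_left rlinearD(3)[OF rlinear_strip(1)])
      qed
    qed
  qed
qed

lemma strip_suffix_conc:
  assumes p: "p \<in> suffixes" and f: "f \<in> carrier A" and y: "y \<in> carrier S"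
  shows "strip_suffix p (conc y f) = conc y (strip_suffix p f)"
proof -
  obtain v0 cs0 w0 where p0: "p = (v0, cs0, w0)" by (rule prod_cases3)
  have f': "Poly_Mapping.keys f \<subseteq> Ch X 0" and y': "Poly_Mapping.keys y \<subseteq> Ch Y 0"
    using f y by (auto simp: path_algebra_simps)
  show ?thesis
  proof (rule rlinear_eqI[OF rlinear_comp[OF rlinear_strip(2) rlinear_conc_right]
        rlinear_comp[OF rlinear_conc_right rlinear_strip(2)] f'])
    fix c assume c: "c \<in> Ch X 0"
    show "strip_suffix p (conc y (Poly_Mapping.single c 1)) = conc y (strip_suffix p (Poly_Mapping.single c 1))"
    proof (rule rlinear_eqI[OF rlinear_comp[OF rlinear_strip(2) rlinear_conc_left] rlinear_conc_left y'])
      fix d assume d: "d \<in> Ch Y 0"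
      obtain v cs w v' ys u where eq: "c = (v, cs, w)" "d = (u, ys, v')" by (metis prod_cases3)
      show "strip_suffix p (conc (Poly_Mapping.single d 1) (Poly_Mapping.single c 1)) =
          conc (Poly_Mapping.single d 1) (strip_suffix p (Poly_Mapping.single c 1))"
      proof (cases "v = v' \<and> w = w0")
        case True
        have cd: "dpath X v cs w0" "dpath Y u ys v"
          using c d True by (auto simp: eq Ch_iff[OF X] Ch_iff[OF Y(1)])
        show ?thesis
          using suffix_before_Y[OF p[unfolded p0] cd] True
          by (auto simp: p0 eq conc_single strip_suffix_single conc_right)
      next
        case False
        then show ?thesis by (auto simp: p0 eq conc_single strip_suffix_single conc_right rlinearD(3)[OF rlinear_strip(2)])
      qed
    qed
  qed
qed

lemma S_one: "\<one>\<^bsub>S\<^esub> \<in> carrier S"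
  using unit_in_carrier[OF Y(1), where 'r = 'r] by (simp add: path_algebra_simps)

abbreviation basis :: "'a cchain \<Rightarrow> ('a, 'r) chains" where
  "basis c \<equiv> Poly_Mapping.single c 1"

definition vertex_path :: "'a \<Rightarrow> ('a, 'r) chains" where
  "vertex_path v = basis (v, [], v)"

lemma strip_prefix_prefix:
  assumes "p \<in> prefixes" "p' \<in> prefixes"
  shows "strip_prefix p (basis p') = (if p = p' then vertex_path (snd (snd p)) else 0)"
proof -
  obtain v cs w v' cs' w' where eq: "p = (v, cs, w)" "p' = (v', cs', w')" by (metis prod_cases3)
  have "v' = v \<and> (\<exists>ds. cs' = cs @ ds \<and> dpath Y w ds w') \<longleftrightarrow> p = p'"
  proof
    assume l: "v' = v \<and> (\<exists>ds. cs' = cs @ ds \<and> dpath Y w ds w')"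
    then obtain ds where ds: "cs' = cs @ ds" "dpath Y w ds w'" by blast
    have "ds = []"
    proof (rule ccontr)
      assume "ds \<noteq> []"
      then have "last cs' \<in> set ds" "cs' \<noteq> []" using ds by auto
      then show False using dpath_cubes[OF ds(2)] assms(2) by (auto simp: eq prefixes_def)
    qed
    then show "p = p'" using l ds by (simp add: eq)
  next
    assume "p = p'"
    then show "v' = v \<and> (\<exists>ds. cs' = cs @ ds \<and> dpath Y w ds w')" using assms(2) by (simp add: eq prefixes_def)
  qed
  then show ?thesis by (auto simp: eq strip_prefix_single vertex_path_def)
qed

lemma strip_suffix_suffix:
  assumes "p \<in> suffixes" "p' \<in> suffixes"
  shows "strip_suffix p (basis p') = (if p = p' then vertex_path (fst p) else 0)"
proof -
  obtain v cs w v' cs' w' where eq: "p = (v, cs, w)" "p' = (v', cs', w')" by (metis prod_cases3)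
  have "w' = w \<and> (\<exists>ds. cs' = ds @ cs \<and> dpath Y v' ds v) \<longleftrightarrow> p = p'"
  proof
    assume l: "w' = w \<and> (\<exists>ds. cs' = ds @ cs \<and> dpath Y v' ds v)"
    then obtain ds where ds: "cs' = ds @ cs" "dpath Y v' ds v" by blast
    have "ds = []"
    proof (rule ccontr)
      assume "ds \<noteq> []"
      then have "hd cs' \<in> set ds" "cs' \<noteq> []" using ds by auto
      then show False using dpath_cubes[OF ds(2)] assms(2) by (auto simp: eq suffixes_def)
    qed
    then show "p = p'" using l ds by (simp add: eq)
  next
    assume "p = p'"
    then show "w' = w \<and> (\<exists>ds. cs' = ds @ cs \<and> dpath Y v' ds v)" using assms(2) by (simp add: eq suffixes_def)
  qed
  then show ?thesis by (auto simp: eq strip_suffix_single vertex_path_def)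
qed

text \<open>Move edges of \<open>Y\<close> from the end of the path to the second factor until an edge outside \<open>Y\<close> appears.
The starting vertex of an edge of \<open>Y\<close> is in \<open>Y\<close>, so the next edge can be treated in the same way.\<close>

lemma prefix_decomposition:
  assumes "dpath X v cs w" "weight cs = 0" "w \<in> cells Y 0"
  shows "\<exists>cs0 ds u. cs = cs0 @ ds \<and> (v, cs0, u) \<in> prefixes \<and> dpath Y u ds w \<and> weight ds = 0"
  using assms
proof (induction cs arbitrary: w rule: rev_induct)
  case Nil
  then have "(v, [], w) \<in> prefixes" "dpath Y w [] w" by (auto simp: prefixes_def)
  then show ?case by force
next
  case (snoc c cs)
  show ?case
  proof (cases "c \<in> cubes Y")
    case True
    obtain u where u: "dpath X v cs u" "dpath X u [c] w" using snoc.prems(1) dpath_append[OF X] by blast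
    have "u = vertex Y False c" using u(2) vertex_sub[OF sub True] by simp
    then have "u \<in> cells Y 0" using vertex_in_cells[OF Y(1) True] by simp
    then obtain cs0 ds u' where ih: "cs = cs0 @ ds" "(v, cs0, u') \<in> prefixes" "dpath Y u' ds u" "weight ds = 0"
      using snoc.IH[OF u(1)] snoc.prems by auto
    have "dpath Y u [c] w"
      unfolding dpath_sub_iff[OF sub] using u(2) True \<open>u \<in> cells Y 0\<close> by auto
    then have "dpath Y u' (ds @ [c]) w" using ih(3) dpath_append[OF Y(1)] by blast
    moreover have "weight (ds @ [c]) = 0" using ih(4) snoc.prems(2) by simp
    ultimately show ?thesis using ih(1,2) by (metis append_assoc)
  next
    case False
    then have "(v, cs @ [c], w) \<in> prefixes" using snoc.prems by (simp add: prefixes_def)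
    moreover have "dpath Y w [] w" using snoc.prems by simp
    ultimately show ?thesis by force
  qed
qed

lemma suffix_decomposition:
  assumes "dpath X v cs w" "weight cs = 0" "v \<in> cells Y 0"
  shows "\<exists>ds cs0 u. cs = ds @ cs0 \<and> (u, cs0, w) \<in> suffixes \<and> dpath Y v ds u \<and> weight ds = 0"
  using assms
proof (induction cs arbitrary: v)
  case Nil
  then have "(w, [], w) \<in> suffixes" "dpath Y v [] w" by (auto simp: suffixes_def)
  then show ?case by force
next
  case (Cons c cs)
  show ?case
  proof (cases "c \<in> cubes Y")
    case True
    let ?u = "vertex X True c"
    have "?u \<in> cells Y 0" using vertex_in_cells[OF Y(1) True] vertex_sub[OF sub True] by metis
    then obtain ds cs0 u' where ih: "cs = ds @ cs0" "(u', cs0, w) \<in> suffixes" "dpath Y ?u ds u'" "weight ds = 0"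
      using Cons.IH[of ?u] Cons.prems by auto
    have "dpath Y v (c # ds) u'"
      using ih(3) True Cons.prems vertex_sub[OF sub True] by simp
    moreover have "weight (c # ds) = 0" using ih(4) Cons.prems by simp
    ultimately show ?thesis using ih(1,2) by (metis append_Cons)
  next
    case False
    then have "(v, c # cs, w) \<in> suffixes" using Cons.prems by (simp add: suffixes_def)
    moreover have "dpath Y v [] v" using Cons.prems by simp
    ultimately show ?thesis by force
  qed
qed

lemma prefixes_carrier: "p \<in> prefixes \<Longrightarrow> Poly_Mapping.single p a \<in> carrier A"
  by (cases p) (auto simp: prefixes_def path_algebra_simps Ch_iff[OF X])

lemma suffixes_carrier: "p \<in> suffixes \<Longrightarrow> Poly_Mapping.single p a \<in> carrier A"
  by (cases p) (auto simp: suffixes_def path_algebra_simps Ch_iff[OF X])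

lemma vertex_path_carrier: "v \<in> cells Y 0 \<Longrightarrow> vertex_path v \<in> carrier S"
  by (simp add: vertex_path_def path_algebra_simps Ch_iff[OF Y(1)])

lemma prefix_end: "p \<in> prefixes \<Longrightarrow> snd (snd p) \<in> cells Y 0"
  "p \<in> prefixes \<Longrightarrow> conc (basis p) (vertex_path (snd (snd p))) = basis p"
  by (cases p; simp add: prefixes_def vertex_path_def conc_single)+

lemma suffix_start: "p \<in> suffixes \<Longrightarrow> fst p \<in> cells Y 0"
  "p \<in> suffixes \<Longrightarrow> conc (vertex_path (fst p)) (basis p) = basis p"
  by (cases p; simp add: suffixes_def vertex_path_def conc_single)+

end

context ext_module
begin

lemma ep_homs:
  "m \<in> carrier M \<Longrightarrow> q \<in> carrier A \<Longrightarrow> (\<lambda>p. ep p m q) \<in> add_hom A E"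
  "p \<in> carrier A \<Longrightarrow> q \<in> carrier A \<Longrightarrow> (\<lambda>m. ep p m q) \<in> add_hom M E"
  "p \<in> carrier A \<Longrightarrow> m \<in> carrier M \<Longrightarrow> (\<lambda>q. ep p m q) \<in> add_hom A E"
  by (rule add_homI; simp add: path_algebra_simps(5) ep_add)+

lemma ep_zero:
  "m \<in> carrier M \<Longrightarrow> q \<in> carrier A \<Longrightarrow> ep 0 m q = \<zero>\<^bsub>E\<^esub>"
  "p \<in> carrier A \<Longrightarrow> q \<in> carrier A \<Longrightarrow> ep p \<zero>\<^bsub>M\<^esub> q = \<zero>\<^bsub>E\<^esub>"
  "p \<in> carrier A \<Longrightarrow> m \<in> carrier M \<Longrightarrow> ep p m 0 = \<zero>\<^bsub>E\<^esub>"
proof -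
  have A_group: "abelian_group A" using A_ring by (simp add: ring_def)
  show "m \<in> carrier M \<Longrightarrow> q \<in> carrier A \<Longrightarrow> ep 0 m q = \<zero>\<^bsub>E\<^esub>"
    using add_hom_group(1)[OF A_group E_group ep_homs(1)] by (simp add: path_algebra_simps(4))
  show "p \<in> carrier A \<Longrightarrow> q \<in> carrier A \<Longrightarrow> ep p \<zero>\<^bsub>M\<^esub> q = \<zero>\<^bsub>E\<^esub>"
    by (rule add_hom_group(1)[OF M.abelian_group_axioms E_group ep_homs(2)])
  show "p \<in> carrier A \<Longrightarrow> m \<in> carrier M \<Longrightarrow> ep p m 0 = \<zero>\<^bsub>E\<^esub>"
    using add_hom_group(1)[OF A_group E_group ep_homs(3)] by (simp add: path_algebra_simps(4))
qed

text \<open>In \<open>p \<otimes> m \<otimes> q\<close> the \<open>Y\<close>-parts of the paths \<open>p\<close> and \<open>q\<close> are moved into \<open>m\<close>, which leaves reduced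
paths. If \<open>p\<close> ends or \<open>q\<close> starts outside \<open>Y\<close>, the element is 0: insert the unit of \<open>R[Y]\<close>, which
fixes \<open>m\<close> and annihilates the path.\<close>

lemma E_span [consumes 1, case_names zero add pure]:
  assumes t: "t \<in> carrier E" and zero: "Q \<zero>\<^bsub>E\<^esub>"
    and add: "\<And>t u. t \<in> carrier E \<Longrightarrow> u \<in> carrier E \<Longrightarrow> Q t \<Longrightarrow> Q u \<Longrightarrow> Q (t \<oplus>\<^bsub>E\<^esub> u)"
    and pure: "\<And>p m q. p \<in> prefixes \<Longrightarrow> q \<in> suffixes \<Longrightarrow> m \<in> carrier M \<Longrightarrow> Q (ep (basis p) m (basis q))"
  shows "Q t"
  using t
proof (induction rule: E_induct)
  case (pure p m q)
  have Q_q: "Q (ep (basis p0) m q)" if p0: "p0 \<in> prefixes" and m: "m \<in> carrier M" and q: "q \<in> carrier A" for p0 m q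
  proof -
    note p0A = prefixes_carrier[OF p0, of 1]
    have "Poly_Mapping.keys q \<subseteq> Ch X 0" using q by (simp add: path_algebra_simps)
    then show ?thesis
    proof (induction q rule: chains_induct)
      case zero
      then show ?case using ep_zero(3)[OF p0A m] assms(2) by simp
    next
      case (add f g)
      then have "f \<in> carrier A" "g \<in> carrier A" by (simp_all add: path_algebra_simps)
      then show ?case using ep_add(3)[OF p0A m] assms(3) add p0A m by simp
    next
      case (single c a)
      obtain v cs w where c: "c = (v, cs, w)" by (rule prod_cases3)
      have cs: "dpath X v cs w" "weight cs = 0" using single by (simp_all add: c Ch_iff[OF X])
      have cA: "Poly_Mapping.single c a \<in> carrier A" using single by (simp add: path_algebra_simps)
      show ?case
      proof (cases "v \<in> cells Y 0")
        case True
        obtain ds cs0 u where d: "cs = ds @ cs0" "(u, cs0, w) \<in> suffixes" "dpath Y v ds u" "weight ds = 0"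
          using suffix_decomposition[OF cs True] by blast
        let ?y = "Poly_Mapping.single (v, ds, u) a"
        have y: "?y \<in> carrier S" using d by (simp add: path_algebra_simps Ch_iff[OF Y(1)])
        have "Poly_Mapping.single c a = conc ?y (basis (u, cs0, w))" by (simp add: c conc_single d)
        then have "ep (basis p0) m (Poly_Mapping.single c a) = ep (basis p0) (rsmult M m ?y) (basis (u, cs0, w))"
          using ep_balanced(2)[OF p0A m suffixes_carrier[OF d(2), of 1] y] by simp
        then show ?thesis using assms(4)[OF p0 d(2) M.ract_closed[OF m y]] by simp
      next
        case False
        have "conc \<one>\<^bsub>S\<^esub> (Poly_Mapping.single c a) = 0"
          using False by (simp add: path_algebra_simps c conc_left conc_single sum.neutral)
        then have "ep (basis p0) m (Poly_Mapping.single c a) = \<zero>\<^bsub>E\<^esub>"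
          using ep_balanced(2)[OF p0A m cA S_one] M.ract_one[OF m] ep_zero(3)[OF p0A m] by simp
        then show ?thesis using assms(2) by simp
      qed
    qed
  qed
  note m = pure(2) and q = pure(3)
  have "Poly_Mapping.keys p \<subseteq> Ch X 0" using pure(1) by (simp add: path_algebra_simps)
  then show ?case
  proof (induction p rule: chains_induct)
    case zero
    then show ?case using ep_zero(1)[OF m q] assms(2) by simp
  next
    case (add f g)
    then have fg: "f \<in> carrier A" "g \<in> carrier A" by (simp_all add: path_algebra_simps)
    then show ?case using ep_add(1)[OF fg(1) m q fg(2)] assms(3) add m q by simp
  next
    case (single c a)
    obtain v cs w where c: "c = (v, cs, w)" by (rule prod_cases3)
    have cs: "dpath X v cs w" "weight cs = 0" using single by (simp_all add: c Ch_iff[OF X])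
    have cA: "Poly_Mapping.single c a \<in> carrier A" using single by (simp add: path_algebra_simps)
    show ?case
    proof (cases "w \<in> cells Y 0")
      case True
      obtain cs0 ds u where d: "cs = cs0 @ ds" "(v, cs0, u) \<in> prefixes" "dpath Y u ds w" "weight ds = 0"
        using prefix_decomposition[OF cs True] by blast
      let ?y = "Poly_Mapping.single (u, ds, w) a"
      have y: "?y \<in> carrier S" using d by (simp add: path_algebra_simps Ch_iff[OF Y(1)])
      have "Poly_Mapping.single c a = conc (basis (v, cs0, u)) ?y" by (simp add: c conc_single d)
      then have "ep (Poly_Mapping.single c a) m q = ep (basis (v, cs0, u)) (smult M ?y m) q"
        using ep_balanced(1)[OF prefixes_carrier[OF d(2), of 1] m q y] by simp
      then show ?thesis using Q_q[OF d(2) M.lact_closed[OF y m] q] by simp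
    next
      case False
      have "conc (Poly_Mapping.single c a) \<one>\<^bsub>S\<^esub> = 0"
        using False by (simp add: path_algebra_simps c conc_right conc_single) (rule sum.neutral, auto)
      then have "ep (Poly_Mapping.single c a) m q = \<zero>\<^bsub>E\<^esub>"
        using ep_balanced(1)[OF cA m q S_one] M.one_lact[OF m] ep_zero(1)[OF m q] by simp
      then show ?thesis using assms(2) by simp
    qed
  qed
qed (rule zero, rule add)

text \<open>The map \<open>p \<otimes> m \<otimes> q \<mapsto> strip_prefix p0 p \<bullet> m \<bullet> strip_suffix q0 q\<close>.\<close>

definition coord :: "'a cchain \<Rightarrow> 'a cchain \<Rightarrow> ('a, 'r, 'm) ext \<Rightarrow> 'm" where
  "coord p0 q0 = tensor_lift M (\<lambda>(t, q). rsmult M (tensor_lift M (\<lambda>(p, m). smult M (strip_prefix p0 p) m) t) (strip_suffix q0 q))"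

lemma coord:
  assumes p0: "p0 \<in> prefixes" and q0: "q0 \<in> suffixes"
  shows coord_hom: "coord p0 q0 \<in> add_hom E M"
    and coord_ep: "p \<in> carrier A \<Longrightarrow> m \<in> carrier M \<Longrightarrow> q \<in> carrier A \<Longrightarrow>
      coord p0 q0 (ep p m q) = rsmult M (smult M (strip_prefix p0 p) m) (strip_suffix q0 q)"
proof -
  note S_simps = path_algebra_simps(2,5)[of R Y]
  have add: "smult M (y + y') m = smult M y m \<oplus>\<^bsub>M\<^esub> smult M y' m"
    "rsmult M m (y + y') = rsmult M m y \<oplus>\<^bsub>M\<^esub> rsmult M m y'"
    "smult M (conc y y') m = smult M y (smult M y' m)"
    "rsmult M m (conc y y') = rsmult M (rsmult M m y) y'"
    if "y \<in> carrier S" "y' \<in> carrier S" "m \<in> carrier M" for y y' m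
    using M.add_lact[OF that] M.add_ract[OF that(3,1,2)] M.lact_assoc[OF that] M.ract_assoc[OF that(3,1,2)]
    by (simp_all add: S_simps)
  note L = ext_lift[where P = M and f = "\<lambda>p. smult M (strip_prefix p0 p)" and g = "\<lambda>x q. rsmult M x (strip_suffix q0 q)",
      OF M.abelian_group_axioms, folded coord_def]
  note ss = strip_carrier add rlinearD(1)[OF rlinear_strip(1)] rlinearD(1)[OF rlinear_strip(2)]
      strip_prefix_conc[OF p0] strip_suffix_conc[OF q0] M.lact_closed M.ract_closed M.lact_add M.ract_add M.lact_ract
  show "coord p0 q0 \<in> add_hom E M"
    by (rule L(1)) (simp_all add: ss)
  show "p \<in> carrier A \<Longrightarrow> m \<in> carrier M \<Longrightarrow> q \<in> carrier A \<Longrightarrow>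
      coord p0 q0 (ep p m q) = rsmult M (smult M (strip_prefix p0 p) m) (strip_suffix q0 q)"
    by (rule L(2)) (simp_all add: ss)
qed

sublocale E: abelian_group E by (rule E_group)

lemma act_zero:
  "m \<in> carrier M \<Longrightarrow> smult M 0 m = \<zero>\<^bsub>M\<^esub>" "m \<in> carrier M \<Longrightarrow> rsmult M m 0 = \<zero>\<^bsub>M\<^esub>"
  "b \<in> carrier S \<Longrightarrow> rsmult M \<zero>\<^bsub>M\<^esub> b = \<zero>\<^bsub>M\<^esub>"
proof -
  have S_group: "abelian_group S" using S_ring by (simp add: ring_def)
  note gr = add_hom_group(1)[OF S_group M.abelian_group_axioms]
  show "smult M 0 m = \<zero>\<^bsub>M\<^esub>" if m: "m \<in> carrier M"
  proof -
    have "(\<lambda>a. smult M a m) \<in> add_hom S M"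
      by (rule add_homI) (simp_all add: m M.lact_closed M.add_lact)
    from gr[OF this] show ?thesis by (simp add: path_algebra_simps(4))
  qed
  show "rsmult M m 0 = \<zero>\<^bsub>M\<^esub>" if m: "m \<in> carrier M"
  proof -
    have "(\<lambda>a. rsmult M m a) \<in> add_hom S M"
      by (rule add_homI) (simp_all add: m M.ract_closed M.add_ract)
    from gr[OF this] show ?thesis by (simp add: path_algebra_simps(4))
  qed
  show "rsmult M \<zero>\<^bsub>M\<^esub> b = \<zero>\<^bsub>M\<^esub>" if b: "b \<in> carrier S"
    by (rule add_hom_group(1)[OF M.abelian_group_axioms M.abelian_group_axioms ract_hom[OF M_biaction b]])
qed

text \<open>The index set \<open>K\<close> may be replaced by any larger finite one, since the coordinates outside of it contribute
0. Stated for all larger sets, the property passes to sums of two elements by taking the union of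
their index sets.\<close>

definition expands_on :: "('a, 'r, 'm) ext \<Rightarrow> ('a cchain \<times> 'a cchain) set \<Rightarrow> bool" where
  "expands_on t K \<longleftrightarrow> finite K \<and> K \<subseteq> prefixes \<times> suffixes \<and>
    (\<forall>K'. finite K' \<longrightarrow> K \<subseteq> K' \<longrightarrow> K' \<subseteq> prefixes \<times> suffixes \<longrightarrow>
       (\<Oplus>\<^bsub>E\<^esub>k\<in>K'. ep (basis (fst k)) (coord (fst k) (snd k) t) (basis (snd k))) = t)"

lemma expands_onI:
  assumes "finite K" "K \<subseteq> prefixes \<times> suffixes"
    and "\<And>K'. finite K' \<Longrightarrow> K \<subseteq> K' \<Longrightarrow> K' \<subseteq> prefixes \<times> suffixes \<Longrightarrow>
       (\<Oplus>\<^bsub>E\<^esub>k\<in>K'. ep (basis (fst k)) (coord (fst k) (snd k) t) (basis (snd k))) = t"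
  shows "expands_on t K"
  unfolding expands_on_def using assms by blast

lemma expands_onD:
  assumes "expands_on t K"
  shows "finite K" "K \<subseteq> prefixes \<times> suffixes"
    and "finite K' \<Longrightarrow> K \<subseteq> K' \<Longrightarrow> K' \<subseteq> prefixes \<times> suffixes \<Longrightarrow>
       (\<Oplus>\<^bsub>E\<^esub>k\<in>K'. ep (basis (fst k)) (coord (fst k) (snd k) t) (basis (snd k))) = t"
  using assms unfolding expands_on_def by blast+

text \<open>It suffices to treat \<open>p \<otimes> m \<otimes> q\<close> with reduced \<open>p\<close> and \<open>q\<close>. Its only nonzero coordinate is at
\<open>(p, q)\<close>, where it equals \<open>m\<close> cut down by the constant paths at the end of \<open>p\<close> and the start of
\<open>q\<close>; these can be moved back into the outer factors and disappear there.\<close>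

lemma coord_expansion:
  assumes "t \<in> carrier E"
  shows "\<exists>K. expands_on t K"
  using assms
proof (induction rule: E_span)
  let ?term = "\<lambda>t k. ep (basis (fst k)) (coord (fst k) (snd k) t) (basis (snd k))"
  have closed: "?term t k \<in> carrier E" if "t \<in> carrier E" "k \<in> prefixes \<times> suffixes" for t k
  proof -
    obtain p q where k: "k = (p, q)" "p \<in> prefixes" "q \<in> suffixes" using \<open>k \<in> prefixes \<times> suffixes\<close> by (metis mem_Times_iff prod.collapse)
    show ?thesis unfolding k(1) fst_conv snd_conv
      by (rule ep_closed[OF prefixes_carrier[OF k(2)] add_homD(1)[OF coord_hom[OF k(2,3)] that(1)] suffixes_carrier[OF k(3)]])
  qed
  {
    case zero
    have "?term \<zero>\<^bsub>E\<^esub> k = \<zero>\<^bsub>E\<^esub>" if kk: "k \<in> prefixes \<times> suffixes" for k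
    proof -
      obtain p q where k: "k = (p, q)" "p \<in> prefixes" "q \<in> suffixes" using kk by (metis mem_Times_iff prod.collapse)
      show ?thesis
        unfolding k(1) fst_conv snd_conv add_hom_group(1)[OF E_group M.abelian_group_axioms coord_hom[OF k(2,3)]]
        by (rule ep_zero(2)[OF prefixes_carrier[OF k(2)] suffixes_carrier[OF k(3)]])
    qed
    then have "(\<Oplus>\<^bsub>E\<^esub>k\<in>K'. ?term \<zero>\<^bsub>E\<^esub> k) = \<zero>\<^bsub>E\<^esub>" if "K' \<subseteq> prefixes \<times> suffixes" for K'
      using that by (intro E.add.finprod_one_eqI) blast
    then have "expands_on \<zero>\<^bsub>E\<^esub> {}" by (intro expands_onI) simp_all
    then show ?case ..
  next
    case (add t u)
    then obtain K L where K: "expands_on t K" and L: "expands_on u L" by blast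
    have "(\<Oplus>\<^bsub>E\<^esub>k\<in>K'. ?term (t \<oplus>\<^bsub>E\<^esub> u) k) = t \<oplus>\<^bsub>E\<^esub> u"
      if K': "finite K'" "K \<union> L \<subseteq> K'" "K' \<subseteq> prefixes \<times> suffixes" for K'
    proof -
      have "?term (t \<oplus>\<^bsub>E\<^esub> u) k = ?term t k \<oplus>\<^bsub>E\<^esub> ?term u k" if kk: "k \<in> K'" for k
      proof -
        obtain p q where k: "k = (p, q)" "p \<in> prefixes" "q \<in> suffixes" using kk K'(3) by (metis mem_Times_iff prod.collapse subsetD)
        show ?thesis
          using add(1,2) add_homD[OF coord_hom[OF k(2,3)]] prefixes_carrier[OF k(2)] suffixes_carrier[OF k(3)]
          by (simp add: k(1) ep_add(2))
      qed
      then have "(\<Oplus>\<^bsub>E\<^esub>k\<in>K'. ?term (t \<oplus>\<^bsub>E\<^esub> u) k) = (\<Oplus>\<^bsub>E\<^esub>k\<in>K'. ?term t k \<oplus>\<^bsub>E\<^esub> ?term u k)"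
        using closed[OF add(1)] closed[OF add(2)] subsetD[OF K'(3)]
        by (intro E.finsum_cong' refl Pi_I E.a_closed) blast+
      also have "\<dots> = (\<Oplus>\<^bsub>E\<^esub>k\<in>K'. ?term t k) \<oplus>\<^bsub>E\<^esub> (\<Oplus>\<^bsub>E\<^esub>k\<in>K'. ?term u k)"
        using closed[OF add(1)] closed[OF add(2)] subsetD[OF K'(3)] by (intro E.finsum_addf Pi_I) blast+
      also have "\<dots> = t \<oplus>\<^bsub>E\<^esub> u" using expands_onD(3)[OF K, of K'] expands_onD(3)[OF L, of K'] K' by simp
      finally show ?thesis .
    qed
    then have "expands_on (t \<oplus>\<^bsub>E\<^esub> u) (K \<union> L)"
      using expands_onD(1,2)[OF K] expands_onD(1,2)[OF L] by (intro expands_onI) simp_all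
    then show ?case ..
  next
    case (pure p m q)
    note A = prefixes_carrier[OF pure(1), of 1] suffixes_carrier[OF pure(2), of 1]
    let ?t = "ep (basis p) m (basis q)"
    have t: "?t \<in> carrier E" using A pure by simp
    have "(\<Oplus>\<^bsub>E\<^esub>k\<in>K'. ?term ?t k) = ?t"
      if K': "finite K'" "{(p, q)} \<subseteq> K'" "K' \<subseteq> prefixes \<times> suffixes" for K'
    proof -
      have tm: "?term ?t k = (if k = (p, q) then ?t else \<zero>\<^bsub>E\<^esub>)" if kk: "k \<in> K'" for k
      proof -
        obtain p' q' where k: "k = (p', q')" "p' \<in> prefixes" "q' \<in> suffixes" using kk K'(3) by (metis mem_Times_iff prod.collapse subsetD)
        note A' = prefixes_carrier[OF k(2), of 1] suffixes_carrier[OF k(3), of 1]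
        have c: "coord p' q' ?t = rsmult M (smult M (strip_prefix p' (basis p)) m) (strip_suffix q' (basis q))"
          by (rule coord_ep[OF k(2,3) A(1) pure(3) A(2)])
        show ?thesis
        proof (cases "p' = p \<and> q' = q")
          case True
          let ?e = "vertex_path (snd (snd p))" and ?f = "vertex_path (fst q)"
          have e: "?e \<in> carrier S" and f: "?f \<in> carrier S"
            using prefix_end(1)[OF pure(1)] suffix_start(1)[OF pure(2)] vertex_path_carrier by blast+
          have "?term ?t k = ep (basis p) (rsmult M (smult M ?e m) ?f) (basis q)"
            using True c by (simp add: k strip_prefix_prefix[OF pure(1,1)] strip_suffix_suffix[OF pure(2,2)])
          also have "\<dots> = ep (conc (basis p) ?e) m (conc ?f (basis q))"
            using ep_balanced(2)[OF A(1) M.lact_closed[OF e pure(3)] A(2) f]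
              ep_balanced(1)[OF A(1) pure(3) _ e, of "conc ?f (basis q)"] suffix_start(2)[OF pure(2)] A(2)
            by simp
          also have "\<dots> = ?t" using prefix_end(2)[OF pure(1)] suffix_start(2)[OF pure(2)] by simp
          finally show ?thesis using True k by simp
        next
          case False
          then have "coord p' q' ?t = \<zero>\<^bsub>M\<^esub>"
            unfolding c using strip_carrier[OF A(1), of p'] strip_carrier[OF A(2), of q'] pure(3)
            by (auto simp: strip_prefix_prefix[OF k(2) pure(1)] strip_suffix_suffix[OF k(3) pure(2)] act_zero
                M.lact_closed split: if_splits)
          then show ?thesis using False A' by (auto simp: k ep_zero)
        qed
      qed
      have "(\<Oplus>\<^bsub>E\<^esub>k\<in>K'. ?term ?t k) = (\<Oplus>\<^bsub>E\<^esub>k\<in>K'. if (p, q) = k then ?t else \<zero>\<^bsub>E\<^esub>)"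
        using tm t by (intro E.finsum_cong') auto
      also have "\<dots> = ?t"
        using E.add.finprod_singleton[of "(p, q)" K' "\<lambda>_. ?t"] K' t by simp
      finally show ?thesis .
    qed
    then have "expands_on ?t {(p, q)}" using pure(1,2) by (intro expands_onI) simp_all
    then show ?case ..
  }
qed

text \<open>A property of the coordinates of \<open>t\<close>, such as being cycles, restricts the middle factors that have to be
considered when something is proved for \<open>t\<close>.\<close>

lemma E_coord_induct [consumes 1, case_names coord zero add pure]:
  assumes t: "t \<in> carrier E" and coord: "\<And>p q. p \<in> prefixes \<Longrightarrow> q \<in> suffixes \<Longrightarrow> coord p q t \<in> N"
    and zero: "Q \<zero>\<^bsub>E\<^esub>"
    and add: "\<And>t u. t \<in> carrier E \<Longrightarrow> u \<in> carrier E \<Longrightarrow> Q t \<Longrightarrow> Q u \<Longrightarrow> Q (t \<oplus>\<^bsub>E\<^esub> u)"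
    and pure: "\<And>p m q. p \<in> prefixes \<Longrightarrow> q \<in> suffixes \<Longrightarrow> m \<in> carrier M \<Longrightarrow> m \<in> N \<Longrightarrow> Q (ep (basis p) m (basis q))"
  shows "Q t"
proof -
  let ?term = "\<lambda>k. ep (basis (fst k)) (coord (fst k) (snd k) t) (basis (snd k))"
  obtain K where "expands_on t K" using coord_expansion[OF t] by blast
  note K = expands_onD(1,2)[OF this] expands_onD(3)[OF this expands_onD(1)[OF this] order_refl expands_onD(2)[OF this]]
  have tm: "?term k \<in> carrier E" "Q (?term k)" if "k \<in> prefixes \<times> suffixes" for k
  proof -
    obtain p q where k: "k = (p, q)" "p \<in> prefixes" "q \<in> suffixes" using \<open>k \<in> prefixes \<times> suffixes\<close> by (metis mem_Times_iff prod.collapse)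
    have m: "coord p q t \<in> carrier M" by (rule add_homD(1)[OF coord_hom[OF k(2,3)] t])
    show "?term k \<in> carrier E" using m prefixes_carrier[OF k(2)] suffixes_carrier[OF k(3)] by (simp add: k(1))
    show "Q (?term k)" using pure[OF k(2,3) m coord[OF k(2,3)]] by (simp add: k(1))
  qed
  have "(\<Oplus>\<^bsub>E\<^esub>k\<in>K. ?term k) \<in> carrier E \<and> Q (\<Oplus>\<^bsub>E\<^esub>k\<in>K. ?term k)"
    using K(1,2)
  proof (induction K)
    case (insert k K)
    then have ik: "k \<in> prefixes \<times> suffixes" "K \<subseteq> prefixes \<times> suffixes" by auto
    have "(\<Oplus>\<^bsub>E\<^esub>k\<in>insert k K. ?term k) = ?term k \<oplus>\<^bsub>E\<^esub> (\<Oplus>\<^bsub>E\<^esub>k\<in>K. ?term k)"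
      using insert(1,2) tm(1) ik by (intro E.finsum_insert) auto
    then show ?case using insert.IH[OF ik(2)] tm[OF ik(1)] add by simp
  qed (simp add: zero)
  then show ?thesis using K(3) by simp
qed

lemma coord_eq_zero:
  assumes "t \<in> carrier E" and "\<And>p q. p \<in> prefixes \<Longrightarrow> q \<in> suffixes \<Longrightarrow> coord p q t = \<zero>\<^bsub>M\<^esub>"
  shows "t = \<zero>\<^bsub>E\<^esub>"
  using assms(1)
proof (induction rule: E_coord_induct[where N = "{\<zero>\<^bsub>M\<^esub>}"])
  case (pure p m q)
  then show ?case using ep_zero(2) prefixes_carrier suffixes_carrier by simp
qed (simp_all add: assms(2))

end

section \<open>Homology classes\<close>

lemma chain_group: "abelian_group (chain_bimodule R Z i)"
  by (rule additive_keys_abelian_group) (simp_all add: chain_bimodule_simps)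

lemma chain_minus:
  assumes "x \<in> carrier (chain_bimodule R Z i)" "y \<in> carrier (chain_bimodule R Z i)"
  shows "x \<ominus>\<^bsub>chain_bimodule R Z i\<^esub> y = x - y"
proof -
  have "\<ominus>\<^bsub>chain_bimodule R Z i\<^esub> y = - y"
    by (rule abelian_group.minus_equality[OF chain_group]) (use assms in \<open>auto simp: chain_bimodule_simps\<close>)
  then show ?thesis by (simp add: a_minus_def chain_bimodule_simps)
qed

lemma chain_coset_eq_iff:
  assumes "additive_subgroup N (chain_bimodule R Z i)"
    and "x \<in> carrier (chain_bimodule R Z i)" "y \<in> carrier (chain_bimodule R Z i)"
  shows "N +>\<^bsub>chain_bimodule R Z i\<^esub> x = N +>\<^bsub>chain_bimodule R Z i\<^esub> y \<longleftrightarrow> x - y \<in> N"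
  using coset_eq_iff[OF chain_group assms] chain_minus[OF assms(2,3)] by simp

lemma cycles_iff: "z \<in> cycles R Z i \<longleftrightarrow> z \<in> carrier (chain_bimodule R Z i) \<and> boundary Z z = 0"
  by (simp add: cycles_def a_kernel_def' chain_bimodule_simps)

lemma HM_eq:
  "HM R Z i = (quot_bimodule (chain_bimodule R Z i) (boundaries R Z i))\<lparr>carrier := HM_class R Z i ` cycles R Z i\<rparr>"
  by (simp add: HM_def homology_eq boundaries_def cycles_def HM_class_def[abs_def])

lemma HM_simps:
  "carrier (HM R Z i) = HM_class R Z i ` cycles R Z i"
  "zero (HM R Z i) = boundaries R Z i"
  "add (HM R Z i) = add (quot_bimodule (chain_bimodule R Z i) (boundaries R Z i))"
  "smult (HM R Z i) = smult (quot_bimodule (chain_bimodule R Z i) (boundaries R Z i))"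
  "rsmult (HM R Z i) = rsmult (quot_bimodule (chain_bimodule R Z i) (boundaries R Z i))"
  by (simp_all add: HM_eq quot_simps)

context
  fixes Z :: "'a precubical" and R :: "'r::field itself"
  assumes Z: "precubical_set Z" and fin: "finite (cells Z 0)"
begin

abbreviation (input) "AZ \<equiv> path_algebra R Z"
abbreviation (input) "CZ \<equiv> chain_bimodule R Z"

lemma CZ_biaction: "biaction AZ AZ (CZ i)"
  using chain_bimodule_bimodule[OF Z fin, of R i] by (simp add: bimodule_iff_biaction)

lemma boundaries_sub: "sub_biaction AZ AZ (CZ i) (boundaries R Z i)"
  unfolding boundaries_def
  using image_sub_biaction[OF CZ_biaction CZ_biaction boundary_bimodule_hom[OF Z] carrier_sub_biaction[OF CZ_biaction]]
  by simp

lemma boundaries_subgroup: "additive_subgroup (boundaries R Z i) (CZ i)"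
  using boundaries_sub by (simp add: sub_biaction_def)

lemma cycles_sub: "sub_biaction AZ AZ (CZ (Suc j)) (cycles R Z (Suc j))"
  unfolding cycles_def using kernel_sub_biaction[OF CZ_biaction CZ_biaction boundary_bimodule_hom[OF Z]] by simp

lemma cycles_subgroup: "additive_subgroup (cycles R Z (Suc j)) (CZ (Suc j))"
  using cycles_sub by (simp add: sub_biaction_def)

lemma HM_bimodule: "bimodule AZ AZ (HM R Z (Suc j))"
  unfolding HM_def
  using homology_bimodule[OF chain_bimodule_bimodule[OF Z fin] chain_bimodule_bimodule[OF Z fin]
      chain_bimodule_bimodule[OF Z fin] boundary_bimodule_hom[OF Z] boundary_bimodule_hom[OF Z]]
  by simp

lemma HM_class_eq_iff:
  "x \<in> carrier (CZ i) \<Longrightarrow> y \<in> carrier (CZ i) \<Longrightarrow> HM_class R Z i x = HM_class R Z i y \<longleftrightarrow> x - y \<in> boundaries R Z i"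
  unfolding HM_class_def by (rule chain_coset_eq_iff[OF boundaries_subgroup])

lemma HM_class_eq_zero_iff: "x \<in> carrier (CZ i) \<Longrightarrow> HM_class R Z i x = \<zero>\<^bsub>HM R Z i\<^esub> \<longleftrightarrow> x \<in> boundaries R Z i"
  unfolding HM_class_def HM_simps by (rule coset_zero(2)[OF chain_group boundaries_subgroup])

lemma HM_class_add:
  "x \<in> carrier (CZ i) \<Longrightarrow> y \<in> carrier (CZ i) \<Longrightarrow>
    HM_class R Z i x \<oplus>\<^bsub>HM R Z i\<^esub> HM_class R Z i y = HM_class R Z i (x + y)"
  using quot_add[OF chain_group boundaries_subgroup] by (simp add: HM_simps HM_class_def chain_bimodule_simps)

lemma HM_class_act:
  assumes "x \<in> carrier (CZ i)" "a \<in> carrier AZ"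
  shows "smult (HM R Z i) a (HM_class R Z i x) = HM_class R Z i (conc a x)"
    and "rsmult (HM R Z i) (HM_class R Z i x) a = HM_class R Z i (conc x a)"
  using quot_act[OF CZ_biaction boundaries_sub assms(1)] assms(2)
  by (simp_all add: HM_simps HM_class_def chain_bimodule_simps)

end

section \<open>Bimodule maps out of an extension of scalars\<close>

context ext_module
begin

lemma ext_hom:
  assumes P: "bimodule A A P" and \<iota>: "\<iota> \<in> bimodule_hom S S M P"
  shows ext_hom_bimodule_hom: "ext_hom P \<iota> \<in> bimodule_hom A A E P"
    and ext_hom_ep: "p \<in> carrier A \<Longrightarrow> m \<in> carrier M \<Longrightarrow> q \<in> carrier A \<Longrightarrow>
      ext_hom P \<iota> (ep p m q) = rsmult P (smult P p (\<iota> m)) q"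
proof -
  interpret P: bimodule A A P by (rule P)
  note \<iota>D = bimodule_homD[OF \<iota>]
  have P_biaction: "biaction A A P" using P by (simp add: bimodule_iff_biaction)
  have add: "smult P (a + a') x = smult P a x \<oplus>\<^bsub>P\<^esub> smult P a' x"
    "rsmult P x (a + a') = rsmult P x a \<oplus>\<^bsub>P\<^esub> rsmult P x a'"
    "smult P (conc a a') x = smult P a (smult P a' x)"
    "rsmult P x (conc a a') = rsmult P (rsmult P x a) a'"
    if "a \<in> carrier A" "a' \<in> carrier A" "x \<in> carrier P" for a a' x
    using P.add_lact[OF that] P.add_ract[OF that(3,1,2)] P.lact_assoc[OF that] P.ract_assoc[OF that(3,1,2)]
    by (simp_all add: path_algebra_simps(2,5))
  note L = ext_lift[where P = P and f = "\<lambda>p m. smult P p (\<iota> m)" and g = "rsmult P",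
      OF P.abelian_group_axioms, folded ext_hom_def]
  have hom: "ext_hom P \<iota> \<in> add_hom E P"
    by (rule L(1)) (simp_all add: add P.lact_closed P.ract_closed P.lact_add P.ract_add P.lact_ract \<iota>D S_in_A)
  show ep: "ext_hom P \<iota> (ep p m q) = rsmult P (smult P p (\<iota> m)) q"
    if "p \<in> carrier A" "m \<in> carrier M" "q \<in> carrier A" for p m q
    by (rule L(2)) (simp_all add: add P.lact_closed P.ract_closed P.lact_add P.ract_add P.lact_ract \<iota>D S_in_A that)
  have E_biaction: "biaction A A E" using E_bimodule by (simp add: bimodule_iff_biaction)
  have conc_cl: "conc a p \<in> carrier A" if "a \<in> carrier A" "p \<in> carrier A" for a p
    using ring.ring_simprules(5)[OF A_ring that] by (simp add: path_algebra_simps)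
  have "ext_hom P \<iota> (smult E a t) = smult P a (ext_hom P \<iota> t)" if a: "a \<in> carrier A" and t: "t \<in> carrier E" for a t
    by (rule E_hom_eq[OF P.abelian_group_axioms add_hom_comp[OF lact_hom[OF E_biaction a] hom]
          add_hom_comp[OF hom lact_hom[OF P_biaction a]] _ t])
      (simp add: ep_act a ep conc_cl add P.lact_closed P.ract_closed P.lact_ract \<iota>D)
  moreover have "ext_hom P \<iota> (rsmult E t a) = rsmult P (ext_hom P \<iota> t) a" if a: "a \<in> carrier A" and t: "t \<in> carrier E" for a t
    by (rule E_hom_eq[OF P.abelian_group_axioms add_hom_comp[OF ract_hom[OF E_biaction a] hom]
          add_hom_comp[OF hom ract_hom[OF P_biaction a]] _ t])
      (simp add: ep_act a ep conc_cl add P.lact_closed P.ract_closed P.lact_ract \<iota>D)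
  ultimately show "ext_hom P \<iota> \<in> bimodule_hom A A E P"
    using hom by (simp add: bimodule_hom_def)
qed

end

section \<open>The subcomplex generated by the chains of the subset\<close>

context precubical_pair
begin

abbreviation "Sub \<equiv> rel_sub R X Y"
abbreviation "EC i \<equiv> ext_scalars R X Y (CY i)"
abbreviation "ecp i \<equiv> ext_pure R X Y (CY i)"
abbreviation "incl i \<equiv> ext_incl R X i :: ('a, 'r, ('a, 'r) chains) ext \<Rightarrow> _"
abbreviation "crd i \<equiv> ext_module.coord Y (CY i)"

lemma EC: "ext_module X Y R (CY i)"
  by (intro ext_module.intro ext_module_axioms.intro precubical_pair_axioms CY_bimodule)

lemma CY_in_C: "m \<in> carrier (CY i) \<Longrightarrow> m \<in> carrier (C i)"
  using Ch_sub[OF X sub, of "i - 1"] by (auto simp: chain_bimodule_simps deg_chains_def split: if_splits)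

lemma boundary_Y: "m \<in> carrier (CY i) \<Longrightarrow> boundary Y m = boundary X m"
  using boundary_sub[OF sub, of m "i - 1"]
  by (cases "i = 0") (auto simp: chain_bimodule_simps deg_chains_def keys_eq_empty boundary_rlinear)

lemma boundary_in_C: "x \<in> carrier (C (Suc i)) \<Longrightarrow> boundary X x \<in> carrier (C i)"
  using boundary_deg[OF X] by (simp add: chain_bimodule_simps)

lemma boundary_in_CY: "m \<in> carrier (CY (Suc i)) \<Longrightarrow> boundary X m \<in> carrier (CY i)"
  using boundary_deg[OF Y(1), of m i] boundary_Y[of m "Suc i"] by (simp add: chain_bimodule_simps)

lemma boundary_bimodule:
  assumes "p \<in> carrier A" "x \<in> carrier (C i)" "q \<in> carrier A"
  shows "boundary X (conc (conc p x) q) = conc (conc p (boundary X x)) q"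
proof (cases i)
  case 0
  then show ?thesis using assms(2) carrier_chain_bimodule_0[of R X] by (simp add: conc_left conc_right boundary_rlinear)
next
  case (Suc j)
  have p: "Poly_Mapping.keys p \<subseteq> Ch X 0" and x: "Poly_Mapping.keys x \<subseteq> Ch X j" and q: "Poly_Mapping.keys q \<subseteq> Ch X 0"
    using assms Suc by (simp_all add: path_algebra_simps chain_bimodule_simps deg_chains_def)
  have px: "Poly_Mapping.keys (conc p x) \<subseteq> Ch X j" using conc_keys[OF X p x] by simp
  show ?thesis by (simp add: boundary_conc_path_right[OF X px q] boundary_conc_path_left[OF X p])
qed

lemma inclusion_hom: "(\<lambda>c. c) \<in> bimodule_hom S S (CY i) (C i)"
proof -
  have "(\<lambda>c. c) \<in> add_hom (CY i) (C i)"
    by (rule add_homI) (simp_all add: CY_in_C chain_bimodule_simps(3))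
  then show ?thesis by (simp add: bimodule_hom_def chain_bimodule_simps(4,5))
qed

lemma incl_hom: "incl i \<in> bimodule_hom A A (EC i) (C i)"
  unfolding ext_incl_def by (rule ext_module.ext_hom_bimodule_hom[OF EC C_bimodule inclusion_hom])

lemma incl_ecp:
  "p \<in> carrier A \<Longrightarrow> m \<in> carrier (CY i) \<Longrightarrow> q \<in> carrier A \<Longrightarrow> incl i (ecp i p m q) = conc (conc p m) q"
  unfolding ext_incl_def
  using ext_module.ext_hom_ep[OF EC C_bimodule inclusion_hom, of p m i q] by (simp add: chain_bimodule_simps)

lemma EC_biaction: "biaction A A (EC i)"
  using ext_module.E_bimodule[OF EC, of i] by (simp add: bimodule_iff_biaction)

lemma Sub_sub: "sub_biaction A A (C i) (Sub i)"
  unfolding rel_sub_def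
  by (rule image_sub_biaction[OF EC_biaction C_biaction(1) incl_hom carrier_sub_biaction[OF EC_biaction]])

lemma Sub_subgroup: "additive_subgroup (Sub i) (C i)"
  using Sub_sub by (simp add: sub_biaction_def)

lemma Sub_mem:
  "s \<in> Sub i \<Longrightarrow> s \<in> carrier (C i)" "0 \<in> Sub i" "s \<in> Sub i \<Longrightarrow> t \<in> Sub i \<Longrightarrow> s + t \<in> Sub i"
  using additive_subgroup_mem(1-3)[OF Sub_subgroup[of i]] by (simp_all add: chain_bimodule_simps(2,3))

lemma conc_in_Sub:
  assumes "p \<in> carrier A" "m \<in> carrier (CY i)" "q \<in> carrier A"
  shows "conc (conc p m) q \<in> Sub i"
  unfolding rel_sub_def incl_ecp[OF assms, symmetric]
  by (rule imageI) (rule ext_module.ep_closed[OF EC assms])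

lemma CY_in_Sub: "m \<in> carrier (CY i) \<Longrightarrow> m \<in> Sub i"
proof -
  assume m: "m \<in> carrier (CY i)"
  interpret C: bimodule A A "C i" by (rule C_bimodule)
  have "conc (conc \<one>\<^bsub>A\<^esub> m) \<one>\<^bsub>A\<^esub> = m"
    using C.one_lact[OF CY_in_C[OF m]] C.ract_one[OF CY_in_C[OF m]] by (simp add: chain_bimodule_simps)
  moreover have "\<one>\<^bsub>A\<^esub> \<in> carrier A" using ring.ring_simprules(6)[OF A_ring] .
  ultimately show "m \<in> Sub i" using conc_in_Sub[OF _ m, of "\<one>\<^bsub>A\<^esub>" "\<one>\<^bsub>A\<^esub>"] by simp
qed

lemma crd_ecp:
  assumes "p0 \<in> prefixes" "q0 \<in> suffixes" "p \<in> carrier A" "m \<in> carrier (CY i)" "q \<in> carrier A"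
  shows "crd i p0 q0 (ecp i p m q) = conc (conc (strip_prefix p0 p) m) (strip_suffix q0 q)"
  using ext_module.coord_ep[OF EC assms] by (simp add: chain_bimodule_simps)

lemma crd_hom: "p0 \<in> prefixes \<Longrightarrow> q0 \<in> suffixes \<Longrightarrow> crd i p0 q0 \<in> add_hom (EC i) (CY i)"
  by (rule ext_module.coord_hom[OF EC])

text \<open>The element \<open>u\<close> arises from \<open>t\<close> by applying the boundary to the middle factors. Boundary and coordinates
commute because the boundary is linear over directed paths.\<close>

lemma boundary_lift:
  assumes "t \<in> carrier (EC (Suc i))"
  shows "\<exists>u\<in>carrier (EC i). incl i u = boundary X (incl (Suc i) t) \<and>
    (\<forall>p\<in>prefixes. \<forall>q\<in>suffixes. crd i p q u = boundary X (crd (Suc i) p q t))"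
  using assms
proof (induction rule: ext_module.E_induct[OF EC, consumes 1, case_names zero add pure])
  case zero
  have g: "abelian_group (EC i)" for i by (rule ext_module.E_group[OF EC])
  have "incl i \<zero>\<^bsub>EC i\<^esub> = 0" for i
    using add_hom_group(1)[OF g chain_group bimodule_homD(1)[OF incl_hom]] by (simp add: chain_bimodule_simps)
  moreover have "crd i p q \<zero>\<^bsub>EC i\<^esub> = 0" if "p \<in> prefixes" "q \<in> suffixes" for i p q
    using add_hom_group(1)[OF g chain_group crd_hom[OF that]] by (simp add: chain_bimodule_simps)
  moreover have "\<zero>\<^bsub>EC i\<^esub> \<in> carrier (EC i)" using abelian_groupE(2)[OF g] .
  ultimately show ?case by (intro bexI[of _ "\<zero>\<^bsub>EC i\<^esub>"]) (auto simp: boundary_rlinear)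
next
  case (add t t')
  then obtain u u' where u: "u \<in> carrier (EC i)" "incl i u = boundary X (incl (Suc i) t)"
      "\<And>p q. p \<in> prefixes \<Longrightarrow> q \<in> suffixes \<Longrightarrow> crd i p q u = boundary X (crd (Suc i) p q t)"
    and u': "u' \<in> carrier (EC i)" "incl i u' = boundary X (incl (Suc i) t')"
      "\<And>p q. p \<in> prefixes \<Longrightarrow> q \<in> suffixes \<Longrightarrow> crd i p q u' = boundary X (crd (Suc i) p q t')"
    by blast
  have cl: "u \<oplus>\<^bsub>EC i\<^esub> u' \<in> carrier (EC i)"
    using abelian_groupE(1)[OF ext_module.E_group[OF EC] u(1) u'(1)] .
  have "incl i (u \<oplus>\<^bsub>EC i\<^esub> u') = boundary X (incl (Suc i) (t \<oplus>\<^bsub>EC (Suc i)\<^esub> t'))"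
    unfolding bimodule_homD(5)[OF incl_hom u(1) u'(1)] bimodule_homD(5)[OF incl_hom add(1,2)]
      chain_bimodule_simps(3) boundary_rlinear(1) u(2) u'(2) ..
  moreover have "crd i p q (u \<oplus>\<^bsub>EC i\<^esub> u') = boundary X (crd (Suc i) p q (t \<oplus>\<^bsub>EC (Suc i)\<^esub> t'))"
    if "p \<in> prefixes" "q \<in> suffixes" for p q
    unfolding add_homD(2)[OF crd_hom[OF that] u(1) u'(1)] add_homD(2)[OF crd_hom[OF that] add(1,2)]
      chain_bimodule_simps(3) boundary_rlinear(1) u(3)[OF that] u'(3)[OF that] ..
  ultimately show ?case using cl by blast
next
  case (pure p m q)
  have m': "boundary X m \<in> carrier (CY i)" using boundary_in_CY[OF pure(2)] .
  have "incl i (ecp i p (boundary X m) q) = boundary X (incl (Suc i) (ecp (Suc i) p m q))"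
    using boundary_bimodule[OF pure(1) CY_in_C[OF pure(2)] pure(3)]
    by (simp add: incl_ecp[OF pure] incl_ecp[OF pure(1) m' pure(3)])
  moreover have "crd i p0 q0 (ecp i p (boundary X m) q) = boundary X (crd (Suc i) p0 q0 (ecp (Suc i) p m q))"
    if "p0 \<in> prefixes" "q0 \<in> suffixes" for p0 q0
    using boundary_bimodule[OF S_in_A[OF strip_carrier(1)[OF pure(1)]] CY_in_C[OF pure(2)] S_in_A[OF strip_carrier(2)[OF pure(3)]]]
    by (simp add: crd_ecp[OF that pure] crd_ecp[OF that pure(1) m' pure(3)])
  moreover have "ecp i p (boundary X m) q \<in> carrier (EC i)"
    by (rule ext_module.ep_closed[OF EC pure(1) m' pure(3)])
  ultimately show ?case by (intro bexI[of _ "ecp i p (boundary X m) q"]) simp_all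
qed

lemma boundary_Sub:
  assumes "s \<in> Sub (Suc i)"
  shows "boundary X s \<in> Sub i"
proof -
  obtain t where t: "t \<in> carrier (EC (Suc i))" "s = incl (Suc i) t" using assms by (auto simp: rel_sub_def)
  obtain u where "u \<in> carrier (EC i)" "incl i u = boundary X s" using boundary_lift[OF t(1)] t(2) by blast
  then show ?thesis unfolding rel_sub_def by (metis imageI)
qed

end

section \<open>Relative homology classes\<close>

context precubical_pair
begin

abbreviation "Rel \<equiv> rel_chain_bimodule R X Y"
abbreviation "rc i x \<equiv> Sub i +>\<^bsub>C i\<^esub> x"
abbreviation "rel_class \<equiv> HM_rel_class R X Y"

lemma Rel_bimodule: "bimodule A A (Rel i)"
  unfolding rel_chain_bimodule_def by (rule quot_bimodule_bimodule[OF C_bimodule Sub_sub])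

lemma Rel_biaction: "biaction A A (Rel i)"
  using Rel_bimodule by (simp add: bimodule_iff_biaction)

lemma Rel_group: "abelian_group (Rel i)"
  unfolding rel_chain_bimodule_def by (rule quot_abelian_group[OF chain_group Sub_subgroup])

lemma rc_bimodule_hom: "(\<lambda>x. rc i x) \<in> bimodule_hom A A (C i) (Rel i)"
  unfolding rel_chain_bimodule_def by (rule coset_bimodule_hom[OF C_biaction(1) Sub_sub])

lemmas rc_hom = bimodule_homD[OF rc_bimodule_hom]

lemma Rel_carrier: "carrier (Rel i) = (\<lambda>x. rc i x) ` carrier (C i)"
  unfolding rel_chain_bimodule_def by (rule quot_carrier)

lemma rc_eq_iff: "x \<in> carrier (C i) \<Longrightarrow> y \<in> carrier (C i) \<Longrightarrow> rc i x = rc i y \<longleftrightarrow> x - y \<in> Sub i"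
  by (rule chain_coset_eq_iff[OF Sub_subgroup])

lemma rc_eq_zero_iff: "x \<in> carrier (C i) \<Longrightarrow> rc i x = \<zero>\<^bsub>Rel i\<^esub> \<longleftrightarrow> x \<in> Sub i"
  unfolding rel_chain_bimodule_def quot_simps by (rule coset_zero(2)[OF chain_group Sub_subgroup])

lemma rel_boundary_hom: "rel_boundary R X Y i \<in> bimodule_hom A A (Rel (Suc i)) (Rel i)"
  unfolding rel_boundary_def rel_chain_bimodule_def
  by (rule quot_map_bimodule_hom[OF C_biaction(1) Sub_sub C_biaction(1) Sub_sub boundary_bimodule_hom[OF X] boundary_Sub])

lemma rel_boundary_rc: "x \<in> carrier (C (Suc i)) \<Longrightarrow> rel_boundary R X Y i (rc (Suc i) x) = rc i (boundary X x)"
  unfolding rel_boundary_def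
  by (rule quot_map_coset[OF chain_group Sub_subgroup chain_group Sub_subgroup
        bimodule_homD(1)[OF boundary_bimodule_hom[OF X]] boundary_Sub])

lemma rel_boundaries_eq: "rel_boundaries R X Y i = (\<lambda>c. rc i (boundary X c)) ` carrier (C (Suc i))"
  unfolding rel_boundaries_def Suc_eq_plus1[symmetric] Rel_carrier image_image
  by (rule image_cong[OF refl]) (rule rel_boundary_rc)

lemma rel_boundaries_sub: "sub_biaction A A (Rel i) (rel_boundaries R X Y i)"
  unfolding rel_boundaries_def Suc_eq_plus1[symmetric]
  by (rule image_sub_biaction[OF Rel_biaction Rel_biaction rel_boundary_hom carrier_sub_biaction[OF Rel_biaction]])

lemma rel_boundaries_subgroup: "additive_subgroup (rel_boundaries R X Y i) (Rel i)"
  using rel_boundaries_sub by (simp add: sub_biaction_def)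

text \<open>Representatives in \<open>R_i[X]\<close> of the cycles of the quotient complex.\<close>

definition rel_cycles :: "nat \<Rightarrow> ('a, 'r) chains set" where
  "rel_cycles i = {x \<in> carrier (C i). boundary X x \<in> Sub (i - 1)}"

lemma rel_kernel: "a_kernel (Rel (Suc j)) (Rel j) (rel_boundary R X Y j) = (\<lambda>x. rc (Suc j) x) ` rel_cycles (Suc j)"
proof -
  have "rel_boundary R X Y j (rc (Suc j) x) = \<zero>\<^bsub>Rel j\<^esub> \<longleftrightarrow> x \<in> rel_cycles (Suc j)" if "x \<in> carrier (C (Suc j))" for x
    using that by (simp add: rel_boundary_rc rc_eq_zero_iff boundary_in_C rel_cycles_def)
  then show ?thesis by (auto simp: a_kernel_def' Rel_carrier) (auto simp: rel_cycles_def)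
qed

lemma HM_rel_eq: "HM_rel R X Y (Suc j) =
  (quot_bimodule (Rel (Suc j)) (rel_boundaries R X Y (Suc j)))\<lparr>carrier := rel_class (Suc j) ` rel_cycles (Suc j)\<rparr>"
  unfolding HM_rel_def homology_eq rel_boundaries_def[symmetric] diff_Suc_1 rel_kernel image_image HM_rel_class_def ..

lemma HM_rel_simps:
  "carrier (HM_rel R X Y (Suc j)) = rel_class (Suc j) ` rel_cycles (Suc j)"
  "zero (HM_rel R X Y (Suc j)) = rel_boundaries R X Y (Suc j)"
  "add (HM_rel R X Y (Suc j)) = add (quot_bimodule (Rel (Suc j)) (rel_boundaries R X Y (Suc j)))"
  "smult (HM_rel R X Y (Suc j)) = smult (quot_bimodule (Rel (Suc j)) (rel_boundaries R X Y (Suc j)))"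
  "rsmult (HM_rel R X Y (Suc j)) = rsmult (quot_bimodule (Rel (Suc j)) (rel_boundaries R X Y (Suc j)))"
  by (simp_all add: HM_rel_eq quot_simps)

lemma HM_rel_bimodule: "bimodule A A (HM_rel R X Y (Suc j))"
  unfolding HM_rel_def diff_Suc_1 Suc_eq_plus1[symmetric]
  by (rule homology_bimodule[OF Rel_bimodule Rel_bimodule Rel_bimodule rel_boundary_hom rel_boundary_hom])

lemma rel_class_eq_iff:
  assumes "x \<in> carrier (C i)" "y \<in> carrier (C i)"
  shows "rel_class i x = rel_class i y \<longleftrightarrow> (\<exists>c\<in>carrier (C (Suc i)). x - y - boundary X c \<in> Sub i)"
proof -
  have xy: "x - y \<in> carrier (C i)"
    using assms keys_diff[of x y] by (auto simp: chain_bimodule_simps)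
  have "rel_class i x = rel_class i y \<longleftrightarrow> rc i x \<ominus>\<^bsub>Rel i\<^esub> rc i y \<in> rel_boundaries R X Y i"
    unfolding HM_rel_class_def by (rule coset_eq_iff[OF Rel_group rel_boundaries_subgroup rc_hom(4)[OF assms(1)] rc_hom(4)[OF assms(2)]])
  also have "rc i x \<ominus>\<^bsub>Rel i\<^esub> rc i y = rc i (x - y)"
    using add_hom_group(3)[OF chain_group Rel_group rc_hom(1) assms] chain_minus[OF assms] by simp
  also have "rc i (x - y) \<in> rel_boundaries R X Y i \<longleftrightarrow> (\<exists>c\<in>carrier (C (Suc i)). rc i (x - y) = rc i (boundary X c))"
    unfolding rel_boundaries_eq by blast
  also have "\<dots> \<longleftrightarrow> (\<exists>c\<in>carrier (C (Suc i)). x - y - boundary X c \<in> Sub i)"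
    using rc_eq_iff[OF xy boundary_in_C] by blast
  finally show ?thesis .
qed

lemma rel_class_zero: "\<zero>\<^bsub>HM_rel R X Y (Suc j)\<^esub> = rel_class (Suc j) 0"
proof -
  have "rc (Suc j) 0 = \<zero>\<^bsub>Rel (Suc j)\<^esub>"
    using rc_eq_zero_iff[of 0 "Suc j"] Sub_mem(2) by (simp add: chain_bimodule_simps)
  then show ?thesis
    using coset_zero(1)[OF Rel_group rel_boundaries_subgroup] by (simp add: HM_rel_simps HM_rel_class_def)
qed

lemma rel_class_add:
  assumes "x \<in> carrier (C (Suc j))" "y \<in> carrier (C (Suc j))"
  shows "rel_class (Suc j) x \<oplus>\<^bsub>HM_rel R X Y (Suc j)\<^esub> rel_class (Suc j) y = rel_class (Suc j) (x + y)"
  unfolding HM_rel_class_def HM_rel_simps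
    quot_add[OF Rel_group rel_boundaries_subgroup rc_hom(4)[OF assms(1)] rc_hom(4)[OF assms(2)]]
    rc_hom(5)[OF assms, symmetric] chain_bimodule_simps(3) ..

lemma rel_class_act:
  assumes "x \<in> carrier (C (Suc j))" "a \<in> carrier A"
  shows "smult (HM_rel R X Y (Suc j)) a (rel_class (Suc j) x) = rel_class (Suc j) (conc a x)"
    and "rsmult (HM_rel R X Y (Suc j)) (rel_class (Suc j) x) a = rel_class (Suc j) (conc x a)"
  unfolding HM_rel_class_def HM_rel_simps quot_act(1)[OF Rel_biaction rel_boundaries_sub rc_hom(4)[OF assms(1)] assms(2)]
    quot_act(2)[OF Rel_biaction rel_boundaries_sub rc_hom(4)[OF assms(1)] assms(2)]
    rc_hom(2)[OF assms(2,1), symmetric] rc_hom(3)[OF assms, symmetric] chain_bimodule_simps(4,5)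
  by (rule refl)+

lemma cycles_rel_cycles: "cycles R X (Suc j) \<subseteq> rel_cycles (Suc j)"
  by (auto simp: cycles_iff rel_cycles_def Sub_mem(2))

lemma HM_proj_class: "z \<in> carrier (C i) \<Longrightarrow> HM_proj R X Y i (HM_class R X i z) = rel_class i z"
  unfolding HM_proj_def HM_class_def HM_rel_class_def
  by (rule quot_map_coset[OF chain_group boundaries_subgroup[OF X finite_vertices] Rel_group rel_boundaries_subgroup rc_hom(1)])
    (auto simp: rel_boundaries_eq boundaries_def)

lemma HM_proj_hom: "HM_proj R X Y (Suc j) \<in> bimodule_hom A A (HM R X (Suc j)) (HM_rel R X Y (Suc j))"
  unfolding HM_eq HM_rel_eq
proof (rule restrict_bimodule_hom)
  show "HM_proj R X Y (Suc j) \<in> bimodule_hom A A (quot_bimodule (C (Suc j)) (boundaries R X (Suc j)))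
      (quot_bimodule (Rel (Suc j)) (rel_boundaries R X Y (Suc j)))"
    unfolding HM_proj_def
    by (rule quot_map_bimodule_hom[OF C_biaction(1) boundaries_sub[OF X finite_vertices] Rel_biaction rel_boundaries_sub rc_bimodule_hom])
      (auto simp: rel_boundaries_eq boundaries_def)
  show "HM_class R X (Suc j) ` cycles R X (Suc j) \<subseteq> carrier (quot_bimodule (C (Suc j)) (boundaries R X (Suc j)))"
    by (auto simp: quot_carrier HM_class_def cycles_iff)
  have "HM_proj R X Y (Suc j) (HM_class R X (Suc j) z) \<in> rel_class (Suc j) ` rel_cycles (Suc j)"
    if "z \<in> cycles R X (Suc j)" for z
    using HM_proj_class[of z "Suc j"] that subsetD[OF cycles_rel_cycles that] by (simp add: cycles_iff)
  then show "HM_proj R X Y (Suc j) ` HM_class R X (Suc j) ` cycles R X (Suc j) \<subseteq> rel_class (Suc j) ` rel_cycles (Suc j)"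
    by blast
qed

section \<open>The comparison with the homology of the subcomplex\<close>

abbreviation "Bd i \<equiv> boundary X ` Sub (Suc i)"
abbreviation "P i \<equiv> quot_bimodule (C i) (Bd i)"
abbreviation "cls i x \<equiv> Bd i +>\<^bsub>C i\<^esub> x"
abbreviation "EH i \<equiv> ext_scalars R X Y (HM R Y i)"
abbreviation "ehp i \<equiv> ext_pure R X Y (HM R Y i)"

text \<open>The map \<open>p \<otimes> [z] \<otimes> q \<mapsto> [p z q]\<close>. Its target is the quotient of all of \<open>R_i[X]\<close> by the boundaries of
the subcomplex, which contains the homology of the subcomplex and lets any chain represent a class.\<close>

definition comparison :: "nat \<Rightarrow> ('a, 'r, ('a, 'r) chains set) ext \<Rightarrow> ('a, 'r) chains set" where
  "comparison i = ext_hom (P i) (quot_map (C i) (Bd i) (\<lambda>z. z))"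

lemma Bd_sub: "sub_biaction A A (C i) (Bd i)"
  by (rule image_sub_biaction[OF C_biaction(1) C_biaction(1) boundary_bimodule_hom[OF X] Sub_sub])

lemma Bd_subgroup: "additive_subgroup (Bd i) (C i)"
  using Bd_sub by (simp add: sub_biaction_def)

lemma P_bimodule: "bimodule A A (P i)"
  by (rule quot_bimodule_bimodule[OF C_bimodule Bd_sub])

lemma P_group: "abelian_group (P i)"
  by (rule quot_abelian_group[OF chain_group Bd_subgroup])

lemma cls_eq_iff: "x \<in> carrier (C i) \<Longrightarrow> y \<in> carrier (C i) \<Longrightarrow> cls i x = cls i y \<longleftrightarrow> x - y \<in> Bd i"
  by (rule chain_coset_eq_iff[OF Bd_subgroup])

lemma cls_add: "x \<in> carrier (C i) \<Longrightarrow> y \<in> carrier (C i) \<Longrightarrow> cls i x \<oplus>\<^bsub>P i\<^esub> cls i y = cls i (x + y)"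
  using quot_add[OF chain_group Bd_subgroup] by (simp add: chain_bimodule_simps)

lemma cls_zero: "\<zero>\<^bsub>P i\<^esub> = cls i 0"
  using coset_zero(1)[OF chain_group Bd_subgroup, of i] by (simp add: quot_simps chain_bimodule_simps)

lemma cls_act:
  assumes "x \<in> carrier (C i)" "a \<in> carrier A"
  shows "smult (P i) a (cls i x) = cls i (conc a x)" "rsmult (P i) (cls i x) a = cls i (conc x a)"
  using quot_act[OF C_biaction(1) Bd_sub assms(1)] assms(2) by (simp_all add: chain_bimodule_simps)

lemma boundaries_Y_subset: "boundaries R Y i \<subseteq> Bd i" "boundaries R Y i \<subseteq> boundaries R X i"
proof -
  have "boundary Y c = boundary X c \<and> c \<in> Sub (Suc i) \<and> c \<in> carrier (C (Suc i))" if "c \<in> carrier (CY (Suc i))" for c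
    using that boundary_Y CY_in_Sub CY_in_C by blast
  then show "boundaries R Y i \<subseteq> Bd i" "boundaries R Y i \<subseteq> boundaries R X i"
    unfolding boundaries_def Suc_eq_plus1[symmetric] by auto
qed

lemma Bd_subset: "Bd i \<subseteq> boundaries R X i"
  unfolding boundaries_def using Sub_mem(1) by auto

lemma sub_biaction_S: "sub_biaction A A N K \<Longrightarrow> sub_biaction S S N K"
  by (auto simp: sub_biaction_def S_in_A)

lemma HMY_carrier_subset: "HM_class R Y i ` cycles R Y i \<subseteq> carrier (quot_bimodule (CY i) (boundaries R Y i))"
  by (auto simp: quot_carrier HM_class_def cycles_iff)

lemma CY_biaction: "biaction S S (CY i)"
  using CY_bimodule by (simp add: bimodule_iff_biaction)

lemma class_map_hom: "quot_map (C i) (Bd i) (\<lambda>z. z) \<in> bimodule_hom S S (HM R Y i) (P i)"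
proof -
  have h: "quot_map (C i) (Bd i) (\<lambda>z. z) \<in> bimodule_hom S S (quot_bimodule (CY i) (boundaries R Y i)) (P i)"
    by (rule quot_map_bimodule_hom[OF CY_biaction boundaries_sub[OF Y] C_biaction(4) sub_biaction_S[OF Bd_sub] inclusion_hom])
      (use boundaries_Y_subset in blast)
  have "quot_map (C i) (Bd i) (\<lambda>z. z) \<in> bimodule_hom S S (HM R Y i) ((P i)\<lparr>carrier := carrier (P i)\<rparr>)"
    unfolding HM_eq
    by (rule restrict_bimodule_hom[OF h HMY_carrier_subset]) (use bimodule_homD(4)[OF h] HMY_carrier_subset in blast)
  then show ?thesis by simp
qed

lemma class_map: "z \<in> carrier (CY i) \<Longrightarrow> quot_map (C i) (Bd i) (\<lambda>z. z) (HM_class R Y i z) = cls i z"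
  unfolding HM_class_def
  by (rule quot_map_coset[OF chain_group boundaries_subgroup[OF Y] chain_group Bd_subgroup bimodule_homD(1)[OF inclusion_hom]])
    (use boundaries_Y_subset in blast)

lemma class_map_X: "z \<in> carrier (CY i) \<Longrightarrow> quot_map (C i) (boundaries R X i) (\<lambda>z. z) (HM_class R Y i z) = HM_class R X i z"
  unfolding HM_class_def
  by (rule quot_map_coset[OF chain_group boundaries_subgroup[OF Y] chain_group boundaries_subgroup[OF X finite_vertices]
        bimodule_homD(1)[OF inclusion_hom]])
    (use boundaries_Y_subset in blast)

lemma cycles_Y_subset: "cycles R Y i \<subseteq> cycles R X i"
  using boundary_Y CY_in_C by (auto simp: cycles_iff)

lemma class_map_X_hom: "quot_map (C i) (boundaries R X i) (\<lambda>z. z) \<in> bimodule_hom S S (HM R Y i) (HM R X i)"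
proof -
  have h: "quot_map (C i) (boundaries R X i) (\<lambda>z. z) \<in>
      bimodule_hom S S (quot_bimodule (CY i) (boundaries R Y i)) (quot_bimodule (C i) (boundaries R X i))"
    by (rule quot_map_bimodule_hom[OF CY_biaction boundaries_sub[OF Y] C_biaction(4)
          sub_biaction_S[OF boundaries_sub[OF X finite_vertices]] inclusion_hom])
      (use boundaries_Y_subset in blast)
  have "quot_map (C i) (boundaries R X i) (\<lambda>z. z) (HM_class R Y i z) \<in> HM_class R X i ` cycles R X i"
    if "z \<in> cycles R Y i" for z
  proof -
    have "z \<in> carrier (CY i)" using that by (simp add: cycles_iff)
    from class_map_X[OF this] show ?thesis using subsetD[OF cycles_Y_subset that] by simp
  qed
  then show ?thesis unfolding HM_eq
    by (intro restrict_bimodule_hom[OF h HMY_carrier_subset]) blast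
qed

lemma EH: "ext_module X Y R (HM R Y (Suc j))"
  by (intro ext_module.intro ext_module_axioms.intro precubical_pair_axioms HM_bimodule[OF Y])

lemma comparison_hom: "comparison (Suc j) \<in> bimodule_hom A A (EH (Suc j)) (P (Suc j))"
  unfolding comparison_def by (rule ext_module.ext_hom_bimodule_hom[OF EH P_bimodule class_map_hom])

lemma conc_in_C:
  assumes "x \<in> carrier (C i)" "a \<in> carrier A"
  shows "conc a x \<in> carrier (C i)" "conc x a \<in> carrier (C i)"
  using biaction.lact_closed[OF C_biaction(1) assms(2,1)] biaction.ract_closed[OF C_biaction(1) assms]
  by (simp_all add: chain_bimodule_simps(4,5))

lemma comparison_ehp:
  assumes "p \<in> carrier A" "z \<in> cycles R Y (Suc j)" "q \<in> carrier A"
  shows "comparison (Suc j) (ehp (Suc j) p (HM_class R Y (Suc j) z) q) = cls (Suc j) (conc (conc p z) q)"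
proof -
  have z: "z \<in> carrier (CY (Suc j))" using assms(2) by (simp add: cycles_iff)
  have "HM_class R Y (Suc j) z \<in> carrier (HM R Y (Suc j))" using assms(2) by (simp add: HM_simps)
  from ext_module.ext_hom_ep[OF EH P_bimodule class_map_hom assms(1) this assms(3)]
  show ?thesis unfolding comparison_def
    by (simp add: class_map[OF z] cls_act conc_in_C CY_in_C[OF z] assms(1,3))
qed

lemma HM_incl_hom: "HM_incl R X (Suc j) \<in> bimodule_hom A A (EH (Suc j)) (HM R X (Suc j))"
  unfolding HM_incl_def
  by (rule ext_module.ext_hom_bimodule_hom[OF EH HM_bimodule[OF X finite_vertices] class_map_X_hom])

lemma HM_incl_ehp:
  assumes "p \<in> carrier A" "z \<in> cycles R Y (Suc j)" "q \<in> carrier A"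
  shows "HM_incl R X (Suc j) (ehp (Suc j) p (HM_class R Y (Suc j) z) q) = HM_class R X (Suc j) (conc (conc p z) q)"
proof -
  have z: "z \<in> carrier (CY (Suc j))" using assms(2) by (simp add: cycles_iff)
  have "HM_class R Y (Suc j) z \<in> carrier (HM R Y (Suc j))" using assms(2) by (simp add: HM_simps)
  from ext_module.ext_hom_ep[OF EH HM_bimodule[OF X finite_vertices] class_map_X_hom assms(1) this assms(3)]
  show ?thesis unfolding HM_incl_def
    by (simp add: class_map_X[OF z] HM_class_act[OF X finite_vertices] conc_in_C CY_in_C[OF z] assms(1,3))
qed

text \<open>Choosing a cycle for each middle factor lifts \<open>t\<close> to the extension of scalars of the chain module. One and
the same lift represents the values of \<open>comparison\<close> and \<open>HM_incl\<close>, and its coordinates represent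
those of \<open>t\<close>.\<close>

lemma homology_lift:
  assumes "t \<in> carrier (EH (Suc j))"
  shows "\<exists>u\<in>carrier (EC (Suc j)). incl (Suc j) u \<in> cycles R X (Suc j) \<and>
    comparison (Suc j) t = cls (Suc j) (incl (Suc j) u) \<and> HM_incl R X (Suc j) t = HM_class R X (Suc j) (incl (Suc j) u) \<and>
    (\<forall>p\<in>prefixes. \<forall>q\<in>suffixes. crd (Suc j) p q u \<in> carrier (CY (Suc j)) \<and>
       ext_module.coord Y (HM R Y (Suc j)) p q t = HM_class R Y (Suc j) (crd (Suc j) p q u))"
    (is "\<exists>u\<in>_. ?lift t u")
  using assms
proof (induction rule: ext_module.E_induct[OF EH, consumes 1, case_names zero add pure])
  case zero
  let ?i = "Suc j"
  have g: "abelian_group (EC ?i)" by (rule ext_module.E_group[OF EC])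
  have gH: "abelian_group (EH ?i)" by (rule ext_module.E_group[OF EH])
  have hX: "abelian_group (HM R X ?i)" "abelian_group (HM R Y ?i)"
    using HM_bimodule[OF X finite_vertices, of R j] HM_bimodule[OF Y, of R j] by (simp_all add: bimodule_def)
  have inc: "incl ?i \<zero>\<^bsub>EC ?i\<^esub> = 0"
    using add_hom_group(1)[OF g chain_group bimodule_homD(1)[OF incl_hom]] by (simp add: chain_bimodule_simps)
  have cmp: "comparison ?i \<zero>\<^bsub>EH ?i\<^esub> = cls ?i 0"
    using add_hom_group(1)[OF gH P_group bimodule_homD(1)[OF comparison_hom]] by (simp add: cls_zero)
  have "(0 :: ('a, 'r) chains) \<in> boundaries R Z ?i" if "Z = X \<or> Z = Y" for Z
    using that additive_subgroup_mem(1)[OF boundaries_subgroup[OF X finite_vertices, of R ?i]]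
      additive_subgroup_mem(1)[OF boundaries_subgroup[OF Y, of R ?i]] by (auto simp: chain_bimodule_simps)
  then have cl0: "HM_class R X ?i 0 = \<zero>\<^bsub>HM R X ?i\<^esub>" "HM_class R Y ?i 0 = \<zero>\<^bsub>HM R Y ?i\<^esub>"
    using HM_class_eq_zero_iff[OF X finite_vertices, of 0 R ?i] HM_class_eq_zero_iff[OF Y, of 0 R ?i]
    by (simp_all add: chain_bimodule_simps)
  have hinc: "HM_incl R X ?i \<zero>\<^bsub>EH ?i\<^esub> = HM_class R X ?i 0"
    using add_hom_group(1)[OF gH hX(1) bimodule_homD(1)[OF HM_incl_hom]] by (simp add: cl0)
  have cr: "crd ?i p q \<zero>\<^bsub>EC ?i\<^esub> = 0" "ext_module.coord Y (HM R Y ?i) p q \<zero>\<^bsub>EH ?i\<^esub> = HM_class R Y ?i 0"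
    if pq: "p \<in> prefixes" "q \<in> suffixes" for p q
    using add_hom_group(1)[OF g chain_group crd_hom[OF pq]]
      add_hom_group(1)[OF gH hX(2) ext_module.coord_hom[OF EH pq]]
    by (simp_all add: chain_bimodule_simps cl0)
  have "?lift \<zero>\<^bsub>EH ?i\<^esub> \<zero>\<^bsub>EC ?i\<^esub>"
    by (simp add: inc cmp hinc cr cycles_iff chain_bimodule_simps boundary_rlinear)
  then show ?case using abelian_groupE(2)[OF g] by blast
next
  case (add t t')
  let ?i = "Suc j"
  obtain u u' where u: "u \<in> carrier (EC ?i)" "?lift t u" and u': "u' \<in> carrier (EC ?i)" "?lift t' u'"
    using add by blast
  have iu: "incl ?i u \<in> carrier (C ?i)" "incl ?i u' \<in> carrier (C ?i)"
    using bimodule_homD(4)[OF incl_hom] u(1) u'(1) by blast+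
  have inc: "incl ?i (u \<oplus>\<^bsub>EC ?i\<^esub> u') = incl ?i u + incl ?i u'"
    using bimodule_homD(5)[OF incl_hom u(1) u'(1)] by (simp only: chain_bimodule_simps)
  have cyc: "incl ?i u + incl ?i u' \<in> cycles R X ?i"
    using additive_subgroup_mem(3)[OF cycles_subgroup[OF X finite_vertices], of "incl ?i u" R j "incl ?i u'"] u(2) u'(2)
    by (simp only: chain_bimodule_simps)
  have cmp: "comparison ?i (t \<oplus>\<^bsub>EH ?i\<^esub> t') = cls ?i (incl ?i u + incl ?i u')"
    using bimodule_homD(5)[OF comparison_hom add(1,2)] u(2) u'(2) cls_add[OF iu] by (simp only:)
  have hinc: "HM_incl R X ?i (t \<oplus>\<^bsub>EH ?i\<^esub> t') = HM_class R X ?i (incl ?i u + incl ?i u')"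
    using bimodule_homD(5)[OF HM_incl_hom add(1,2)] u(2) u'(2) HM_class_add[OF X finite_vertices iu] by (simp only:)
  have cr: "crd ?i p q (u \<oplus>\<^bsub>EC ?i\<^esub> u') \<in> carrier (CY ?i) \<and>
      ext_module.coord Y (HM R Y ?i) p q (t \<oplus>\<^bsub>EH ?i\<^esub> t') = HM_class R Y ?i (crd ?i p q (u \<oplus>\<^bsub>EC ?i\<^esub> u'))"
    if pq: "p \<in> prefixes" "q \<in> suffixes" for p q
  proof -
    have c: "crd ?i p q (u \<oplus>\<^bsub>EC ?i\<^esub> u') = crd ?i p q u + crd ?i p q u'"
      using add_homD(2)[OF crd_hom[OF pq] u(1) u'(1)] by (simp only: chain_bimodule_simps)
    have m: "crd ?i p q u \<in> carrier (CY ?i)" "crd ?i p q u' \<in> carrier (CY ?i)" using u(2) u'(2) pq by blast+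
    have "ext_module.coord Y (HM R Y ?i) p q t = HM_class R Y ?i (crd ?i p q u)"
      "ext_module.coord Y (HM R Y ?i) p q t' = HM_class R Y ?i (crd ?i p q u')" using u(2) u'(2) pq by blast+
    then have "ext_module.coord Y (HM R Y ?i) p q (t \<oplus>\<^bsub>EH ?i\<^esub> t') = HM_class R Y ?i (crd ?i p q u + crd ?i p q u')"
      using add_homD(2)[OF ext_module.coord_hom[OF EH pq] add(1,2)] HM_class_add[OF Y m] by (simp only:)
    moreover have "crd ?i p q u + crd ?i p q u' \<in> carrier (CY ?i)"
      using abelian_groupE(1)[OF chain_group m] by (simp only: chain_bimodule_simps(3))
    ultimately show ?thesis unfolding c by blast
  qed
  have "?lift (t \<oplus>\<^bsub>EH ?i\<^esub> t') (u \<oplus>\<^bsub>EC ?i\<^esub> u')"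
    unfolding inc cmp hinc using cyc cr by blast
  moreover have "u \<oplus>\<^bsub>EC ?i\<^esub> u' \<in> carrier (EC ?i)"
    using abelian_groupE(1)[OF ext_module.E_group[OF EC] u(1) u'(1)] .
  ultimately show ?case by blast
next
  case (pure p m q)
  let ?i = "Suc j"
  obtain z where z: "z \<in> cycles R Y ?i" "m = HM_class R Y ?i z" using pure(2) by (auto simp: HM_simps)
  have zC: "z \<in> carrier (CY ?i)" using z(1) by (simp add: cycles_iff)
  let ?u = "ecp ?i p z q"
  have inc: "incl ?i ?u = conc (conc p z) q" by (rule incl_ecp[OF pure(1) zC pure(3)])
  have cyc: "conc (conc p z) q \<in> cycles R X ?i"
    using z(1) cycles_Y_subset[of ?i] boundary_bimodule[OF pure(1) CY_in_C[OF zC] pure(3)]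
      conc_in_C CY_in_C[OF zC] pure(1,3)
    by (auto simp: cycles_iff conc_left conc_right)
  have cr: "crd ?i p0 q0 ?u \<in> carrier (CY ?i) \<and>
      ext_module.coord Y (HM R Y ?i) p0 q0 (ehp ?i p m q) = HM_class R Y ?i (crd ?i p0 q0 ?u)"
    if pq: "p0 \<in> prefixes" "q0 \<in> suffixes" for p0 q0
  proof -
    note s = strip_carrier(1)[OF pure(1), of p0] strip_carrier(2)[OF pure(3), of q0]
    have c1: "conc (strip_prefix p0 p) z \<in> carrier (CY ?i)"
      using biaction.lact_closed[OF CY_biaction s(1) zC] by (simp only: chain_bimodule_simps)
    have c2: "conc (conc (strip_prefix p0 p) z) (strip_suffix q0 q) \<in> carrier (CY ?i)"
      using biaction.ract_closed[OF CY_biaction c1 s(2)] by (simp only: chain_bimodule_simps)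
    show ?thesis
      unfolding crd_ecp[OF pq pure(1) zC pure(3)] ext_module.coord_ep[OF EH pq pure]
      unfolding z(2) HM_class_act(1)[OF Y zC s(1)] HM_class_act(2)[OF Y c1 s(2)]
      using c2 by blast
  qed
  have "?lift (ehp ?i p m q) ?u"
    unfolding inc z(2) comparison_ehp[OF pure(1) z(1) pure(3)] HM_incl_ehp[OF pure(1) z(1) pure(3)]
    using cyc cr unfolding z(2) by blast
  moreover have "?u \<in> carrier (EC ?i)" by (rule ext_module.ep_closed[OF EC pure(1) zC pure(3)])
  ultimately show ?case by blast
qed

end

section \<open>The long exact sequence\<close>

locale embedded_pair = precubical_pair X Y R
  for X Y :: "'a precubical" and R :: "'r::field itself" +
  assumes emb: "ext_embeds R X Y"
begin

lemma incl_inj: "inj_on (incl (Suc j)) (carrier (EC (Suc j)))"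
  using emb by (simp add: ext_embeds_def)

lemma incl_zero: "incl i \<zero>\<^bsub>EC i\<^esub> = 0"
  using add_hom_group(1)[OF ext_module.E_group[OF EC] chain_group bimodule_homD(1)[OF incl_hom]]
  by (simp add: chain_bimodule_simps)

text \<open>The boundary of the image of \<open>t\<close> is the image of an element whose coordinates are the boundaries of those
of \<open>t\<close>. If the image is 0, so is that element, by injectivity of the inclusion.\<close>

lemma coord_cycle:
  assumes t: "t \<in> carrier (EC (Suc j))" and cyc: "boundary X (incl (Suc j) t) = 0"
    and pq: "p \<in> prefixes" "q \<in> suffixes"
  shows "crd (Suc j) p q t \<in> cycles R Y (Suc j)"
proof -
  have m: "crd (Suc j) p q t \<in> carrier (CY (Suc j))" by (rule add_homD(1)[OF crd_hom[OF pq] t])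
  have "boundary X (crd (Suc j) p q t) = 0"
  proof (cases j)
    case 0
    then have "Poly_Mapping.keys (crd (Suc j) p q t) \<subseteq> Ch Y 0" using m by (simp add: chain_bimodule_simps deg_chains_def)
    from boundary_dim_0[OF Y(1) this] show ?thesis using boundary_Y[OF m] by simp
  next
    case (Suc k)
    obtain u where u: "u \<in> carrier (EC j)" "incl j u = boundary X (incl (Suc j) t)"
      "\<And>p q. p \<in> prefixes \<Longrightarrow> q \<in> suffixes \<Longrightarrow> crd j p q u = boundary X (crd (Suc j) p q t)"
      using boundary_lift[OF t] by blast
    have "incl j u = incl j \<zero>\<^bsub>EC j\<^esub>" using u(2) cyc incl_zero by simp
    then have "u = \<zero>\<^bsub>EC j\<^esub>"
      using inj_onD[OF incl_inj[of k]] u(1) abelian_groupE(2)[OF ext_module.E_group[OF EC]] unfolding Suc by blast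
    then have "crd j p q u = 0"
      using add_hom_group(1)[OF ext_module.E_group[OF EC] chain_group crd_hom[OF pq]] by (simp add: chain_bimodule_simps)
    then show ?thesis using u(3)[OF pq] by simp
  qed
  then show ?thesis using m boundary_Y[OF m] by (simp add: cycles_iff)
qed

text \<open>Lift \<open>t\<close> to chains. If the lift bounds in the subcomplex, then by injectivity of the inclusion it equals
the coordinatewise boundary of some element, so that all coordinates of \<open>t\<close> are classes of boundaries
of \<open>Y\<close>.\<close>

lemma comparison_kernel:
  assumes t: "t \<in> carrier (EH (Suc j))" and zero: "comparison (Suc j) t = \<zero>\<^bsub>P (Suc j)\<^esub>"
  shows "t = \<zero>\<^bsub>EH (Suc j)\<^esub>"
proof (rule ext_module.coord_eq_zero[OF EH t])
  obtain u where u: "u \<in> carrier (EC (Suc j))" and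
    lift: "incl (Suc j) u \<in> cycles R X (Suc j) \<and>
      comparison (Suc j) t = cls (Suc j) (incl (Suc j) u) \<and> HM_incl R X (Suc j) t = HM_class R X (Suc j) (incl (Suc j) u) \<and>
      (\<forall>p\<in>prefixes. \<forall>q\<in>suffixes. crd (Suc j) p q u \<in> carrier (CY (Suc j)) \<and>
         ext_module.coord Y (HM R Y (Suc j)) p q t = HM_class R Y (Suc j) (crd (Suc j) p q u))"
    by (rule bexE[OF homology_lift[OF t]]) (rule that)
  note lift2 = conjunct2[OF lift]
  note lift3 = conjunct2[OF lift2]
  note classes = conjunct2[OF lift3]
  have "cls (Suc j) (incl (Suc j) u) = \<zero>\<^bsub>P (Suc j)\<^esub>"
    by (rule trans[OF conjunct1[OF lift2, symmetric] zero])
  then have "cls (Suc j) (incl (Suc j) u) = Bd (Suc j)" by (simp only: quot_simps)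
  then have "incl (Suc j) u \<in> Bd (Suc j)"
    by (rule iffD1[OF coset_zero(2)[OF chain_group Bd_subgroup bimodule_homD(4)[OF incl_hom u]]])
  then obtain \<sigma> where \<sigma>: "\<sigma> \<in> carrier (EC (Suc (Suc j)))" "incl (Suc j) u = boundary X (incl (Suc (Suc j)) \<sigma>)"
    unfolding rel_sub_def image_image by (elim imageE) (rule that)
  obtain v where v: "v \<in> carrier (EC (Suc j))" "incl (Suc j) v = boundary X (incl (Suc (Suc j)) \<sigma>)"
    "\<And>p q. p \<in> prefixes \<Longrightarrow> q \<in> suffixes \<Longrightarrow> crd (Suc j) p q v = boundary X (crd (Suc (Suc j)) p q \<sigma>)"
    using boundary_lift[OF \<sigma>(1)] by blast
  have "u = v" using inj_onD[OF incl_inj _ u v(1)] \<sigma>(2) v(2) by simp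
  fix p q assume pq: "p \<in> prefixes" "q \<in> suffixes"
  have m: "crd (Suc (Suc j)) p q \<sigma> \<in> carrier (CY (Suc (Suc j)))" by (rule add_homD(1)[OF crd_hom[OF pq] \<sigma>(1)])
  have "crd (Suc j) p q u = boundary Y (crd (Suc (Suc j)) p q \<sigma>)"
    using v(3)[OF pq] boundary_Y[OF m] \<open>u = v\<close> by simp
  then have "crd (Suc j) p q u \<in> boundaries R Y (Suc j)"
    using m unfolding boundaries_def Suc_eq_plus1[symmetric] by blast
  note c = bspec[OF bspec[OF classes pq(1)] pq(2)]
  show "ext_module.coord Y (HM R Y (Suc j)) p q t = \<zero>\<^bsub>HM R Y (Suc j)\<^esub>"
    by (rule trans[OF conjunct2[OF c] iffD2[OF HM_class_eq_zero_iff[OF Y conjunct1[OF c]]]]) fact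
qed

lemma comparison_inj:
  assumes t: "t \<in> carrier (EH (Suc j))" "t' \<in> carrier (EH (Suc j))" and eq: "comparison (Suc j) t = comparison (Suc j) t'"
  shows "t = t'"
proof -
  let ?E = "EH (Suc j)"
  have g: "abelian_group ?E" by (rule ext_module.E_group[OF EH])
  have "comparison (Suc j) (t \<ominus>\<^bsub>?E\<^esub> t') = comparison (Suc j) t \<ominus>\<^bsub>P (Suc j)\<^esub> comparison (Suc j) t'"
    by (rule add_hom_group(3)[OF g P_group bimodule_homD(1)[OF comparison_hom] t])
  also have "\<dots> = \<zero>\<^bsub>P (Suc j)\<^esub>"
    using a_minus_eq_zero_iff[OF P_group bimodule_homD(4)[OF comparison_hom t(1)] bimodule_homD(4)[OF comparison_hom t(2)]] eq
    by blast
  finally have "t \<ominus>\<^bsub>?E\<^esub> t' = \<zero>\<^bsub>?E\<^esub>"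
    using comparison_kernel[OF abelian_group.minus_closed[OF g t]] by blast
  then show ?thesis using a_minus_eq_zero_iff[OF g t] by blast
qed

text \<open>A cycle of the subcomplex is the sum of \<open>p m q\<close> over its coordinates \<open>m\<close>, and these are cycles of \<open>Y\<close> by
\<open>coord_cycle\<close>, so that \<open>p \<otimes> [m] \<otimes> q\<close> makes sense.\<close>

lemma comparison_surj:
  assumes z: "z \<in> Sub (Suc j)" "boundary X z = 0"
  shows "\<exists>t\<in>carrier (EH (Suc j)). comparison (Suc j) t = cls (Suc j) z"
proof -
  obtain u where u: "u \<in> carrier (EC (Suc j))" "z = incl (Suc j) u" using z(1) by (auto simp: rel_sub_def)
  have g: "abelian_group (EH (Suc j))" by (rule ext_module.E_group[OF EH])
  have "\<exists>t\<in>carrier (EH (Suc j)). comparison (Suc j) t = cls (Suc j) (incl (Suc j) u)"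
    using u(1)
  proof (induction rule: ext_module.E_coord_induct[OF EC, where N = "cycles R Y (Suc j)", consumes 1, case_names coord zero add pure])
    case (coord p q)
    then show ?case using coord_cycle[OF u(1)] z(2) u(2) by simp
  next
    case zero
    have "comparison (Suc j) \<zero>\<^bsub>EH (Suc j)\<^esub> = cls (Suc j) (incl (Suc j) \<zero>\<^bsub>EC (Suc j)\<^esub>)"
      using add_hom_group(1)[OF g P_group bimodule_homD(1)[OF comparison_hom]] by (simp add: incl_zero cls_zero)
    then show ?case using abelian_groupE(2)[OF g] by blast
  next
    case (add u u')
    then obtain t t' where t: "t \<in> carrier (EH (Suc j))" "comparison (Suc j) t = cls (Suc j) (incl (Suc j) u)"
      and t': "t' \<in> carrier (EH (Suc j))" "comparison (Suc j) t' = cls (Suc j) (incl (Suc j) u')" by blast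
    have "comparison (Suc j) (t \<oplus>\<^bsub>EH (Suc j)\<^esub> t') = cls (Suc j) (incl (Suc j) u + incl (Suc j) u')"
      unfolding bimodule_homD(5)[OF comparison_hom t(1) t'(1)] t(2) t'(2)
      by (rule cls_add[OF bimodule_homD(4)[OF incl_hom add(1)] bimodule_homD(4)[OF incl_hom add(2)]])
    also have "incl (Suc j) u + incl (Suc j) u' = incl (Suc j) (u \<oplus>\<^bsub>EC (Suc j)\<^esub> u')"
      unfolding bimodule_homD(5)[OF incl_hom add(1,2)] chain_bimodule_simps(3) ..
    finally show ?case using abelian_groupE(1)[OF g t(1) t'(1)] by blast
  next
    case (pure p m q)
    note A = prefixes_carrier[OF pure(1), of 1] suffixes_carrier[OF pure(2), of 1]
    have "comparison (Suc j) (ehp (Suc j) (basis p) (HM_class R Y (Suc j) m) (basis q)) =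
        cls (Suc j) (incl (Suc j) (ecp (Suc j) (basis p) m (basis q)))"
      unfolding comparison_ehp[OF A(1) pure(4) A(2)] incl_ecp[OF A(1) pure(3) A(2)] ..
    moreover have "ehp (Suc j) (basis p) (HM_class R Y (Suc j) m) (basis q) \<in> carrier (EH (Suc j))"
      using pure(4) by (intro ext_module.ep_closed[OF EH] A) (simp add: HM_simps)
    ultimately show ?case by blast
  qed
  then show ?thesis using u(2) by simp
qed

lemma comparison_image:
  assumes "t \<in> carrier (EH (Suc j))"
  shows "\<exists>z\<in>Sub (Suc j). z \<in> cycles R X (Suc j) \<and> comparison (Suc j) t = cls (Suc j) z \<and>
    HM_incl R X (Suc j) t = HM_class R X (Suc j) z"
proof -
  obtain u where u: "u \<in> carrier (EC (Suc j))" and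
    lift: "incl (Suc j) u \<in> cycles R X (Suc j) \<and>
      comparison (Suc j) t = cls (Suc j) (incl (Suc j) u) \<and> HM_incl R X (Suc j) t = HM_class R X (Suc j) (incl (Suc j) u) \<and>
      (\<forall>p\<in>prefixes. \<forall>q\<in>suffixes. crd (Suc j) p q u \<in> carrier (CY (Suc j)) \<and>
         ext_module.coord Y (HM R Y (Suc j)) p q t = HM_class R Y (Suc j) (crd (Suc j) p q u))"
    by (rule bexE[OF homology_lift[OF assms]]) (rule that)
  note l = conjunct1[OF lift] conjunct1[OF conjunct2[OF lift]] conjunct1[OF conjunct2[OF conjunct2[OF lift]]]
  have "incl (Suc j) u \<in> Sub (Suc j)" unfolding rel_sub_def using u by (rule imageI)
  then show ?thesis by (rule bexI[rotated]) (intro conjI l)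
qed

lemma HM_incl_of_comparison:
  assumes t: "t \<in> carrier (EH (Suc j))" and x: "x \<in> carrier (C (Suc j))" and eq: "comparison (Suc j) t = cls (Suc j) x"
  shows "HM_incl R X (Suc j) t = HM_class R X (Suc j) x"
proof -
  obtain z where z: "z \<in> Sub (Suc j)" "comparison (Suc j) t = cls (Suc j) z" "HM_incl R X (Suc j) t = HM_class R X (Suc j) z"
    using comparison_image[OF t] by blast
  have zC: "z \<in> carrier (C (Suc j))" by (rule Sub_mem(1)[OF z(1)])
  have "z - x \<in> Bd (Suc j)" using cls_eq_iff[OF zC x] z(2) eq by simp
  then have "z - x \<in> boundaries R X (Suc j)" by (rule subsetD[OF Bd_subset])
  then show ?thesis using z(3) HM_class_eq_iff[OF X finite_vertices zC x] by simp
qed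

text \<open>The inverse image under \<open>comparison\<close> of the class of the boundary of a relative cycle. By \<open>connect_eq\<close>
it does not depend on the relative cycle: another representative differs from it by a boundary and a
chain of the subcomplex, and the boundary of the latter vanishes in the target of \<open>comparison\<close>.\<close>

definition connect :: "nat \<Rightarrow> ('a, 'r) chains set set \<Rightarrow> ('a, 'r, ('a, 'r) chains set) ext" where
  "connect i D = (SOME t. t \<in> carrier (EH i) \<and>
     (\<exists>x\<in>rel_cycles (Suc i). D = rel_class (Suc i) x \<and> comparison i t = cls i (boundary X x)))"

lemma rel_cycles_iff: "x \<in> rel_cycles (Suc i) \<longleftrightarrow> x \<in> carrier (C (Suc i)) \<and> boundary X x \<in> Sub i"
  by (simp add: rel_cycles_def)

lemma boundary_boundary_C: "x \<in> carrier (C i) \<Longrightarrow> boundary X (boundary X x) = 0"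
  using boundary_boundary_deg[OF X] by (simp add: chain_bimodule_simps)

lemma connect_exists:
  assumes "x \<in> rel_cycles (Suc (Suc j))"
  shows "\<exists>t\<in>carrier (EH (Suc j)). comparison (Suc j) t = cls (Suc j) (boundary X x)"
  using assms boundary_boundary_C by (intro comparison_surj) (auto simp: rel_cycles_iff)

lemma connect_eq:
  assumes x: "x \<in> rel_cycles (Suc (Suc j))" and t: "t \<in> carrier (EH (Suc j))"
    and eq: "comparison (Suc j) t = cls (Suc j) (boundary X x)"
  shows "connect (Suc j) (rel_class (Suc (Suc j)) x) = t"
  unfolding connect_def
proof (rule someI2)
  show "t \<in> carrier (EH (Suc j)) \<and> (\<exists>x'\<in>rel_cycles (Suc (Suc j)).
      rel_class (Suc (Suc j)) x = rel_class (Suc (Suc j)) x' \<and> comparison (Suc j) t = cls (Suc j) (boundary X x'))"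
    using assms by blast
next
  fix t' assume "t' \<in> carrier (EH (Suc j)) \<and> (\<exists>x'\<in>rel_cycles (Suc (Suc j)).
      rel_class (Suc (Suc j)) x = rel_class (Suc (Suc j)) x' \<and> comparison (Suc j) t' = cls (Suc j) (boundary X x'))"
  then obtain x' where x': "x' \<in> rel_cycles (Suc (Suc j))" and cl: "rel_class (Suc (Suc j)) x = rel_class (Suc (Suc j)) x'"
    and t': "t' \<in> carrier (EH (Suc j))" "comparison (Suc j) t' = cls (Suc j) (boundary X x')" by blast
  have C: "x \<in> carrier (C (Suc (Suc j)))" "x' \<in> carrier (C (Suc (Suc j)))" using x x' by (simp_all add: rel_cycles_iff)
  obtain c where c: "c \<in> carrier (C (Suc (Suc (Suc j))))" "x - x' - boundary X c \<in> Sub (Suc (Suc j))"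
    using rel_class_eq_iff[OF C] cl by blast
  have "boundary X (x - x' - boundary X c) \<in> Bd (Suc j)" using c(2) by (rule imageI)
  then have "boundary X x - boundary X x' \<in> Bd (Suc j)"
    using boundary_boundary_C[OF c(1)] by (simp add: boundary_rlinear)
  then have "comparison (Suc j) t' = comparison (Suc j) t"
    using cls_eq_iff[OF boundary_in_C[OF C(1)] boundary_in_C[OF C(2)]] t'(2) eq by simp
  then show "t' = t" by (rule comparison_inj[OF t'(1) t])
qed

lemma rel_cycles_closed:
  "x \<in> rel_cycles (Suc i) \<Longrightarrow> y \<in> rel_cycles (Suc i) \<Longrightarrow> x + y \<in> rel_cycles (Suc i)"
  "x \<in> rel_cycles (Suc i) \<Longrightarrow> a \<in> carrier A \<Longrightarrow> conc a x \<in> rel_cycles (Suc i) \<and> boundary X (conc a x) = conc a (boundary X x)"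
  "x \<in> rel_cycles (Suc i) \<Longrightarrow> a \<in> carrier A \<Longrightarrow> conc x a \<in> rel_cycles (Suc i) \<and> boundary X (conc x a) = conc (boundary X x) a"
proof -
  note bD = bimodule_homD(2,3)[OF boundary_bimodule_hom[OF X, of R i], unfolded chain_bimodule_simps(4,5)]
  have S: "conc a s \<in> Sub i" "conc s a \<in> Sub i" if "a \<in> carrier A" "s \<in> Sub i" for a s
    using Sub_sub[of i] that by (auto simp: sub_biaction_def chain_bimodule_simps(4,5))
  show "x \<in> rel_cycles (Suc i) \<Longrightarrow> y \<in> rel_cycles (Suc i) \<Longrightarrow> x + y \<in> rel_cycles (Suc i)"
    using abelian_groupE(1)[OF chain_group, of x R X "Suc i" y] Sub_mem(3)[of "boundary X x" i "boundary X y"]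
    by (simp add: rel_cycles_iff boundary_rlinear chain_bimodule_simps(3))
  show "x \<in> rel_cycles (Suc i) \<Longrightarrow> a \<in> carrier A \<Longrightarrow> conc a x \<in> rel_cycles (Suc i) \<and> boundary X (conc a x) = conc a (boundary X x)"
    using bD(1) S(1) conc_in_C(1) by (simp add: rel_cycles_iff)
  show "x \<in> rel_cycles (Suc i) \<Longrightarrow> a \<in> carrier A \<Longrightarrow> conc x a \<in> rel_cycles (Suc i) \<and> boundary X (conc x a) = conc (boundary X x) a"
    using bD(2) S(2) conc_in_C(2) by (simp add: rel_cycles_iff)
qed

lemma connect_hom: "connect (Suc j) \<in> bimodule_hom A A (HM_rel R X Y (Suc (Suc j))) (EH (Suc j))"
proof -
  let ?i = "Suc j" and ?k = "Suc (Suc j)"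
  let ?\<delta> = "connect ?i"
  have g: "abelian_group (EH ?i)" by (rule ext_module.E_group[OF EH])
  have E: "biaction A A (EH ?i)" using ext_module.E_bimodule[OF EH, of j] by (simp add: bimodule_iff_biaction)
  have rep: "\<exists>x t. D = rel_class ?k x \<and> x \<in> rel_cycles ?k \<and> t \<in> carrier (EH ?i) \<and>
      comparison ?i t = cls ?i (boundary X x) \<and> ?\<delta> D = t" if "D \<in> carrier (HM_rel R X Y ?k)" for D
    using that connect_exists connect_eq unfolding HM_rel_simps by blast
  have hom: "?\<delta> \<in> add_hom (HM_rel R X Y ?k) (EH ?i)"
  proof (rule add_homI)
    fix D assume "D \<in> carrier (HM_rel R X Y ?k)"
    from rep[OF this] show "?\<delta> D \<in> carrier (EH ?i)" by blast
  next
    fix D D' assume "D \<in> carrier (HM_rel R X Y ?k)" "D' \<in> carrier (HM_rel R X Y ?k)"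
    then obtain x t x' t' where x: "D = rel_class ?k x" "x \<in> rel_cycles ?k" "t \<in> carrier (EH ?i)"
        "comparison ?i t = cls ?i (boundary X x)" "?\<delta> D = t"
      and x': "D' = rel_class ?k x'" "x' \<in> rel_cycles ?k" "t' \<in> carrier (EH ?i)"
        "comparison ?i t' = cls ?i (boundary X x')" "?\<delta> D' = t'"
      using rep by metis
    have C: "x \<in> carrier (C ?k)" "x' \<in> carrier (C ?k)" using x(2) x'(2) by (simp_all add: rel_cycles_iff)
    have "comparison ?i (t \<oplus>\<^bsub>EH ?i\<^esub> t') = cls ?i (boundary X (x + x'))"
      unfolding bimodule_homD(5)[OF comparison_hom x(3) x'(3)] x(4) x'(4) cls_add[OF boundary_in_C[OF C(1)] boundary_in_C[OF C(2)]]
        boundary_rlinear(1) ..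
    then have "?\<delta> (rel_class ?k (x + x')) = t \<oplus>\<^bsub>EH ?i\<^esub> t'"
      by (rule connect_eq[OF rel_cycles_closed(1)[OF x(2) x'(2)] abelian_groupE(1)[OF g x(3) x'(3)]])
    then show "?\<delta> (D \<oplus>\<^bsub>HM_rel R X Y ?k\<^esub> D') = ?\<delta> D \<oplus>\<^bsub>EH ?i\<^esub> ?\<delta> D'"
      unfolding x(5) x'(5) unfolding x(1) x'(1) rel_class_add[OF C] .
  qed
  have "?\<delta> (smult (HM_rel R X Y ?k) a D) = smult (EH ?i) a (?\<delta> D) \<and>
      ?\<delta> (rsmult (HM_rel R X Y ?k) D a) = rsmult (EH ?i) (?\<delta> D) a"
    if a: "a \<in> carrier A" and D: "D \<in> carrier (HM_rel R X Y ?k)" for a D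
  proof
    obtain x t where x: "D = rel_class ?k x" "x \<in> rel_cycles ?k" "t \<in> carrier (EH ?i)"
        "comparison ?i t = cls ?i (boundary X x)" "?\<delta> D = t"
      using rep[OF D] by blast
    have C: "x \<in> carrier (C ?k)" using x(2) by (simp add: rel_cycles_iff)
    note l = rel_cycles_closed(2)[OF x(2) a] and r = rel_cycles_closed(3)[OF x(2) a]
    have "comparison ?i (smult (EH ?i) a t) = cls ?i (boundary X (conc a x))"
      unfolding bimodule_homD(2)[OF comparison_hom a x(3)] x(4) cls_act(1)[OF boundary_in_C[OF C] a] using l by simp
    then show "?\<delta> (smult (HM_rel R X Y ?k) a D) = smult (EH ?i) a (?\<delta> D)"
      unfolding x(5) unfolding x(1) rel_class_act(1)[OF C a] using l
      by (intro connect_eq biaction.lact_closed[OF E a x(3)]) simp_all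
    have "comparison ?i (rsmult (EH ?i) t a) = cls ?i (boundary X (conc x a))"
      unfolding bimodule_homD(3)[OF comparison_hom x(3) a] x(4) cls_act(2)[OF boundary_in_C[OF C] a] using r by simp
    then show "?\<delta> (rsmult (HM_rel R X Y ?k) D a) = rsmult (EH ?i) (?\<delta> D) a"
      unfolding x(5) unfolding x(1) rel_class_act(2)[OF C a] using r
      by (intro connect_eq biaction.ract_closed[OF E x(3) a]) simp_all
  qed
  then show ?thesis using hom by (simp add: bimodule_hom_def)
qed

text \<open>The prescribed value is the sum of the elements \<open>p \<otimes> [z] \<otimes> q\<close>, and \<open>comparison\<close> maps it to the class of
the sum of \<open>p z q\<close>, which is the boundary of \<open>x\<close>; by \<open>connect_eq\<close> nothing else is needed.\<close>

lemma connecting_map: "connecting_map R X Y (Suc j) (connect (Suc j))"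
  unfolding connecting_map_def Suc_eq_plus1[symmetric]
proof (intro allI impI, elim conjE)
  fix x and n :: nat and p z q
  let ?i = "Suc j"
  assume x: "x \<in> carrier (C (Suc ?i))"
    and pzq: "\<forall>k<n. p k \<in> carrier A \<and> z k \<in> cycles R Y ?i \<and> q k \<in> carrier A"
    and bd: "boundary X x = (\<Sum>k<n. conc (conc (p k) (z k)) (q k))"
  let ?t = "\<lambda>k. ehp ?i (p k) (HM_class R Y ?i (z k)) (q k)"
  interpret E: abelian_group "EH ?i" by (rule ext_module.E_group[OF EH])
  have "(\<Oplus>\<^bsub>EH ?i\<^esub>k\<in>{..<m}. ?t k) \<in> carrier (EH ?i) \<and>
      comparison ?i (\<Oplus>\<^bsub>EH ?i\<^esub>k\<in>{..<m}. ?t k) = cls ?i (\<Sum>k<m. conc (conc (p k) (z k)) (q k)) \<and>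
      (\<Sum>k<m. conc (conc (p k) (z k)) (q k)) \<in> Sub ?i" if "m \<le> n" for m
    using that
  proof (induction m)
    case 0
    then show ?case
      using add_hom_group(1)[OF E.abelian_group_axioms P_group bimodule_homD(1)[OF comparison_hom]]
      by (simp add: cls_zero Sub_mem(2))
  next
    case (Suc m)
    let ?s = "\<Sum>k<m. conc (conc (p k) (z k)) (q k)" and ?f = "\<Oplus>\<^bsub>EH ?i\<^esub>k\<in>{..<m}. ?t k"
    have cl: "?t k \<in> carrier (EH ?i)" if "k < n" for k
      using pzq that by (intro ext_module.ep_closed[OF EH]) (auto simp: HM_simps)
    have m: "m < n" using Suc.prems by simp
    have pzq': "p m \<in> carrier A" "z m \<in> cycles R Y ?i" "q m \<in> carrier A" using pzq m by blast+
    have zC: "z m \<in> carrier (CY ?i)" using pzq'(2) by (simp add: cycles_iff)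
    have IH: "?f \<in> carrier (EH ?i)" "comparison ?i ?f = cls ?i ?s" "?s \<in> Sub ?i" using Suc by simp_all
    have sm: "conc (conc (p m) (z m)) (q m) \<in> Sub ?i" by (rule conc_in_Sub[OF pzq'(1) zC pzq'(3)])
    have f: "(\<Oplus>\<^bsub>EH ?i\<^esub>k\<in>{..<Suc m}. ?t k) = ?t m \<oplus>\<^bsub>EH ?i\<^esub> ?f"
      unfolding lessThan_Suc using cl m by (intro E.finsum_insert) auto
    have s: "(\<Sum>k<Suc m. conc (conc (p k) (z k)) (q k)) = conc (conc (p m) (z m)) (q m) + ?s"
      by (simp add: add.commute)
    have "comparison ?i (?t m \<oplus>\<^bsub>EH ?i\<^esub> ?f) = cls ?i (conc (conc (p m) (z m)) (q m) + ?s)"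
      unfolding bimodule_homD(5)[OF comparison_hom cl[OF m] IH(1)] IH(2) comparison_ehp[OF pzq']
      by (rule cls_add[OF Sub_mem(1)[OF sm] Sub_mem(1)[OF IH(3)]])
    then show ?case unfolding f s using E.a_closed[OF cl[OF m] IH(1)] Sub_mem(3)[OF sm IH(3)] by blast
  qed
  from this[OF order_refl] show "connect ?i (rel_class (Suc ?i) x) = (\<Oplus>\<^bsub>EH ?i\<^esub>k\<in>{..<n}. ?t k)"
    using x unfolding bd[symmetric] by (intro connect_eq) (simp_all add: rel_cycles_iff)
qed

text \<open>If the boundary of a relative cycle \<open>x\<close> is also the boundary of some \<open>s\<close> in the subcomplex, then \<open>x - s\<close> is an
absolute cycle with the same relative class.\<close>

lemma exact_at_relative:
  "exact_at (HM R X (Suc (Suc j))) (HM_rel R X Y (Suc (Suc j))) (EH (Suc j)) (HM_proj R X Y (Suc (Suc j))) (connect (Suc j))"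
  unfolding exact_at_def
proof (intro equalityI subsetI)
  let ?i = "Suc j" and ?k = "Suc (Suc j)"
  have g: "abelian_group (EH ?i)" by (rule ext_module.E_group[OF EH])
  have zero: "comparison ?i \<zero>\<^bsub>EH ?i\<^esub> = cls ?i 0"
    using add_hom_group(1)[OF g P_group bimodule_homD(1)[OF comparison_hom]] by (simp add: cls_zero)
  fix D
  {
    assume "D \<in> HM_proj R X Y ?k ` carrier (HM R X ?k)"
    then obtain z where z: "z \<in> cycles R X ?k" "D = rel_class ?k z"
      using HM_proj_class by (auto simp: HM_simps cycles_iff)
    have zr: "z \<in> rel_cycles ?k" using z(1) cycles_rel_cycles by blast
    have "connect ?i D = \<zero>\<^bsub>EH ?i\<^esub>"
      unfolding z(2) using z(1) zero by (intro connect_eq[OF zr abelian_groupE(2)[OF g]]) (simp add: cycles_iff)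
    then show "D \<in> a_kernel (HM_rel R X Y ?k) (EH ?i) (connect ?i)"
      using zr z(2) by (simp add: a_kernel_def' HM_rel_simps)
  next
    assume D: "D \<in> a_kernel (HM_rel R X Y ?k) (EH ?i) (connect ?i)"
    then obtain x where x: "x \<in> rel_cycles ?k" "D = rel_class ?k x" by (auto simp: a_kernel_def' HM_rel_simps)
    have xC: "x \<in> carrier (C ?k)" using x(1) by (simp add: rel_cycles_iff)
    obtain t where t: "t \<in> carrier (EH ?i)" "comparison ?i t = cls ?i (boundary X x)" using connect_exists[OF x(1)] by blast
    have "t = \<zero>\<^bsub>EH ?i\<^esub>" using connect_eq[OF x(1) t] D x(2) by (simp add: a_kernel_def')
    then have "cls ?i (boundary X x) = cls ?i 0" using t(2) zero by simp
    then have "boundary X x \<in> Bd ?i"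
      using cls_eq_iff[OF boundary_in_C[OF xC], of 0] by (simp add: chain_bimodule_simps)
    then obtain s where s: "s \<in> Sub ?k" "boundary X x = boundary X s" by blast
    have sC: "s \<in> carrier (C ?k)" by (rule Sub_mem(1)[OF s(1)])
    have xs: "x - s \<in> carrier (C ?k)"
      using abelian_group.minus_closed[OF chain_group xC sC] by (simp only: chain_minus[OF xC sC])
    have cyc: "x - s \<in> cycles R X ?k" using xs s(2) by (simp add: cycles_iff boundary_rlinear)
    have "rel_class ?k x = rel_class ?k (x - s)"
      unfolding rel_class_eq_iff[OF xC xs] using s(1)
      by (intro bexI[of _ 0]) (simp_all add: boundary_rlinear chain_bimodule_simps)
    then have "D = HM_proj R X Y ?k (HM_class R X ?k (x - s))" using x(2) HM_proj_class[OF xs] by simp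
    then show "D \<in> HM_proj R X Y ?k ` carrier (HM R X ?k)" using cyc by (auto simp: HM_simps)
  }
qed

text \<open>A cycle of the subcomplex that bounds in \<open>X\<close> is the boundary of a relative cycle.\<close>

lemma exact_at_ext:
  "exact_at (HM_rel R X Y (Suc (Suc j))) (EH (Suc j)) (HM R X (Suc j)) (connect (Suc j)) (HM_incl R X (Suc j))"
  unfolding exact_at_def
proof (intro equalityI subsetI)
  let ?i = "Suc j" and ?k = "Suc (Suc j)"
  fix t
  {
    assume "t \<in> connect ?i ` carrier (HM_rel R X Y ?k)"
    then obtain x where x: "x \<in> rel_cycles ?k" "t = connect ?i (rel_class ?k x)" by (auto simp: HM_rel_simps)
    have xC: "x \<in> carrier (C ?k)" using x(1) by (simp add: rel_cycles_iff)
    obtain t' where t': "t' \<in> carrier (EH ?i)" "comparison ?i t' = cls ?i (boundary X x)" using connect_exists[OF x(1)] by blast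
    have "t = t'" using connect_eq[OF x(1) t'] x(2) by simp
    then have t: "t \<in> carrier (EH ?i)" "HM_incl R X ?i t = HM_class R X ?i (boundary X x)"
      using t' HM_incl_of_comparison[OF t'(1) boundary_in_C[OF xC] t'(2)] by simp_all
    moreover have "boundary X x \<in> boundaries R X ?i"
      using xC unfolding boundaries_def Suc_eq_plus1[symmetric] by (rule imageI)
    ultimately show "t \<in> a_kernel (EH ?i) (HM R X ?i) (HM_incl R X ?i)"
      using HM_class_eq_zero_iff[OF X finite_vertices boundary_in_C[OF xC]] by (simp add: a_kernel_def')
  next
    assume "t \<in> a_kernel (EH ?i) (HM R X ?i) (HM_incl R X ?i)"
    then have t: "t \<in> carrier (EH ?i)" "HM_incl R X ?i t = \<zero>\<^bsub>HM R X ?i\<^esub>" by (simp_all add: a_kernel_def')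
    obtain z where z: "z \<in> Sub ?i" "comparison ?i t = cls ?i z" "HM_incl R X ?i t = HM_class R X ?i z"
      using comparison_image[OF t(1)] by blast
    have "z \<in> boundaries R X ?i"
      using HM_class_eq_zero_iff[OF X finite_vertices Sub_mem(1)[OF z(1)]] t(2) z(3) by simp
    then obtain x where x: "x \<in> carrier (C ?k)" "z = boundary X x" unfolding boundaries_def by auto
    have xr: "x \<in> rel_cycles ?k" using x z(1) by (simp add: rel_cycles_iff)
    have "connect ?i (rel_class ?k x) = t" using z(2) x(2) by (intro connect_eq[OF xr t(1)]) simp
    then show "t \<in> connect ?i ` carrier (HM_rel R X Y ?k)" using xr unfolding HM_rel_simps by blast
  }
qed

text \<open>A cycle with trivial relative class is, up to a boundary, a cycle of the subcomplex, and these are reached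
by \<open>comparison_surj\<close>.\<close>

lemma exact_at_absolute:
  "exact_at (EH (Suc j)) (HM R X (Suc j)) (HM_rel R X Y (Suc j)) (HM_incl R X (Suc j)) (HM_proj R X Y (Suc j))"
  unfolding exact_at_def
proof (intro equalityI subsetI)
  let ?i = "Suc j"
  have zC: "(0 :: ('a, 'r) chains) \<in> carrier (C ?i)" by (simp add: chain_bimodule_simps)
  fix c
  {
    assume "c \<in> HM_incl R X ?i ` carrier (EH ?i)"
    then obtain t where t: "t \<in> carrier (EH ?i)" "c = HM_incl R X ?i t" by blast
    obtain z where z: "z \<in> Sub ?i" "z \<in> cycles R X ?i" "HM_incl R X ?i t = HM_class R X ?i z"
      using comparison_image[OF t(1)] by blast
    have "rel_class ?i z = rel_class ?i 0"
      unfolding rel_class_eq_iff[OF Sub_mem(1)[OF z(1)] zC] using z(1)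
      by (intro bexI[of _ 0]) (simp_all add: boundary_rlinear chain_bimodule_simps)
    then have "HM_proj R X Y ?i c = \<zero>\<^bsub>HM_rel R X Y ?i\<^esub>"
      using HM_proj_class[OF Sub_mem(1)[OF z(1)]] t(2) z(3) by (simp add: rel_class_zero)
    then show "c \<in> a_kernel (HM R X ?i) (HM_rel R X Y ?i) (HM_proj R X Y ?i)"
      using z(2,3) t(2) by (simp add: a_kernel_def' HM_simps)
  next
    assume "c \<in> a_kernel (HM R X ?i) (HM_rel R X Y ?i) (HM_proj R X Y ?i)"
    then obtain z where z: "z \<in> cycles R X ?i" "c = HM_class R X ?i z" "HM_proj R X Y ?i c = rel_class ?i 0"
      by (auto simp: a_kernel_def' HM_simps rel_class_zero)
    have zC': "z \<in> carrier (C ?i)" using z(1) by (simp add: cycles_iff)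
    have "rel_class ?i z = rel_class ?i 0" using z HM_proj_class[OF zC'] by simp
    then obtain x where x: "x \<in> carrier (C (Suc ?i))" "z - boundary X x \<in> Sub ?i"
      using rel_class_eq_iff[OF zC' zC] by auto
    let ?s = "z - boundary X x"
    have "boundary X ?s = 0" using z(1) boundary_boundary_C[OF x(1)] by (simp add: cycles_iff boundary_rlinear)
    then obtain t where t: "t \<in> carrier (EH ?i)" "comparison ?i t = cls ?i ?s" using comparison_surj[OF x(2)] by blast
    have "HM_incl R X ?i t = HM_class R X ?i ?s" by (rule HM_incl_of_comparison[OF t(1) Sub_mem(1)[OF x(2)] t(2)])
    also have "\<dots> = HM_class R X ?i z"
    proof -
      have "?s - z = boundary X (- x)" "- x \<in> carrier (C (Suc ?i))"
        using x(1) by (simp_all add: boundary_rlinear chain_bimodule_simps)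
      then have "?s - z \<in> boundaries R X ?i" unfolding boundaries_def Suc_eq_plus1[symmetric] by (metis imageI)
      then show ?thesis using HM_class_eq_iff[OF X finite_vertices Sub_mem(1)[OF x(2)] zC'] by simp
    qed
    finally show "c \<in> HM_incl R X ?i ` carrier (EH ?i)" using t(1) z(2) by blast
  }
qed

text \<open>In degree 1 all chains are cycles, because the boundary vanishes there.\<close>

lemma HM_proj_surj: "HM_proj R X Y (Suc 0) ` carrier (HM R X (Suc 0)) = carrier (HM_rel R X Y (Suc 0))"
proof -
  have "boundary X x = 0" if "x \<in> carrier (C (Suc 0))" for x
    using boundary_dim_0[OF X] that by (simp add: carrier_chain_bimodule_1)
  then have "cycles R X (Suc 0) = carrier (C (Suc 0))" "rel_cycles (Suc 0) = carrier (C (Suc 0))"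
    using Sub_mem(2) by (auto simp: cycles_iff rel_cycles_def)
  then show ?thesis
    by (simp add: HM_simps HM_rel_simps image_image HM_proj_class)
qed

end

theorem theorem8p18:
  fixes X Y :: "'a precubical" and R :: "'r::field itself"
  assumes "relative_pair X Y"
    and "ext_embeds R X Y"
  defines "A \<equiv> path_algebra R X"
  shows "\<exists>\<delta>.
    (\<forall>i\<ge>1.
       bimodule A A (HM R X i) \<and>
       bimodule A A (HM_rel R X Y i) \<and>
       bimodule A A (ext_scalars R X Y (HM R Y i)) \<and>
       HM_incl R X i \<in> bimodule_hom A A (ext_scalars R X Y (HM R Y i)) (HM R X i) \<and>
       HM_proj R X Y i \<in> bimodule_hom A A (HM R X i) (HM_rel R X Y i) \<and>
       \<delta> i \<in> bimodule_hom A A (HM_rel R X Y (i + 1)) (ext_scalars R X Y (HM R Y i)) \<and>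
       connecting_map R X Y i (\<delta> i) \<and>
       exact_at (HM R X (i + 1)) (HM_rel R X Y (i + 1)) (ext_scalars R X Y (HM R Y i))
         (HM_proj R X Y (i + 1)) (\<delta> i) \<and>
       exact_at (HM_rel R X Y (i + 1)) (ext_scalars R X Y (HM R Y i)) (HM R X i)
         (\<delta> i) (HM_incl R X i) \<and>
       exact_at (ext_scalars R X Y (HM R Y i)) (HM R X i) (HM_rel R X Y i)
         (HM_incl R X i) (HM_proj R X Y i)) \<and>
    HM_proj R X Y 1 ` carrier (HM R X 1) = carrier (HM_rel R X Y 1)"
proof -
  have X: "precubical_set X" "finite (cubes X)" and sub: "sub_precubical Y X"
    using assms(1) by (auto simp: relative_pair_def Cub_def)
  have "cells X 0 \<subseteq> snd ` cubes X" by (force simp: cubes_def)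
  then have "finite (cells X 0)" using X(2) finite_surj by blast
  then interpret embedded_pair X Y R
    using X(1) sub assms(2) by unfold_locales
  show ?thesis
  proof (intro exI[of _ connect] conjI allI impI)
    fix i :: nat assume "1 \<le> i"
    then obtain j where i: "i = Suc j" by (cases i) auto
    show "bimodule A A (HM R X i)" unfolding i A_def by (rule HM_bimodule[OF X(1) finite_vertices])
    show "bimodule A A (HM_rel R X Y i)" unfolding i A_def by (rule HM_rel_bimodule)
    show "bimodule A A (ext_scalars R X Y (HM R Y i))" unfolding i A_def by (rule ext_module.E_bimodule[OF EH])
    show "HM_incl R X i \<in> bimodule_hom A A (ext_scalars R X Y (HM R Y i)) (HM R X i)"
      unfolding i A_def by (rule HM_incl_hom)
    show "HM_proj R X Y i \<in> bimodule_hom A A (HM R X i) (HM_rel R X Y i)"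
      unfolding i A_def by (rule HM_proj_hom)
    show "connect i \<in> bimodule_hom A A (HM_rel R X Y (i + 1)) (ext_scalars R X Y (HM R Y i))"
      unfolding i A_def Suc_eq_plus1[symmetric] by (rule connect_hom)
    show "connecting_map R X Y i (connect i)" unfolding i by (rule connecting_map)
    show "exact_at (HM R X (i + 1)) (HM_rel R X Y (i + 1)) (ext_scalars R X Y (HM R Y i)) (HM_proj R X Y (i + 1)) (connect i)"
      unfolding i Suc_eq_plus1[symmetric] by (rule exact_at_relative)
    show "exact_at (HM_rel R X Y (i + 1)) (ext_scalars R X Y (HM R Y i)) (HM R X i) (connect i) (HM_incl R X i)"
      unfolding i Suc_eq_plus1[symmetric] by (rule exact_at_ext)
    show "exact_at (ext_scalars R X Y (HM R Y i)) (HM R X i) (HM_rel R X Y i) (HM_incl R X i) (HM_proj R X Y i)"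
      unfolding i by (rule exact_at_absolute)
  next
    show "HM_proj R X Y 1 ` carrier (HM R X 1) = carrier (HM_rel R X Y 1)"
      using HM_proj_surj by (simp only: One_nat_def)
  qed
qed

end
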